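(* Fix a centrally symmetric polygon $Q$ with up/down indices and let $\Theta^B_f$ be the lattice congruence of the weak order on $B_n$ whose classes are the fibers of the map $\eta^B$ described below. Let $\vec G^B_f$ be the orientation of the Coxeter diagram $s_0 \overset{4}{-} s_1 - s_2 - \cdots - s_{n-1}$ of $B_n$ given by $s_b\to s_{b-1}$ for every up index $b\in[n-1]$ and $s_{b-1}\to s_b$ for every down index $b\in[n-1]$. Then the quotient lattice $B_n/\Theta^B_f$ is the Cambrian lattice $\mathcal C(\vec G^B_f)$ (i.e. $\Theta^B_f=\Theta(\vec G^B_f)$).
   Context: $B_n$: signed permutations of $\pm[n]$ ($x(-i)=-x(i)$), full notation $x_{-n},\dots,x_{-1},x_1,\dots,x_n$; generators $s_0=(-1\ 1)$, $s_i=(i\ i{+}1)(-i{-}1\ {-i})$, $i\in[n-1]$, with $m(s_0,s_1)=4$, $m(s_i,s_{i+1})=3$. Weak order: $v\le w$ iff $I(v)\subseteq I(w)$, $I(w)$ the reflections $t$ with $\ell(tw)<\ell(w)$. The Cambrian congruence $\Theta(\vec G)$ is the smallest lattice congruence of the weak order such that for each directed edge $s\to t$, $t$ is congruent to the element with word $tsts\cdots$ of $m(s,t)-1$ letters; $\mathcal C(\vec G)$ is the quotient. $Q$: convex $(2n+2)$-gon with vertices $v_i$, $i\in\{\pm1,\dots,\pm(n+1)\}$, $v_{-i}=-v_i$, $x$-coordinates strictly increasing in the order $-n-1<\dots<-1<1<\dots<n+1$, $v_{\pm(n+1)}$ on the $x$-axis; $i$ is up if $v_i$ lies above the axis, down otherwise.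 For $x\in B_n$ with full notation $y_1,\dots,y_{2n}$, paths $\lambda_0,\dots,\lambda_{2n}$ from $v_{-n-1}$ to $v_{n+1}$ visit vertices in increasing index: $\lambda_0$ visits $v_{-n-1}$, all down vertices, $v_{n+1}$; $\lambda_k$ is $\lambda_{k-1}$ with $v_{y_k}$ deleted if $y_k$ down, added if $y_k$ up. $\eta^B(x)$ is the set of diagonals of $Q$ that are edges of some $\lambda_k$. *)

theory Defs
  imports Main
begin

definition SN :: "nat \<Rightarrow> int set" where
  "SN n = {i. 1 \<le> \<bar>i\<bar> \<and> \<bar>i\<bar> \<le> int n}"

definition Bn :: "nat \<Rightarrow> (int \<Rightarrow> int) set" where
  "Bn n = {x. bij x \<and> (\<forall>i. x (-i) = - x i) \<and> (\<forall>i. i \<notin> SN n \<longrightarrow> x i = i)}"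

definition gen :: "nat \<Rightarrow> int \<Rightarrow> int" where
  "gen j = (if j = 0 then (\<lambda>i. if i = 1 then -1 else if i = -1 then 1 else i)
    else (\<lambda>i. if i = int j then int j + 1 else if i = int j + 1 then int j
              else if i = - int j then - int j - 1 else if i = - int j - 1 then - int j
              else i))"

definition word_prod :: "nat list \<Rightarrow> int \<Rightarrow> int" where
  "word_prod ws = foldr (\<lambda>j f. gen j \<circ> f) ws id"

definition len :: "nat \<Rightarrow> (int \<Rightarrow> int) \<Rightarrow> nat" where
  "len n w = (LEAST k. \<exists>ws. length ws = k \<and> set ws \<subseteq> {..<n} \<and> word_prod ws = w)"

definition refls :: "nat \<Rightarrow> (int \<Rightarrow> int) set" where
  "refls n = {w \<circ> gen j \<circ> inv w | w j. w \<in> Bn n \<and> j < n}"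

definition invset :: "nat \<Rightarrow> (int \<Rightarrow> int) \<Rightarrow> (int \<Rightarrow> int) set" where
  "invset n w = {t \<in> refls n. len n (t \<circ> w) < len n w}"

definition weak_le :: "nat \<Rightarrow> (int \<Rightarrow> int) \<Rightarrow> (int \<Rightarrow> int) \<Rightarrow> bool" where
  "weak_le n v w \<longleftrightarrow> invset n v \<subseteq> invset n w"

definition wmeet :: "nat \<Rightarrow> (int \<Rightarrow> int) \<Rightarrow> (int \<Rightarrow> int) \<Rightarrow> (int \<Rightarrow> int)" where
  "wmeet n x y = (THE m. m \<in> Bn n \<and> weak_le n m x \<and> weak_le n m y \<and>
      (\<forall>z \<in> Bn n. weak_le n z x \<and> weak_le n z y \<longrightarrow> weak_le n z m))"

definition wjoin :: "nat \<Rightarrow> (int \<Rightarrow> int) \<Rightarrow> (int \<Rightarrow> int) \<Rightarrow> (int \<Rightarrow> int)" where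
  "wjoin n x y = (THE m. m \<in> Bn n \<and> weak_le n x m \<and> weak_le n y m \<and>
      (\<forall>z \<in> Bn n. weak_le n x z \<and> weak_le n y z \<longrightarrow> weak_le n m z))"

definition lat_cong :: "nat \<Rightarrow> ((int \<Rightarrow> int) \<times> (int \<Rightarrow> int)) set \<Rightarrow> bool" where
  "lat_cong n \<Theta> \<longleftrightarrow> equiv (Bn n) \<Theta> \<and>
     (\<forall>x\<in>Bn n. \<forall>y\<in>Bn n. \<forall>z\<in>Bn n. (x, y) \<in> \<Theta> \<longrightarrow>
        (wmeet n x z, wmeet n y z) \<in> \<Theta> \<and> (wjoin n x z, wjoin n y z) \<in> \<Theta>)"

text \<open>Coxeter labels m(s_i,s_j) for adjacent generators i,j of the diagram.\<close>
definition coxm :: "nat \<Rightarrow> nat \<Rightarrow> nat" where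
  "coxm i j = (if min i j = 0 then 4 else 3)"

fun altw :: "nat \<Rightarrow> nat \<Rightarrow> nat \<Rightarrow> nat list" where
  "altw t s 0 = []"
| "altw t s (Suc k) = t # altw s t k"

text \<open>Directed edges (s,t) mean s -> t; the smallest lattice congruence with
  t congruent to the element with word t s t s ... (m(s,t)-1 letters).\<close>
definition cambrian_cong :: "nat \<Rightarrow> (nat \<times> nat) set \<Rightarrow> ((int \<Rightarrow> int) \<times> (int \<Rightarrow> int)) set" where
  "cambrian_cong n E = {(x, y). \<forall>\<Theta>. lat_cong n \<Theta> \<and>
      (\<forall>(s, t) \<in> E. (gen t, word_prod (altw t s (coxm s t - 1))) \<in> \<Theta>) \<longrightarrow> (x, y) \<in> \<Theta>}"

definition orient :: "nat \<Rightarrow> int set \<Rightarrow> (nat \<times> nat) set" where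
  "orient n U = {(b, b - 1) | b. 1 \<le> b \<and> b < n \<and> int b \<in> U}
              \<union> {(b - 1, b) | b. 1 \<le> b \<and> b < n \<and> int b \<notin> U}"

text \<open>Vertices of Q are indexed by SN (n+1); U is the set of up indices.\<close>
definition path_edges :: "int set \<Rightarrow> (int \<times> int) set" where
  "path_edges S = {(a, b). a \<in> S \<and> b \<in> S \<and> a < b \<and> \<not> (\<exists>c\<in>S. a < c \<and> c < b)}"

definition diagQ :: "nat \<Rightarrow> int set \<Rightarrow> (int \<times> int) set" where
  "diagQ n U = {(a, b). a \<in> SN (n + 1) \<and> b \<in> SN (n + 1) \<and> a < b}
     - path_edges (U \<union> {- (int n + 1), int n + 1})
     - path_edges ((SN n - U) \<union> {- (int n + 1), int n + 1})"

definition fullnot :: "nat \<Rightarrow> (int \<Rightarrow> int) \<Rightarrow> nat \<Rightarrow> int" where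
  "fullnot n x k = x (if k \<le> n then int k - int n - 1 else int k - int n)"

fun lam :: "nat \<Rightarrow> int set \<Rightarrow> (int \<Rightarrow> int) \<Rightarrow> nat \<Rightarrow> int set" where
  "lam n U x 0 = {- (int n + 1), int n + 1} \<union> (SN n - U)"
| "lam n U x (Suc k) = (let y = fullnot n x (Suc k) in
      if y \<in> U then insert y (lam n U x k) else lam n U x k - {y})"

definition etaB :: "nat \<Rightarrow> int set \<Rightarrow> (int \<Rightarrow> int) \<Rightarrow> (int \<times> int) set" where
  "etaB n U x = (\<Union>k\<in>{0..2*n}. path_edges (lam n U x k)) \<inter> diagQ n U"

end

theory Submission
  imports Defs
begin

text \<open>The weak order is inclusion of the sets \<open>Inv n x\<close> of inverted pairs of values, and these sets are
  exactly the symmetric, transitive and co-transitive ones; hence it is a lattice.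

  A cover exchanging the entries \<open>a < c\<close> leaves \<open>etaB\<close> unchanged if there is a witness: an index
  \<open>b\<close> strictly between \<open>a\<close> and \<open>c\<close> that is up and precedes both, or down and follows both. Each
  fibre has a least element whose inversion set depends monotonically on that of the given element,
  distinct least elements have distinct diagonals, and complementing inversion sets exchanges up and
  down. So the fibres are the classes of a lattice congruence, which contains the generating relations.

  Conversely, a congruence containing the generating relations contracts every cover with a witness,
  by induction on the width \<open>c - a\<close> and then on the inversion set: either the cover has the same
  label as a lower one, or it is forced by a narrower one, or it is part of a generating relation.\<close>

section \<open>The weak order in terms of inverted pairs of values\<close>

text \<open>A reflection is recorded as a pair of values together with its mirror image, so type B
  becomes type A plus invariance under \<open>(a, c) \<mapsto> (- c, - a)\<close>. The price is paid
  at the centre: the interval spanned by \<open>gen 0\<close> and \<open>gen 1\<close> is an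
  octagon, and the negative of a nearby entry may fall between the exchanged entries. The special
  cases \<open>k = 0\<close> and \<open>k = 1\<close> below come from this.

  Both inclusions rest on one walk: going up from the least element of a fibre to a given
  \<open>x\<close>, every cover has a witness (\<open>ex_witness\<close>). Such covers preserve
  \<open>etaB\<close>, and every congruence containing the generating relations contracts them.

  The delicate point of the converse is well-foundedness. Removing a disturbing descent moves down
  and is covered by the inner induction. But when a second entry lies inside the range one has to
  move up, where that induction says nothing. There the larger cover is contracted by means of
  narrower covers alone, and \<open>slide_down\<close> carries the result back.\<close>

lemma uminus_SN [simp]: "- i \<in> SN n \<longleftrightarrow> i \<in> SN n"
  by (auto simp: SN_def)

lemma zero_notin_SN [simp]: "0 \<notin> SN n"
  by (auto simp: SN_def)

lemma SN_iff: "i \<in> SN n \<longleftrightarrow> i \<noteq> 0 \<and> - int n \<le> i \<and> i \<le> int n"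
  by (auto simp: SN_def)

lemma finite_SN [simp]: "finite (SN n)"
  by (rule finite_subset[of _ "{- int n..int n}"]) (auto simp: SN_iff)

lemma Bn_bij: "x \<in> Bn n \<Longrightarrow> bij x"
  and Bn_uminus: "x \<in> Bn n \<Longrightarrow> x (- i) = - x i"
  and Bn_out: "x \<in> Bn n \<Longrightarrow> i \<notin> SN n \<Longrightarrow> x i = i"
  by (auto simp: Bn_def)

lemma Bn_eq_iff: "x \<in> Bn n \<Longrightarrow> x i = x j \<longleftrightarrow> i = j"
  using Bn_bij bij_is_inj inj_eq by metis

lemma Bn_SN: assumes "x \<in> Bn n" shows "x i \<in> SN n \<longleftrightarrow> i \<in> SN n"
  using Bn_out[OF assms] Bn_eq_iff[OF assms] by metis

lemma Bn_eq_uminus_iff: "x \<in> Bn n \<Longrightarrow> x i = - x j \<longleftrightarrow> i = - j"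
  using Bn_eq_iff Bn_uminus by metis

lemma Bn_id: "id \<in> Bn n"
  by (auto simp: Bn_def)

lemma Bn_comp: assumes "x \<in> Bn n" "y \<in> Bn n" shows "x \<circ> y \<in> Bn n"
  using assms by (auto simp: Bn_def bij_comp)

lemma Bn_inv_f [simp]: "x \<in> Bn n \<Longrightarrow> inv x (x i) = i"
  and Bn_f_inv [simp]: "x \<in> Bn n \<Longrightarrow> x (inv x i) = i"
  by (simp_all add: Bn_bij bij_is_inj bij_is_surj surj_f_inv_f)

lemma Bn_inv: assumes "x \<in> Bn n" shows "inv x \<in> Bn n"
proof -
  have "inv x (- i) = - inv x i" for i
    using Bn_inv_f[OF assms, of "- inv x i"] Bn_uminus[OF assms] assms by simp
  moreover have "inv x i = i" if "i \<notin> SN n" for i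
    using Bn_inv_f[OF assms, of i] Bn_out[OF assms that] by simp
  ultimately show ?thesis
    using bij_imp_bij_inv[OF Bn_bij[OF assms]] by (simp add: Bn_def)
qed

lemma Bn_inv_uminus: "x \<in> Bn n \<Longrightarrow> inv x (- i) = - inv x i"
  using Bn_inv Bn_uminus by blast

lemma gen_gen [simp]: "gen j (gen j i) = i"
  by (auto simp: gen_def)

lemma gen_comp_gen [simp]: "gen j \<circ> gen j = id" "f \<circ> gen j \<circ> gen j = f"
  by (auto simp: fun_eq_iff)

lemma gen_Bn: assumes "j < n" shows "gen j \<in> Bn n"
proof -
  have "bij (gen j)" by (rule involuntory_imp_bij) simp
  moreover have "gen j (- i) = - gen j i" for i by (auto simp: gen_def)
  moreover have "gen j i = i" if "i \<notin> SN n" for i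
    using that assms by (auto simp: gen_def SN_def)
  ultimately show ?thesis by (auto simp: Bn_def)
qed

lemma Bn_comp_gen [simp]: "x \<in> Bn n \<Longrightarrow> j < n \<Longrightarrow> x \<circ> gen j \<in> Bn n"
  using Bn_comp gen_Bn by blast

lemma inv_comp_gen: assumes "x \<in> Bn n" shows "inv (x \<circ> gen j) = gen j \<circ> inv x"
  by (rule inv_unique_comp) (use assms in \<open>auto simp: fun_eq_iff\<close>)

text \<open>Right multiplication by \<open>gen j\<close> exchanges the entries at the positions \<open>posl j\<close> and
  \<open>posr j\<close>, which are consecutive in \<open>SN n\<close>.\<close>

definition posl :: "nat \<Rightarrow> int" where
  "posl j = (if j = 0 then - 1 else int j)"

definition posr :: "nat \<Rightarrow> int" where
  "posr j = int j + 1"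

lemma pos_SN [simp]: "j < n \<Longrightarrow> posl j \<in> SN n" "j < n \<Longrightarrow> posr j \<in> SN n"
  by (auto simp: posl_def posr_def SN_def)

lemma posl_less_posr: "posl j < posr j"
  by (auto simp: posl_def posr_def)

lemma gen_pos [simp]: "gen j (posl j) = posr j" "gen j (posr j) = posl j"
  by (auto simp: posl_def posr_def gen_def)

text \<open>Zero must be excluded: it lies between \<open>-1\<close> and \<open>1\<close>, so
  \<open>gen 0\<close> would invert it against both.\<close>

lemma gen_inverts:
  assumes "p < q" "p \<noteq> 0" "q \<noteq> 0"
  shows "gen j q < gen j p \<longleftrightarrow> p = posl j \<and> q = posr j \<or> p = - posr j \<and> q = - posl j"
  using assms by (auto simp: gen_def posl_def posr_def)

definition Pairs :: "nat \<Rightarrow> (int \<times> int) set" where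
  "Pairs n = {(a, c). a \<in> SN n \<and> c \<in> SN n \<and> a < c}"

text \<open>Values rather than positions, because the weak order multiplies by reflections from the
  left, and these exchange values. A reflection corresponds to a pair and its mirror image, which
  coincide exactly for sign changes.\<close>

definition Inv :: "nat \<Rightarrow> (int \<Rightarrow> int) \<Rightarrow> (int \<times> int) set" where
  "Inv n x = {(a, c) \<in> Pairs n. inv x c < inv x a}"

lemma finite_Pairs [simp]: "finite (Pairs n)"
  by (rule finite_subset[of _ "SN n \<times> SN n"]) (auto simp: Pairs_def)

lemma Inv_subset_Pairs: "Inv n x \<subseteq> Pairs n"
  by (auto simp: Inv_def)

lemma finite_Inv [simp]: "finite (Inv n x)"
  using Inv_subset_Pairs finite_Pairs finite_subset by blast

lemma Inv_at:
  assumes "x \<in> Bn n"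
  shows "(x p, x q) \<in> Inv n x \<longleftrightarrow> p \<in> SN n \<and> q \<in> SN n \<and> x p < x q \<and> q < p"
  using assms by (auto simp: Inv_def Pairs_def Bn_SN)

lemma Inv_id [simp]: "Inv n id = {}"
  by (auto simp: Inv_def Pairs_def)

text \<open>Only two entries in consecutive positions, and their mirror images, change their
  relative order. For \<open>j = 0\<close> the two added pairs coincide.\<close>

lemma Inv_gen:
  assumes x: "x \<in> Bn n" and j: "j < n" and asc: "x (posl j) < x (posr j)"
  shows "Inv n (x \<circ> gen j) = Inv n x \<union> {(x (posl j), x (posr j)), (- x (posr j), - x (posl j))}"
    (is "?L = ?R")
proof -
  have "(x p, x q) \<in> ?L \<longleftrightarrow> (x p, x q) \<in> ?R" for p q
  proof -
    have l: "(x p, x q) \<in> ?L \<longleftrightarrow> p \<in> SN n \<and> q \<in> SN n \<and> x p < x q \<and> gen j q < gen j p"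
      using x by (auto simp: Inv_def Pairs_def Bn_SN inv_comp_gen)
    have r: "(x p, x q) \<in> ?R \<longleftrightarrow> p \<in> SN n \<and> q \<in> SN n \<and> x p < x q \<and> q < p \<or>
        p = posl j \<and> q = posr j \<or> p = - posr j \<and> q = - posl j"
      using Inv_at[OF x, of p q] Bn_eq_iff[OF x] Bn_eq_uminus_iff[OF x] by simp blast
    show ?thesis
    proof (cases p q rule: linorder_cases)
      case less
      have "p \<noteq> 0 \<and> q \<noteq> 0" if "p \<in> SN n \<and> q \<in> SN n" using that by (auto simp: SN_iff)
      then show ?thesis
        using less gen_inverts[of p q j] asc j x unfolding l r by (auto simp: Bn_uminus)
    next
      case equal then show ?thesis using posl_less_posr[of j] unfolding l r by auto
    next
      case greater
      have "p \<noteq> 0 \<and> q \<noteq> 0" if "p \<in> SN n \<and> q \<in> SN n" using that by (auto simp: SN_iff)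
      moreover have "gen j p \<noteq> gen j q" using greater by (metis gen_gen less_irrefl)
      ultimately show ?thesis
        using greater gen_inverts[of q p j] asc j x posl_less_posr[of j] unfolding l r
        by (auto simp: Bn_uminus)
    qed
  qed
  then have "(a, c) \<in> ?L \<longleftrightarrow> (a, c) \<in> ?R" for a c using x by (metis Bn_f_inv)
  then show ?thesis by auto
qed

lemma Inv_gen_notin:
  assumes x: "x \<in> Bn n" and asc: "x (posl j) < x (posr j)"
  shows "(x (posl j), x (posr j)) \<notin> Inv n x" "(- x (posr j), - x (posl j)) \<notin> Inv n x"
  using Inv_at[OF x, of "posl j" "posr j"] Inv_at[OF x, of "- posr j" "- posl j"] posl_less_posr[of j]
  by (auto simp: Bn_uminus[OF x])

lemma Inv_gen_asc: "x \<in> Bn n \<Longrightarrow> j < n \<Longrightarrow> x (posl j) < x (posr j) \<Longrightarrow> Inv n x \<subset> Inv n (x \<circ> gen j)"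
  using Inv_gen[of x n j] Inv_gen_notin[of x n j] by auto

lemma Inv_gen_desc:
  assumes "x \<in> Bn n" "j < n" "x (posr j) < x (posl j)"
  shows "Inv n (x \<circ> gen j) \<subset> Inv n x"
  using Inv_gen_asc[of "x \<circ> gen j" n j] assms by simp

lemma Bn_pos_neq: "x \<in> Bn n \<Longrightarrow> x (posl j) \<noteq> x (posr j)"
  using Bn_eq_iff posl_less_posr[of j] by (metis less_irrefl)

text \<open>A squeeze: counting up from \<open>x 1 > 0\<close>, which the ascent at
  \<open>gen 0\<close> supplies, gives \<open>x k \<ge> k\<close>; counting down from
  \<open>x n \<le> n\<close> gives \<open>x k \<le> k\<close>.\<close>

lemma no_descent_id:
  assumes x: "x \<in> Bn n" and asc: "\<And>j. j < n \<Longrightarrow> x (posl j) < x (posr j)"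
  shows "x = id"
proof -
  have lo: "1 \<le> k \<Longrightarrow> k \<le> n \<Longrightarrow> int k \<le> x (int k)" for k
  proof (induction k rule: dec_induct)
    case base
    then have "x (-1) < x 1" using asc[of 0] by (simp add: posl_def posr_def)
    then show ?case using Bn_uminus[OF x, of 1] by simp
  next
    case (step k)
    then show ?case using asc[of k] by (simp add: posl_def posr_def add.commute)
  qed
  have hi: "k \<le> n \<Longrightarrow> 1 \<le> k \<Longrightarrow> x (int k) \<le> int k" for k
  proof (induction k rule: inc_induct)
    case base
    then have "x (int n) \<in> SN n" using Bn_SN[OF x] by (auto simp: SN_iff)
    then show ?case by (simp add: SN_iff)
  next
    case (step k)
    then show ?case using asc[of k] by (simp add: posl_def posr_def add.commute)
  qed
  have pos: "x i = i" if "0 < i" for i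
  proof (cases "i \<in> SN n")
    case True
    then have "Suc 0 \<le> nat i" "nat i \<le> n" using that by (auto simp: SN_iff)
    then show ?thesis using lo[of "nat i"] hi[of "nat i"] that by simp
  qed (use Bn_out[OF x] in auto)
  have "x i = i" for i
    using pos[of i] pos[of "-i"] Bn_out[OF x, of 0] Bn_uminus[OF x, of "i"]
    by (cases i "0::int" rule: linorder_cases) auto
  then show ?thesis by auto
qed

text \<open>Entries in consecutive positions of \<open>x\<close> appear in the same order in
  \<open>y\<close>, so \<open>inv y \<circ> x\<close> has no descent.\<close>

lemma Inv_inject:
  assumes x: "x \<in> Bn n" and y: "y \<in> Bn n" and eq: "Inv n x = Inv n y"
  shows "x = y"
proof -
  let ?g = "inv y \<circ> x"
  have g: "?g \<in> Bn n" using Bn_comp Bn_inv x y by blast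
  have "?g (posl j) < ?g (posr j)" if j: "j < n" for j
  proof -
    let ?p = "posl j" and ?q = "posr j"
    consider "x ?p < x ?q" | "x ?q < x ?p" using Bn_pos_neq[OF x] by (metis linorder_cases)
    then show ?thesis
    proof cases
      case 1
      then have "(x ?p, x ?q) \<notin> Inv n y" using Inv_gen_notin x eq by blast
      then have "inv y (x ?p) \<le> inv y (x ?q)" using 1 j x by (auto simp: Inv_def Pairs_def Bn_SN)
      moreover have "inv y (x ?p) \<noteq> inv y (x ?q)" using 1 y by (metis Bn_f_inv less_irrefl)
      ultimately show ?thesis by simp
    next
      case 2
      then have "(x ?q, x ?p) \<in> Inv n y" using Inv_at[OF x, of ?q ?p] eq j posl_less_posr by simp
      then show ?thesis by (simp add: Inv_def)
    qed
  qed
  then have "?g = id" using no_descent_id[OF g] by blast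
  then have "y (?g i) = y i" for i by simp
  then show ?thesis using y by (auto simp: fun_eq_iff)
qed

section \<open>Sets of pairs that occur as inversion sets\<close>

definition good :: "nat \<Rightarrow> (int \<times> int) set \<Rightarrow> bool" where
  "good n S \<longleftrightarrow> S \<subseteq> Pairs n \<and> (\<forall>a c. (a, c) \<in> S \<longrightarrow> (- c, - a) \<in> S) \<and> trans S \<and>
     (\<forall>a b c. (a, c) \<in> S \<longrightarrow> b \<in> SN n \<longrightarrow> a < b \<longrightarrow> b < c \<longrightarrow> (a, b) \<in> S \<or> (b, c) \<in> S)"

lemma good_Pairs: "good n S \<Longrightarrow> S \<subseteq> Pairs n"
  and good_sym: "good n S \<Longrightarrow> (a, c) \<in> S \<Longrightarrow> (- c, - a) \<in> S"
  and good_trans: "good n S \<Longrightarrow> trans S"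
  and good_coclosed: "good n S \<Longrightarrow> (a, c) \<in> S \<Longrightarrow> b \<in> SN n \<Longrightarrow> a < b \<Longrightarrow> b < c \<Longrightarrow> (a, b) \<in> S \<or> (b, c) \<in> S"
  by (auto simp: good_def)

lemma good_Inv: assumes "x \<in> Bn n" shows "good n (Inv n x)"
  unfolding good_def
  using Inv_subset_Pairs[of n x]
  by (auto simp: Inv_def Pairs_def Bn_inv_uminus[OF assms] intro!: transI)

lemma good_Compl: assumes "good n S" shows "good n (Pairs n - S)"
  unfolding good_def
proof (intro conjI allI impI)
  show "trans (Pairs n - S)"
    using good_coclosed[OF assms] by (force simp: Pairs_def intro!: transI)
next
  fix a b c assume "(a, c) \<in> Pairs n - S" "b \<in> SN n" "a < b" "b < c"
  then show "(a, b) \<in> Pairs n - S \<or> (b, c) \<in> Pairs n - S"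
    using good_trans[OF assms] by (auto simp: Pairs_def dest: transD)
next
  fix a c assume "(a, c) \<in> Pairs n - S"
  then show "(- c, - a) \<in> Pairs n - S"
    using good_sym[OF assms, of "-c" "-a"] by (auto simp: Pairs_def)
qed auto

lemma trans_Pairs: "trans (Pairs n)"
  by (auto simp: Pairs_def intro!: transI)

text \<open>Only co-transitivity needs care. On a chain from \<open>a\<close> to \<open>c\<close>,
  the element \<open>b\<close> either falls within the initial part, where the induction hypothesis
  applies, or inside the last step, which co-transitivity of \<open>S\<close> or \<open>T\<close>
  cuts.\<close>

lemma good_trancl_Un:
  assumes S: "good n S" and T: "good n T" shows "good n ((S \<union> T)\<^sup>+)"
  unfolding good_def
proof (intro conjI allI impI)
  have "(S \<union> T)\<^sup>+ \<subseteq> (Pairs n)\<^sup>+"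
    using good_Pairs S T by (intro trancl_mono_subset) auto
  then show sub: "(S \<union> T)\<^sup>+ \<subseteq> Pairs n" using trans_Pairs by (simp add: trancl_id)
  fix a c assume ac: "(a, c) \<in> (S \<union> T)\<^sup>+"
  then show "(- c, - a) \<in> (S \<union> T)\<^sup>+"
  proof (induction rule: trancl_induct)
    case (base y)
    then show ?case using good_sym S T by blast
  next
    case (step y z)
    then have "(- z, - y) \<in> S \<union> T" using good_sym S T by blast
    then show ?case using step.IH by (meson trancl_into_trancl2)
  qed
  fix b assume b: "b \<in> SN n" "a < b" "b < c"
  from ac b(3) show "(a, b) \<in> (S \<union> T)\<^sup>+ \<or> (b, c) \<in> (S \<union> T)\<^sup>+"
  proof (induction rule: trancl_induct)
    case (base c)
    then show ?case using good_coclosed S T b by blast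
  next
    case (step y z)
    show ?case
    proof (cases b y rule: linorder_cases)
      case less
      then show ?thesis using step by (meson trancl_into_trancl)
    next
      case equal
      then show ?thesis using step by auto
    next
      case greater
      then have "(y, b) \<in> S \<union> T \<or> (b, z) \<in> S \<union> T" using step good_coclosed S T b by blast
      then show ?thesis using step.hyps(1) by (meson r_into_trancl' trancl_into_trancl)
    qed
  qed
qed auto

text \<open>A pair of \<open>S - Inv n x\<close> at minimal distance occupies consecutive positions of \<open>x\<close>.\<close>
lemma good_step:
  assumes x: "x \<in> Bn n" and S: "good n S" and sub: "Inv n x \<subset> S"
  obtains j where "j < n" "x (posl j) < x (posr j)" "Inv n (x \<circ> gen j) \<subseteq> S"
proof -
  define P where "P d \<longleftrightarrow> (\<exists>p q. p < q \<and> (x p, x q) \<in> S \<and> nat (q - p) = d)" for d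
  have "\<exists>d. P d"
  proof -
    obtain a c where ac: "(a, c) \<in> S" "(a, c) \<notin> Inv n x" using sub by auto
    then have "inv x a \<le> inv x c" "a < c" using good_Pairs[OF S] by (auto simp: Inv_def Pairs_def)
    moreover have "inv x a \<noteq> inv x c" using x \<open>a < c\<close> by (metis Bn_f_inv less_irrefl)
    ultimately have "inv x a < inv x c" by simp
    then show ?thesis unfolding P_def using ac(1) x by (metis Bn_f_inv)
  qed
  then have "P (LEAST d. P d)" by (rule LeastI_ex)
  then obtain p q where pq: "p < q" "(x p, x q) \<in> S" "nat (q - p) = (LEAST d. P d)"
    unfolding P_def by blast
  have min: "(x p', x q') \<notin> S" if "p' < q'" "q' - p' < q - p" for p' q'
  proof
    assume "(x p', x q') \<in> S"
    then have "P (nat (q' - p'))" using that P_def by blast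
    then have "nat (q - p) \<le> nat (q' - p')" using pq(3) by (simp add: Least_le)
    then show False using that by linarith
  qed
  have SN: "p \<in> SN n" "q \<in> SN n" "x p < x q"
    using pq(2) good_Pairs[OF S] x by (auto simp: Pairs_def Bn_SN)
  \<comment> \<open>An entry in between would yield, by transitivity or co-transitivity of
    \<open>S\<close>, a pair of \<open>S\<close> at smaller distance.\<close>
  have adj: "\<not> (p < r \<and> r < q)" if r: "r \<in> SN n" for r
  proof
    assume prq: "p < r \<and> r < q"
    have ne: "x r \<noteq> x p" "x r \<noteq> x q" using prq x by (auto simp: Bn_eq_iff)
    have nS: "(x p, x r) \<notin> S" "(x r, x q) \<notin> S" using min prq by auto
    consider "x r < x p" | "x p < x r" "x r < x q" | "x q < x r" using ne by linarith
    then show False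
    proof cases
      case 1
      then have "(x r, x p) \<in> S" using sub r SN prq Inv_at[OF x, of r p] by blast
      then show False using pq(2) good_trans[OF S] nS by (auto dest: transD)
    next
      case 2
      then show False using good_coclosed[OF S pq(2), of "x r"] nS r x by (auto simp: Bn_SN)
    next
      case 3
      then have "(x q, x r) \<in> S" using sub r SN prq Inv_at[OF x, of q r] by blast
      then show False using pq(2) good_trans[OF S] nS by (auto dest: transD)
    qed
  qed
  have "\<exists>j<n. p = posl j \<and> q = posr j \<or> p = - posr j \<and> q = - posl j"
  proof -
    consider "0 < p" | "q < 0" | "p < 0" "0 < q" using SN unfolding SN_iff by linarith
    then show ?thesis
    proof cases
      case 1
      then have "q = p + 1" using adj[of "p + 1"] SN pq(1) by (auto simp: SN_iff)
      then show ?thesis using 1 SN by (intro exI[of _ "nat p"]) (auto simp: posl_def posr_def SN_iff)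
    next
      case 2
      then have "q = p + 1" using adj[of "p + 1"] SN pq(1) by (auto simp: SN_iff)
      then show ?thesis using 2 SN by (intro exI[of _ "nat (-q)"]) (auto simp: posl_def posr_def SN_iff)
    next
      case 3
      then have "q = 1" "p = -1" using adj[of 1] adj[of "-1"] SN by (auto simp: SN_iff)
      then show ?thesis using SN by (intro exI[of _ 0]) (auto simp: posl_def posr_def SN_iff)
    qed
  qed
  then obtain j where j: "j < n" "p = posl j \<and> q = posr j \<or> p = - posr j \<and> q = - posl j" by blast
  have jS: "(x (posl j), x (posr j)) \<in> S"
    using j(2) pq(2) good_sym[OF S pq(2)] Bn_uminus[OF x] by auto
  then have jl: "x (posl j) < x (posr j)" using good_Pairs[OF S] by (auto simp: Pairs_def)
  have "Inv n (x \<circ> gen j) \<subseteq> S"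
    unfolding Inv_gen[OF x j(1) jl] using sub jS good_sym[OF S jS] by auto
  then show thesis using that j(1) jl by blast
qed

text \<open>Each \<open>good_step\<close> appends one generator until no pair is missing. Keeping
  the word also shows that the generators generate \<open>Bn n\<close>, without which
  \<open>len\<close> would not be meaningful.\<close>

lemma good_realize_above:
  assumes S: "good n S"
  shows "x \<in> Bn n \<Longrightarrow> Inv n x \<subseteq> S \<Longrightarrow>
    \<exists>ws. set ws \<subseteq> {..<n} \<and> x \<circ> word_prod ws \<in> Bn n \<and> Inv n (x \<circ> word_prod ws) = S"
proof (induction "card (S - Inv n x)" arbitrary: x rule: less_induct)
  case less
  show ?case
  proof (cases "Inv n x = S")
    case True
    then show ?thesis using less.prems by (intro exI[of _ "[]"]) (auto simp: word_prod_def)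
  next
    case False
    then obtain j where j: "j < n" "x (posl j) < x (posr j)" "Inv n (x \<circ> gen j) \<subseteq> S"
      using good_step[OF less.prems(1) S] less.prems(2) by blast
    have "finite S" using good_Pairs[OF S] finite_subset finite_Pairs by blast
    then have "card (S - Inv n (x \<circ> gen j)) < card (S - Inv n x)"
      using Inv_gen_asc[OF less.prems(1) j(1,2)] j(3) by (intro psubset_card_mono) auto
    then obtain ws where ws: "set ws \<subseteq> {..<n}" "x \<circ> gen j \<circ> word_prod ws \<in> Bn n"
      "Inv n (x \<circ> gen j \<circ> word_prod ws) = S"
      using less.hyps less.prems(1) j by (meson Bn_comp_gen)
    then show ?thesis using j(1) by (intro exI[of _ "j # ws"]) (auto simp: word_prod_def o_assoc)
  qed
qed

lemma good_realize: assumes "good n S" obtains x where "x \<in> Bn n" "Inv n x = S"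
  using good_realize_above[OF assms Bn_id] by auto

lemma Bn_word: assumes "x \<in> Bn n" obtains ws where "set ws \<subseteq> {..<n}" "word_prod ws = x"
  using good_realize_above[OF good_Inv[OF assms] Bn_id] assms Inv_inject by auto

lemma word_prod_append: "word_prod (us @ ws) = word_prod us \<circ> word_prod ws"
  by (induction us) (auto simp: word_prod_def)

lemma word_prod_Bn: "set ws \<subseteq> {..<n} \<Longrightarrow> word_prod ws \<in> Bn n"
proof (induction ws)
  case Nil then show ?case using Bn_id by (simp add: word_prod_def id_def)
next
  case (Cons j ws) then have "gen j \<circ> word_prod ws \<in> Bn n" using Bn_comp gen_Bn by auto
  then show ?case by (simp add: word_prod_def o_def)
qed

section \<open>Reflections and the length function\<close>

definition refl_swap :: "int \<Rightarrow> int \<Rightarrow> int \<Rightarrow> int" where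
  "refl_swap a c i = (if i = a then c else if i = c then a else if i = - a then - c
     else if i = - c then - a else i)"

lemma refl_swap_invol [simp]: "a \<noteq> 0 \<Longrightarrow> c \<noteq> 0 \<Longrightarrow> refl_swap a c (refl_swap a c i) = i"
  by (auto simp: refl_swap_def split: if_splits)

lemma refl_swap_comp [simp]:
  "a \<noteq> 0 \<Longrightarrow> c \<noteq> 0 \<Longrightarrow> refl_swap a c \<circ> (refl_swap a c \<circ> f) = f"
  by (simp add: fun_eq_iff)

lemma refl_swap_commute: "refl_swap a c = refl_swap c a"
  by (rule ext) (simp add: refl_swap_def)

lemma refl_swap_uminus: "a \<noteq> 0 \<Longrightarrow> c \<noteq> 0 \<Longrightarrow> refl_swap (- c) (- a) = refl_swap a c"
  by (rule ext) (auto simp: refl_swap_def)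

lemma refl_swap_Bn: assumes "a \<in> SN n" "c \<in> SN n" shows "refl_swap a c \<in> Bn n"
proof -
  have ne: "a \<noteq> 0" "c \<noteq> 0" using assms by (auto simp: SN_iff)
  have "bij (refl_swap a c)" by (rule involuntory_imp_bij) (simp add: ne)
  moreover have "refl_swap a c (- i) = - refl_swap a c i" for i
    using ne by (auto simp: refl_swap_def)
  moreover have "refl_swap a c i = i" if "i \<notin> SN n" for i
    using that assms by (auto simp: refl_swap_def)
  ultimately show ?thesis by (auto simp: Bn_def)
qed

lemma gen_eq_refl_swap: "gen j = refl_swap (posl j) (posr j)"
  by (auto simp: refl_swap_def gen_def posl_def posr_def fun_eq_iff)

lemma comp_gen_eq_refl_swap:
  assumes "x \<in> Bn n" shows "x \<circ> gen j = refl_swap (x (posl j)) (x (posr j)) \<circ> x"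
  unfolding gen_eq_refl_swap
  using Bn_eq_iff[OF assms] Bn_eq_uminus_iff[OF assms] Bn_uminus[OF assms]
  by (simp add: refl_swap_def fun_eq_iff)

lemma refl_swap_in_refls:
  assumes "x \<in> Bn n" "j < n" shows "refl_swap (x (posl j)) (x (posr j)) \<in> refls n"
proof -
  have "x \<circ> gen j \<circ> inv x = refl_swap (x (posl j)) (x (posr j))"
    using assms by (auto simp: comp_gen_eq_refl_swap fun_eq_iff)
  then show ?thesis using assms unfolding refls_def by (metis (mono_tags, lifting) mem_Collect_eq)
qed

lemma reflsE:
  assumes "t \<in> refls n" obtains a c where "(a, c) \<in> Pairs n" "t = refl_swap a c"
proof -
  obtain w j where w: "w \<in> Bn n" "j < n" "t = w \<circ> gen j \<circ> inv w"
    using assms by (auto simp: refls_def)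
  have t: "t = refl_swap (w (posl j)) (w (posr j))"
    using w by (auto simp: comp_gen_eq_refl_swap fun_eq_iff)
  have "(w (posl j), w (posr j)) \<in> Pairs n \<or> (w (posr j), w (posl j)) \<in> Pairs n"
    using Bn_pos_neq[OF w(1), of j] w by (auto simp: Pairs_def Bn_SN)
  then show thesis using that t refl_swap_commute by metis
qed

text \<open>The exchange property: delete the first letter after which the pair is inverted.\<close>
lemma exchange:
  "set ws \<subseteq> {..<n} \<Longrightarrow> (a, c) \<in> Inv n (word_prod ws) \<Longrightarrow> refl_swap a c \<in> refls n \<and>
    (\<exists>us. length us < length ws \<and> set us \<subseteq> {..<n} \<and> word_prod us = refl_swap a c \<circ> word_prod ws)"
proof (induction ws rule: rev_induct)
  case Nil
  then show ?case by (simp add: word_prod_def flip: id_def)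
next
  case (snoc j ws)
  let ?u = "word_prod ws"
  have u: "?u \<in> Bn n" and j: "j < n" using snoc.prems word_prod_Bn by auto
  have wj: "word_prod (ws @ [j]) = ?u \<circ> gen j" by (simp add: word_prod_append) (simp add: word_prod_def)
  show ?case
  proof (cases "(a, c) \<in> Inv n ?u")
    case True
    then obtain us where us: "length us < length ws" "set us \<subseteq> {..<n}"
      "word_prod us = refl_swap a c \<circ> ?u" "refl_swap a c \<in> refls n"
      using snoc.IH snoc.prems(1) by (metis set_append le_sup_iff)
    then have "word_prod (us @ [j]) = refl_swap a c \<circ> word_prod (ws @ [j])"
      unfolding wj by (simp add: word_prod_append) (simp add: word_prod_def o_assoc)
    then show ?thesis using us j by (intro conjI exI[of _ "us @ [j]"]) auto
  next
    case False
    then have "?u (posl j) < ?u (posr j)"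
      using Inv_gen_desc[OF u j] snoc.prems(2) Bn_pos_neq[OF u] unfolding wj
      by (metis linorder_cases psubsetD)
    then have "(a, c) = (?u (posl j), ?u (posr j)) \<or> (a, c) = (- ?u (posr j), - ?u (posl j))"
      using snoc.prems(2) False Inv_gen[OF u j] unfolding wj by blast
    moreover have "?u (posl j) \<noteq> 0" "?u (posr j) \<noteq> 0"
      using Bn_SN[OF u] pos_SN[OF j] zero_notin_SN by metis+
    ultimately have "refl_swap a c = refl_swap (?u (posl j)) (?u (posr j))"
      and ne: "a \<noteq> 0" "c \<noteq> 0"
      using refl_swap_uminus by auto
    then have "refl_swap a c \<in> refls n" "?u \<circ> gen j = refl_swap a c \<circ> ?u"
      using comp_gen_eq_refl_swap[OF u] refl_swap_in_refls[OF u j] by auto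
    then show ?thesis
      unfolding wj using snoc.prems(1) ne by (intro conjI exI[of _ ws]) simp_all
  qed
qed

lemma len_le: "set ws \<subseteq> {..<n} \<Longrightarrow> word_prod ws = w \<Longrightarrow> len n w \<le> length ws"
  unfolding len_def by (rule Least_le) blast

lemma len_attained:
  assumes "w \<in> Bn n" obtains ws where "set ws \<subseteq> {..<n}" "word_prod ws = w" "length ws = len n w"
proof -
  have "\<exists>k ws. length ws = k \<and> set ws \<subseteq> {..<n} \<and> word_prod ws = w"
    using Bn_word[OF assms] by metis
  then have "\<exists>ws. length ws = len n w \<and> set ws \<subseteq> {..<n} \<and> word_prod ws = w"
    unfolding len_def by (rule LeastI_ex)
  then show thesis using that by blast
qed

lemma Inv_refl_swap:
  assumes w: "w \<in> Bn n" and ac: "(a, c) \<in> Inv n w"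
  shows "refl_swap a c \<in> refls n" "len n (refl_swap a c \<circ> w) < len n w"
proof -
  obtain ws where ws: "set ws \<subseteq> {..<n}" "word_prod ws = w" "length ws = len n w"
    using len_attained w by blast
  then show "refl_swap a c \<in> refls n" using exchange ac by blast
  obtain us where us: "length us < length ws" "set us \<subseteq> {..<n}"
    "word_prod us = refl_swap a c \<circ> w" using exchange ws ac by blast
  then show "len n (refl_swap a c \<circ> w) < len n w" using len_le[OF us(2,3)] ws(3) by simp
qed

text \<open>If the pair is not inverted in \<open>w\<close>, it is inverted in
  \<open>refl_swap a c \<circ> w\<close>; the decrease of length from there back to \<open>w\<close>
  shows that the reflection lengthens \<open>w\<close>.\<close>

lemma refl_swap_in_invset:
  assumes w: "w \<in> Bn n" and ac: "(a, c) \<in> Pairs n"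
  shows "refl_swap a c \<in> refls n \<Longrightarrow> refl_swap a c \<in> invset n w \<longleftrightarrow> (a, c) \<in> Inv n w"
proof -
  let ?t = "refl_swap a c"
  assume t: "?t \<in> refls n"
  have ne: "a \<noteq> 0" "c \<noteq> 0" using ac by (auto simp: Pairs_def SN_iff)
  have "len n w < len n (?t \<circ> w)" if "(a, c) \<notin> Inv n w"
  proof -
    have tB: "?t \<in> Bn n" using ac refl_swap_Bn by (auto simp: Pairs_def)
    have "inv (?t \<circ> w) = inv w \<circ> ?t"
      by (rule inv_unique_comp) (use w ne in \<open>auto simp: fun_eq_iff\<close>)
    then have "inv (?t \<circ> w) a = inv w c" "inv (?t \<circ> w) c = inv w a"
      using ac by (auto simp: refl_swap_def)
    moreover have "inv w a \<noteq> inv w c"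
      using ac Bn_f_inv[OF w, of a] Bn_f_inv[OF w, of c] by (auto simp: Pairs_def)
    ultimately have "(a, c) \<in> Inv n (?t \<circ> w)"
      using that ac by (auto simp: Inv_def)
    then have "len n (?t \<circ> (?t \<circ> w)) < len n (?t \<circ> w)"
      using Inv_refl_swap(2) Bn_comp[OF tB w] by blast
    then show ?thesis using ne by simp
  qed
  then have "len n (?t \<circ> w) < len n w \<longleftrightarrow> (a, c) \<in> Inv n w"
    using Inv_refl_swap(2)[OF w, of a c] by (meson less_asym)
  then show ?thesis using t by (simp add: invset_def)
qed

text \<open>Length and reflections enter the rest of the proof only through this
  equivalence.\<close>

lemma weak_le_iff:
  assumes "v \<in> Bn n" "w \<in> Bn n" shows "weak_le n v w \<longleftrightarrow> Inv n v \<subseteq> Inv n w"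
proof
  assume le: "weak_le n v w"
  show "Inv n v \<subseteq> Inv n w"
  proof clarify
    fix a c assume ac: "(a, c) \<in> Inv n v"
    then have p: "(a, c) \<in> Pairs n" using Inv_subset_Pairs by blast
    have t: "refl_swap a c \<in> refls n" using Inv_refl_swap(1) assms(1) ac by blast
    show "(a, c) \<in> Inv n w"
      using refl_swap_in_invset[OF _ p t] assms le ac by (auto simp: weak_le_def)
  qed
next
  assume le: "Inv n v \<subseteq> Inv n w"
  show "weak_le n v w"
    unfolding weak_le_def
  proof
    fix t assume t: "t \<in> invset n v"
    then have tr: "t \<in> refls n" by (simp add: invset_def)
    then obtain a c where "(a, c) \<in> Pairs n" "t = refl_swap a c" using reflsE by blast
    then show "t \<in> invset n w" using refl_swap_in_invset tr t assms le by blast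
  qed
qed

section \<open>Joins and meets\<close>

lemma trans_Un_trancl: "S \<subseteq> R \<Longrightarrow> T \<subseteq> R \<Longrightarrow> trans R \<Longrightarrow> (S \<union> T)\<^sup>+ \<subseteq> R"
  by (metis Un_least trancl_id trancl_mono_subset)

text \<open>Inversion sets are transitive, so every upper bound contains the closure of the union;
  by \<open>good_trancl_Un\<close> this closure is itself an inversion set.\<close>

lemma wjoin:
  assumes x: "x \<in> Bn n" and y: "y \<in> Bn n"
  shows "wjoin n x y \<in> Bn n \<and> Inv n (wjoin n x y) = (Inv n x \<union> Inv n y)\<^sup>+"
proof -
  let ?S = "(Inv n x \<union> Inv n y)\<^sup>+"
  obtain m where m: "m \<in> Bn n" "Inv n m = ?S"
    using good_realize[OF good_trancl_Un[OF good_Inv[OF x] good_Inv[OF y]]] by blast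
  have sub: "Inv n x \<subseteq> ?S" "Inv n y \<subseteq> ?S" by auto
  have least: "?S \<subseteq> Inv n z" if "z \<in> Bn n" "Inv n x \<subseteq> Inv n z" "Inv n y \<subseteq> Inv n z" for z
    by (rule trans_Un_trancl[OF that(2,3) good_trans[OF good_Inv[OF that(1)]]])
  have "wjoin n x y = m"
    unfolding wjoin_def
  proof (rule the_equality)
    show "m \<in> Bn n \<and> weak_le n x m \<and> weak_le n y m \<and>
      (\<forall>z \<in> Bn n. weak_le n x z \<and> weak_le n y z \<longrightarrow> weak_le n m z)"
      using m(1) sub least x y by (simp add: weak_le_iff m(2))
  next
    fix k assume "k \<in> Bn n \<and> weak_le n x k \<and> weak_le n y k \<and>
      (\<forall>z \<in> Bn n. weak_le n x z \<and> weak_le n y z \<longrightarrow> weak_le n k z)"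
    then have k: "k \<in> Bn n" "weak_le n x k" "weak_le n y k" and "\<forall>z \<in> Bn n. weak_le n x z \<and> weak_le n y z \<longrightarrow> weak_le n k z" by auto
    moreover have "weak_le n x m" "weak_le n y m" using m sub x y by (simp_all add: weak_le_iff)
    ultimately have "weak_le n k m" using m(1) by blast
    then have "Inv n k \<subseteq> Inv n m" using k m(1) by (simp add: weak_le_iff)
    moreover have "Inv n m \<subseteq> Inv n k" using m(2) least[of k] k x y by (simp add: weak_le_iff)
    ultimately show "k = m" using Inv_inject k m by blast
  qed
  then show ?thesis using m by simp
qed

text \<open>The dual formula, since complementing inversion sets reverses the order.\<close>

lemma wmeet:
  assumes x: "x \<in> Bn n" and y: "y \<in> Bn n"
  shows "wmeet n x y \<in> Bn n \<and>
    Inv n (wmeet n x y) = Pairs n - ((Pairs n - Inv n x) \<union> (Pairs n - Inv n y))\<^sup>+"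
proof -
  let ?S = "Pairs n - ((Pairs n - Inv n x) \<union> (Pairs n - Inv n y))\<^sup>+"
  obtain m where m: "m \<in> Bn n" "Inv n m = ?S"
    using good_realize good_Compl good_trancl_Un good_Inv x y by metis
  have sub: "?S \<subseteq> Inv n x" "?S \<subseteq> Inv n y" by auto
  have greatest: "Inv n z \<subseteq> ?S" if z: "z \<in> Bn n" "Inv n z \<subseteq> Inv n x" "Inv n z \<subseteq> Inv n y" for z
  proof -
    have "((Pairs n - Inv n x) \<union> (Pairs n - Inv n y))\<^sup>+ \<subseteq> Pairs n - Inv n z"
      using z by (intro trans_Un_trancl good_trans[OF good_Compl] good_Inv) auto
    then show ?thesis using Inv_subset_Pairs by blast
  qed
  have "wmeet n x y = m"
    unfolding wmeet_def
  proof (rule the_equality)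
    show "m \<in> Bn n \<and> weak_le n m x \<and> weak_le n m y \<and>
      (\<forall>z \<in> Bn n. weak_le n z x \<and> weak_le n z y \<longrightarrow> weak_le n z m)"
      using m(1) sub greatest x y by (simp add: weak_le_iff m(2))
  next
    fix k assume "k \<in> Bn n \<and> weak_le n k x \<and> weak_le n k y \<and>
      (\<forall>z \<in> Bn n. weak_le n z x \<and> weak_le n z y \<longrightarrow> weak_le n z k)"
    then have k: "k \<in> Bn n" "weak_le n k x" "weak_le n k y" and "\<forall>z \<in> Bn n. weak_le n z x \<and> weak_le n z y \<longrightarrow> weak_le n z k" by auto
    moreover have "weak_le n m x" "weak_le n m y" using m sub x y by (simp_all add: weak_le_iff)
    ultimately have "weak_le n m k" using m(1) by blast
    then have "Inv n m \<subseteq> Inv n k" using k m(1) by (simp add: weak_le_iff)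
    moreover have "Inv n k \<subseteq> Inv n m" using m(2) greatest[of k] k x y by (simp add: weak_le_iff)
    ultimately show "k = m" using Inv_inject k m by blast
  qed
  then show ?thesis using m by simp
qed

section \<open>The map \<open>etaB\<close>\<close>

text \<open>The index \<open>k\<close> with \<open>fullnot n x k = v\<close>.\<close>
definition idx :: "nat \<Rightarrow> (int \<Rightarrow> int) \<Rightarrow> int \<Rightarrow> int" where
  "idx n x v = (let p = inv x v in if p < 0 then p + int n + 1 else p + int n)"

lemma idx_bounds:
  assumes "x \<in> Bn n" "v \<in> SN n" shows "1 \<le> idx n x v" "idx n x v \<le> 2 * int n"
  using Bn_SN[OF Bn_inv[OF assms(1)], of v] assms by (auto simp: idx_def Let_def SN_iff)

lemma idx_less_iff:
  assumes "x \<in> Bn n" "u \<in> SN n" "v \<in> SN n"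
  shows "idx n x u < idx n x v \<longleftrightarrow> inv x u < inv x v"
  using Bn_SN[OF Bn_inv[OF assms(1)], of v] Bn_SN[OF Bn_inv[OF assms(1)], of u] assms
  by (auto simp: idx_def Let_def SN_iff)

lemma idx_less_Inv:
  assumes "x \<in> Bn n" "u \<in> SN n" "v \<in> SN n" "u < v"
  shows "idx n x v < idx n x u \<longleftrightarrow> (u, v) \<in> Inv n x"
  using assms by (simp add: idx_less_iff Inv_def Pairs_def)

lemma idx_inj:
  assumes "x \<in> Bn n" "u \<in> SN n" "v \<in> SN n" "idx n x u = idx n x v" shows "u = v"
proof -
  have "inv x u = inv x v"
    using idx_less_iff[OF assms(1-3)] idx_less_iff[OF assms(1,3,2)] assms(4) by simp
  then have "x (inv x u) = x (inv x v)" by simp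
  then show ?thesis using assms(1) by simp
qed

lemma idx_less_Inv':
  assumes "x \<in> Bn n" "u \<in> SN n" "v \<in> SN n" "u < v"
  shows "idx n x u < idx n x v \<longleftrightarrow> (u, v) \<notin> Inv n x"
  unfolding idx_less_Inv[OF assms, symmetric] using idx_inj[OF assms(1-3)] assms(4) by linarith

lemma fullnot_eq_iff:
  assumes "x \<in> Bn n" "1 \<le> k" "k \<le> 2 * n"
  shows "fullnot n x k = v \<and> v \<in> SN n \<longleftrightarrow> v \<in> SN n \<and> idx n x v = int k"
proof (cases "v \<in> SN n")
  case True
  have "fullnot n x k = v \<longleftrightarrow> inv x v = (if k \<le> n then int k - int n - 1 else int k - int n)"
    unfolding fullnot_def using Bn_inv_f[OF assms(1)] Bn_f_inv[OF assms(1), of v] by auto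
  also have "\<dots> \<longleftrightarrow> idx n x v = int k"
    using Bn_SN[OF Bn_inv[OF assms(1)], of v] True assms(2) by (auto simp: idx_def Let_def SN_iff)
  finally show ?thesis using True by simp
qed simp

definition up_dn :: "nat \<Rightarrow> int set \<Rightarrow> bool" where
  "up_dn n U \<longleftrightarrow> U \<subseteq> SN n \<and> (\<forall>i\<in>SN n. i \<in> U \<longleftrightarrow> - i \<notin> U)"

lemma lam_eq:
  assumes x: "x \<in> Bn n" and U: "U \<subseteq> SN n"
  shows "k \<le> 2 * n \<Longrightarrow> lam n U x k = {- (int n + 1), int n + 1} \<union> {v \<in> SN n. v \<in> U \<longleftrightarrow> idx n x v \<le> int k}"
proof (induction k)
  case 0
  then show ?case using idx_bounds(1)[OF x] by fastforce
next
  case (Suc k)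
  let ?y = "fullnot n x (Suc k)"
  have y: "v \<in> SN n \<Longrightarrow> ?y = v \<longleftrightarrow> idx n x v = int (Suc k)" for v
    using fullnot_eq_iff[OF x, of "Suc k" v] Suc.prems by auto
  have yS: "?y \<in> SN n"
    unfolding fullnot_def Bn_SN[OF x] using Suc.prems by (auto simp: SN_iff)
  have ends: "- (int n + 1) \<noteq> ?y" "int n + 1 \<noteq> ?y" using yS by (auto simp: SN_iff)
  have key: "idx n x v \<le> int (Suc k) \<longleftrightarrow> idx n x v \<le> int k \<or> v = ?y" if "v \<in> SN n" for v
    using y[OF that] by auto
  have yk: "\<not> idx n x ?y \<le> int k" using y[OF yS] by simp
  have IH: "lam n U x k = {- (int n + 1), int n + 1} \<union> {v \<in> SN n. v \<in> U \<longleftrightarrow> idx n x v \<le> int k}"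
    using Suc by simp
  have "v \<in> lam n U x (Suc k) \<longleftrightarrow>
      v \<in> {- (int n + 1), int n + 1} \<union> {v \<in> SN n. v \<in> U \<longleftrightarrow> idx n x v \<le> int (Suc k)}" for v
  proof (cases "v = ?y")
    case True
    then show ?thesis using yS yk key[OF yS] ends unfolding lam.simps IH Let_def by auto
  next
    case False
    then have "v \<in> lam n U x (Suc k) \<longleftrightarrow> v \<in> lam n U x k" by (auto simp: Let_def)
    then show ?thesis using key[of v] False unfolding IH by auto
  qed
  then show ?case by blast
qed

text \<open>For \<open>(p, q)\<close> to be an edge of a path, the entries in \<open>before n U p q\<close> must have been read
  and those in \<open>after n U p q\<close> must not.\<close>
definition before :: "nat \<Rightarrow> int set \<Rightarrow> int \<Rightarrow> int \<Rightarrow> int set" where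
  "before n U p q = {b \<in> SN n. p \<le> b \<and> b \<le> q \<and> (b \<in> U \<longleftrightarrow> b = p \<or> b = q)}"

definition after :: "nat \<Rightarrow> int set \<Rightarrow> int \<Rightarrow> int \<Rightarrow> int set" where
  "after n U p q = {b \<in> SN n. p \<le> b \<and> b \<le> q \<and> (b \<notin> U \<longleftrightarrow> b = p \<or> b = q)}"

text \<open>An edge needs its ends on the path and all indices between them off it; for an up or a
  down index this decides whether it has been read. The ends \<open>\<plusminus>(n + 1)\<close> lie
  on every path and outside \<open>SN n\<close>, so they impose no condition.\<close>

lemma path_edges_lam_iff:
  assumes x: "x \<in> Bn n" and U: "U \<subseteq> SN n" and k: "k \<le> 2 * n"
  shows "(p, q) \<in> path_edges (lam n U x k) \<longleftrightarrow> p \<in> SN (n + 1) \<and> q \<in> SN (n + 1) \<and> p < q \<and>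
    (\<forall>u \<in> before n U p q. idx n x u \<le> int k) \<and> (\<forall>v \<in> after n U p q. int k < idx n x v)"
proof -
  have SN1: "v \<in> SN (n + 1) \<longleftrightarrow> v \<in> SN n \<or> v = int n + 1 \<or> v = - (int n + 1)" for v
    by (auto simp: SN_def)
  have bd: "- (int n + 1) < v \<and> v < int n + 1" if "v \<in> SN n" for v
    using that by (auto simp: SN_iff)
  show ?thesis (is "?L \<longleftrightarrow> ?R")
  proof
    assume ?L
    then have L: "p \<in> lam n U x k" "q \<in> lam n U x k" "p < q"
      "\<And>c. c \<in> lam n U x k \<Longrightarrow> p < c \<Longrightarrow> c < q \<Longrightarrow> False"
      by (auto simp: path_edges_def)
    have mem: "v \<in> lam n U x k \<longleftrightarrow> (v \<in> U \<longleftrightarrow> idx n x v \<le> int k)" if "v \<in> SN n" for v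
      using that bd[OF that] unfolding lam_eq[OF x U k] by auto
    have int: "v \<in> lam n U x k \<longleftrightarrow> v = p \<or> v = q" if "p \<le> v" "v \<le> q" for v
      using L that by (auto simp: order_le_less)
    have "p \<in> SN (n + 1)" "q \<in> SN (n + 1)"
      using L(1,2) unfolding SN1 lam_eq[OF x U k] by auto
    moreover have "idx n x u \<le> int k" if "u \<in> before n U p q" for u
      using mem[of u] int[of u] that unfolding before_def by blast
    moreover have "int k < idx n x u" if "u \<in> after n U p q" for u
      using mem[of u] int[of u] that unfolding after_def not_le[symmetric] by blast
    ultimately show ?R using L(3) by blast
  next
    assume R: ?R
    have "p \<in> lam n U x k" "q \<in> lam n U x k"
      using R unfolding lam_eq[OF x U k] SN1 before_def after_def by fastforce+
    moreover have False if c: "c \<in> lam n U x k" "p < c" "c < q" for c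
    proof -
      have "c \<in> SN n" using that R bd[of p] bd[of q] unfolding lam_eq[OF x U k] SN1 by auto
      moreover from this have "c \<in> U \<longleftrightarrow> idx n x c \<le> int k"
        using c(1) bd[of c] unfolding lam_eq[OF x U k] by auto
      moreover have "c \<in> before n U p q \<Longrightarrow> idx n x c \<le> int k" "c \<in> after n U p q \<Longrightarrow> int k < idx n x c"
        using R by blast+
      ultimately show False
        using c(2,3) unfolding before_def after_def by (cases "c \<in> U") auto
    qed
    ultimately show ?L using R by (auto simp: path_edges_def)
  qed
qed

text \<open>The time \<open>k\<close> is bounded below by the reading times of \<open>before\<close>
  and strictly above by those of \<open>after\<close>; a common \<open>k\<close> exists iff every
  lower bound is less than every upper bound.\<close>

lemma etaB_iff:
  assumes x: "x \<in> Bn n" and U: "U \<subseteq> SN n"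
  shows "(p, q) \<in> etaB n U x \<longleftrightarrow> (p, q) \<in> diagQ n U \<and>
    (\<forall>u \<in> before n U p q. \<forall>v \<in> after n U p q. inv x u < inv x v)" (is "?L \<longleftrightarrow> ?R")
proof
  assume ?L
  then obtain k where k: "k \<le> 2 * n" "(p, q) \<in> path_edges (lam n U x k)" "(p, q) \<in> diagQ n U"
    by (auto simp: etaB_def)
  have "inv x u < inv x v" if "u \<in> before n U p q" "v \<in> after n U p q" for u v
  proof -
    have "idx n x u < idx n x v" using that path_edges_lam_iff[OF x U k(1)] k(2) by force
    then show ?thesis using idx_less_iff[OF x] that by (auto simp: before_def after_def)
  qed
  then show ?R using k by blast
next
  assume R: ?R
  have fin: "finite (before n U p q)" by (rule finite_subset[OF _ finite_SN[of n]]) (auto simp: before_def)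
  \<comment> \<open>The inserted 0 covers an empty \<open>before\<close>: then the initial path has
    the edge.\<close>
  define M where "M = Max (insert 0 (idx n x ` before n U p q))"
  have M0: "0 \<le> M" unfolding M_def using fin by simp
  have Mub: "idx n x u \<le> M" if "u \<in> before n U p q" for u
    unfolding M_def using fin that by (intro Max_ge) auto
  have "M \<in> insert 0 (idx n x ` before n U p q)" unfolding M_def using fin by (intro Max_in) auto
  then have M: "M = 0 \<or> (\<exists>u \<in> before n U p q. M = idx n x u)" by auto
  then have k: "nat M \<le> 2 * n" using idx_bounds(2)[OF x] by (force simp: before_def)
  have "M < idx n x v" if v: "v \<in> after n U p q" for v
  proof -
    have vS: "v \<in> SN n" using v by (simp add: after_def)
    from M show ?thesis
    proof
      assume "M = 0" then show ?thesis using idx_bounds(1)[OF x vS] by simp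
    next
      assume "\<exists>u \<in> before n U p q. M = idx n x u"
      then obtain u where "u \<in> before n U p q" "M = idx n x u" by blast
      then show ?thesis using R v vS idx_less_iff[OF x, of u v] by (simp add: before_def)
    qed
  qed
  then have "(p, q) \<in> path_edges (lam n U x (nat M))"
    using path_edges_lam_iff[OF x U k] R Mub M0 by (auto simp: diagQ_def)
  then show ?L using k R by (auto simp: etaB_def)
qed

text \<open>Complementing the inversion set reverses the full notation, and exchanging up with down
  exchanges \<open>before\<close> with \<open>after\<close>; the two effects cancel in
  \<open>etaB_iff\<close>.\<close>

lemma etaB_complement:
  assumes x: "x \<in> Bn n" and y: "y \<in> Bn n" and U: "U \<subseteq> SN n" and eq: "Inv n y = Pairs n - Inv n x"
  shows "etaB n (SN n - U) y = etaB n U x"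
proof -
  have d: "diagQ n (SN n - U) = diagQ n U"
    using U by (auto simp: diagQ_def double_diff)
  have b: "before n (SN n - U) p q = after n U p q" "after n (SN n - U) p q = before n U p q" for p q
    by (auto simp: before_def after_def)
  have rev: "inv y u < inv y v \<longleftrightarrow> inv x v < inv x u" if "u \<in> SN n" "v \<in> SN n" for u v
  proof (cases u v rule: linorder_cases)
    case less
    then show ?thesis
      using idx_less_Inv'[OF y that less] idx_less_iff[OF y that]
        idx_less_Inv[OF x that less] idx_less_iff[OF x that(2,1)] that less eq by (auto simp: Pairs_def)
  next
    case greater
    then show ?thesis
      using idx_less_Inv[OF y that(2,1) greater] idx_less_iff[OF y that]
        idx_less_Inv'[OF x that(2,1) greater] idx_less_iff[OF x that(2,1)] that greater eq
      by (auto simp: Pairs_def)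
  qed auto
  have "(p, q) \<in> etaB n (SN n - U) y \<longleftrightarrow> (p, q) \<in> etaB n U x" for p q
    unfolding etaB_iff[OF x U] etaB_iff[OF y Diff_subset] d b
    using rev by (auto simp: before_def after_def)
  then show ?thesis by auto
qed

section \<open>Covers that do not change the diagonals\<close>

lemma gen_neq: "r \<noteq> s \<Longrightarrow> gen j r \<noteq> gen j s"
  by (metis gen_gen)

lemma gen_less_iff:
  assumes "p \<noteq> 0" "q \<noteq> 0" "p \<noteq> q"
    "\<not> (p = posl j \<and> q = posr j \<or> p = - posr j \<and> q = - posl j)"
    "\<not> (q = posl j \<and> p = posr j \<or> q = - posr j \<and> p = - posl j)"
  shows "gen j p < gen j q \<longleftrightarrow> p < q"
proof (cases "p < q")
  case True
  then have "\<not> gen j q < gen j p" using gen_inverts[of p q j] assms by simp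
  then show ?thesis using True gen_neq[OF assms(3), of j] by linarith
next
  case False
  then have "\<not> gen j p < gen j q" using gen_inverts[of q p j] assms by simp
  then show ?thesis using False by simp
qed

text \<open>The entry \<open>b = x m\<close> lies on every path that could see the order of the two exchanged entries
  (\<open>b\<close> up and read before both, or down and read after both), so no edge passes \<open>b\<close> there.\<close>
definition witness :: "nat \<Rightarrow> int set \<Rightarrow> (int \<Rightarrow> int) \<Rightarrow> nat \<Rightarrow> int \<Rightarrow> bool" where
  "witness n U x j m \<longleftrightarrow> m \<in> SN n \<and> x (posl j) < x m \<and> x m < x (posr j) \<and>
     (m < posl j \<and> x m \<in> U \<or> posr j < m \<and> x m \<notin> U)"

lemma witness_mirror:
  assumes x: "x \<in> Bn n" and U: "up_dn n U" and w: "witness n U x j m"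
  shows "- m \<in> SN n" "- x (posr j) < x (- m)" "x (- m) < - x (posl j)"
    "- m < - posr j \<and> x (- m) \<in> U \<or> - posl j < - m \<and> x (- m) \<notin> U"
proof -
  have "x m \<in> U \<longleftrightarrow> - x m \<notin> U"
    using w U Bn_SN[OF x, of m] unfolding witness_def up_dn_def by blast
  then show "- m \<in> SN n" "- x (posr j) < x (- m)" "x (- m) < - x (posl j)"
    "- m < - posr j \<and> x (- m) \<in> U \<or> - posl j < - m \<and> x (- m) \<notin> U"
    using w unfolding witness_def Bn_uminus[OF x] by auto
qed

text \<open>If the exchange alters the order of some \<open>u\<close> in \<open>before\<close> and
  \<open>v\<close> in \<open>after\<close>, these are the exchanged entries or their mirror images,
  and the witness or its mirror image lies between them. If it is up, it belongs to
  \<open>after\<close> yet precedes \<open>u\<close>; if down, it belongs to \<open>before\<close>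
  yet follows \<open>v\<close>. So \<open>(p, q)\<close> is missing both before and after the
  exchange.\<close>

lemma etaB_gen:
  assumes x: "x \<in> Bn n" and U: "up_dn n U" and j: "j < n" and w: "witness n U x j m"
  shows "etaB n U (x \<circ> gen j) = etaB n U x"
proof -
  have sub: "U \<subseteq> SN n" using U by (simp add: up_dn_def)
  note wm = witness_mirror[OF x U w]
  let ?y = "x \<circ> gen j"
  have y: "?y \<in> Bn n" using x j by simp
  have core: "(\<exists>u \<in> before n U p q. \<exists>v \<in> after n U p q. inv x v < inv x u \<and> inv ?y v < inv ?y u)"
    if bad: "u \<in> before n U p q" "v \<in> after n U p q" "(inv x u < inv x v) \<noteq> (inv ?y u < inv ?y v)" for p q u v
  proof -
    have uv: "u \<in> SN n" "v \<in> SN n" "u \<noteq> v" "p \<le> u" "u \<le> q" "p \<le> v" "v \<le> q"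
      using bad by (auto simp: before_def after_def)
    define r s where "r = inv x u" and "s = inv x v"
    have rs: "r \<in> SN n" "s \<in> SN n" "r \<noteq> s" "u = x r" "v = x s"
      using uv Bn_SN[OF Bn_inv[OF x]] x by (auto simp: r_def s_def) (metis Bn_f_inv)
    have g: "inv ?y w = gen j (inv x w)" for w using inv_comp_gen[OF x] by simp
    have "(r < s) \<noteq> (gen j r < gen j s)" using bad(3) unfolding g r_def s_def .
    moreover have "gen j r \<noteq> gen j s" using rs(3) gen_neq by blast
    moreover have "r \<noteq> 0" "s \<noteq> 0" using rs by (auto simp: SN_iff)
    ultimately have pos: "{r, s} = {posl j, posr j} \<or> {r, s} = {- posr j, - posl j}"
      using gen_inverts[of r s j] gen_inverts[of s r j] rs(3) by (auto simp: neq_iff doubleton_eq_iff)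
    have big: "\<exists>m' \<in> SN n. min u v < x m' \<and> x m' < max u v \<and>
        (m' < min r s \<and> x m' \<in> U \<or> max r s < m' \<and> x m' \<notin> U)"
      using pos
    proof
      assume "{r, s} = {posl j, posr j}"
      then show ?thesis using w posl_less_posr[of j] unfolding rs witness_def doubleton_eq_iff
        by (intro bexI[of _ m]) auto
    next
      assume "{r, s} = {- posr j, - posl j}"
      then show ?thesis using wm posl_less_posr[of j] unfolding rs witness_def doubleton_eq_iff
        by (intro bexI[of _ "- m"]) (auto simp: Bn_uminus[OF x])
    qed
    then obtain m' where m': "m' \<in> SN n" "min u v < x m'" "x m' < max u v"
        "m' < min r s \<and> x m' \<in> U \<or> max r s < m' \<and> x m' \<notin> U" by blast
    \<comment> \<open>The witness may stand at a mirror position and be moved by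
      \<open>gen j\<close> itself, but it does not pass \<open>r\<close> or
      \<open>s\<close>.\<close>
    have ms: "gen j m' < gen j t \<longleftrightarrow> m' < t" if "t = r \<or> t = s" for t
    proof -
      have ne: "m' \<noteq> r" "m' \<noteq> s" using m' by auto
      have nz: "m' \<noteq> 0" "t \<noteq> 0" "m' \<noteq> t" using m'(1) rs that ne by (auto simp: SN_iff)
      have "\<not> (m' = posl j \<and> t = posr j \<or> m' = - posr j \<and> t = - posl j)"
          "\<not> (t = posl j \<and> m' = posr j \<or> t = - posr j \<and> m' = - posl j)"
        using pos that ne by (auto simp: doubleton_eq_iff posl_def posr_def split: if_splits)
      then show ?thesis using gen_less_iff nz by metis
    qed
    have xm: "x m' \<in> SN n" "p < x m'" "x m' < q" "inv x (x m') = m'" using m' uv x by (auto simp: Bn_SN)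
    show ?thesis
      using m'(4)
    proof
      assume a: "m' < min r s \<and> x m' \<in> U"
      then have "x m' \<in> after n U p q" using xm by (auto simp: after_def)
      moreover have "inv x (x m') < inv x u \<and> inv ?y (x m') < inv ?y u"
        unfolding g xm(4) r_def[symmetric] using ms[of r] a by auto
      ultimately show ?thesis using bad(1) by blast
    next
      assume a: "max r s < m' \<and> x m' \<notin> U"
      then have "x m' \<in> before n U p q" using xm by (auto simp: before_def)
      moreover have "inv x v < inv x (x m') \<and> inv ?y v < inv ?y (x m')"
        unfolding g xm(4) s_def[symmetric] using ms[of s] a
          gen_neq[of s m' j] by (auto simp: not_less order_le_less)
      ultimately show ?thesis using bad(2) by blast
    qed
  qed
  have "(p, q) \<in> etaB n U ?y \<longleftrightarrow> (p, q) \<in> etaB n U x" for p q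
    unfolding etaB_iff[OF x sub] etaB_iff[OF y sub] using core[of _ p q] by (metis order_less_asym)
  then show ?thesis by auto
qed

section \<open>Fibres of \<open>etaB\<close> form a lattice congruence\<close>

lemma wmeet_lower:
  assumes "x \<in> Bn n" "y \<in> Bn n"
  shows "wmeet n x y \<in> Bn n" "Inv n (wmeet n x y) \<subseteq> Inv n x" "Inv n (wmeet n x y) \<subseteq> Inv n y"
  using wmeet[OF assms] by auto

lemma wmeet_greatest:
  assumes "x \<in> Bn n" "y \<in> Bn n" "good n S" "S \<subseteq> Inv n x" "S \<subseteq> Inv n y"
  shows "S \<subseteq> Inv n (wmeet n x y)"
proof -
  have "((Pairs n - Inv n x) \<union> (Pairs n - Inv n y))\<^sup>+ \<subseteq> Pairs n - S"
    using assms by (intro trans_Un_trancl good_trans[OF good_Compl]) auto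
  then show ?thesis using wmeet[OF assms(1,2)] good_Pairs[OF assms(3)] by blast
qed

lemma wjoin_upper:
  assumes "x \<in> Bn n" "y \<in> Bn n"
  shows "wjoin n x y \<in> Bn n" "Inv n x \<subseteq> Inv n (wjoin n x y)" "Inv n y \<subseteq> Inv n (wjoin n x y)"
  using wjoin[OF assms] by auto

text \<open>The inversion set of the least element of the fibre. Iterating the replacement of the left end
  of a pair by an up index inside it, and of its right end by a down index inside it, yields
  precisely the pairs \<open>(a', c')\<close> below.\<close>
definition bottom :: "nat \<Rightarrow> int set \<Rightarrow> (int \<times> int) set \<Rightarrow> (int \<times> int) set" where
  "bottom n U S = {(a, c) \<in> Pairs n. \<forall>a' c'. (a' = a \<or> a' \<in> U \<and> a < a' \<and> a' < c) \<longrightarrow>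
     (c' = c \<or> c' \<in> SN n - U \<and> a < c' \<and> c' < c) \<longrightarrow> a' < c' \<longrightarrow> (a', c') \<in> S}"

lemma bottom_Pairs: "bottom n U S \<subseteq> Pairs n"
  by (auto simp: bottom_def)

lemma bottom_subset: "bottom n U S \<subseteq> S"
  by (auto simp: bottom_def Pairs_def)

lemma bottom_mono: "S \<subseteq> T \<Longrightarrow> bottom n U S \<subseteq> bottom n U T"
  unfolding bottom_def by blast

lemma bottomI:
  assumes "(a, c) \<in> Pairs n"
    "\<And>a' c'. a' = a \<or> a' \<in> U \<and> a < a' \<and> a' < c \<Longrightarrow> c' = c \<or> c' \<in> SN n - U \<and> a < c' \<and> c' < c
      \<Longrightarrow> a' < c' \<Longrightarrow> (a', c') \<in> S"
  shows "(a, c) \<in> bottom n U S"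
  using assms unfolding bottom_def by blast

lemma bottomD:
  assumes "(a, c) \<in> bottom n U S" "a' = a \<or> a' \<in> U \<and> a < a' \<and> a' < c"
     "c' = c \<or> c' \<in> SN n - U \<and> a < c' \<and> c' < c" "a' < c'"
  shows "(a', c') \<in> S"
  using assms unfolding bottom_def by blast

lemma bottom_idem:
  assumes "U \<subseteq> SN n" shows "bottom n U (bottom n U S) = bottom n U S"
proof
  show "bottom n U S \<subseteq> bottom n U (bottom n U S)"
  proof clarify
    fix a c assume ac: "(a, c) \<in> bottom n U S"
    then have P: "(a, c) \<in> Pairs n" using bottom_Pairs by blast
    show "(a, c) \<in> bottom n U (bottom n U S)"
    proof (rule bottomI[OF P])
      fix a1 c1 assume 1: "a1 = a \<or> a1 \<in> U \<and> a < a1 \<and> a1 < c" "c1 = c \<or> c1 \<in> SN n - U \<and> a < c1 \<and> c1 < c" "a1 < c1"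
      then have "(a1, c1) \<in> Pairs n" using P assms by (auto simp: Pairs_def)
      then show "(a1, c1) \<in> bottom n U S"
        by (rule bottomI) (rule bottomD[OF ac], use 1 in \<open>auto\<close>)
    qed
  qed
qed (rule bottom_subset)

lemma up_dn_mem: "up_dn n U \<Longrightarrow> i \<in> SN n \<Longrightarrow> i \<notin> U \<longleftrightarrow> - i \<in> U"
  unfolding up_dn_def by blast

lemma up_dn_SN: "up_dn n U \<Longrightarrow> i \<in> U \<Longrightarrow> i \<in> SN n"
  unfolding up_dn_def by blast

text \<open>Symmetry holds because negation exchanges up with down. An up \<open>b\<close> may
  replace the left end, so \<open>(b, c)\<close> inherits all conditions from \<open>(a, c)\<close>;
  a down \<open>b\<close> dually gives \<open>(a, b)\<close>. For transitivity, a pair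
  \<open>(a', c')\<close> straddling \<open>b\<close> is composed of \<open>(a', b)\<close> and
  \<open>(b, c')\<close>.\<close>

lemma good_bottom:
  assumes S: "good n S" and U: "up_dn n U" shows "good n (bottom n U S)"
  unfolding good_def
proof (intro conjI allI impI)
  show "bottom n U S \<subseteq> Pairs n" by (rule bottom_Pairs)
next
  fix a c assume ac: "(a, c) \<in> bottom n U S"
  then have P: "(a, c) \<in> Pairs n" using bottom_Pairs by blast
  then have P': "(- c, - a) \<in> Pairs n" by (auto simp: Pairs_def)
  show "(- c, - a) \<in> bottom n U S"
  proof (rule bottomI[OF P'])
    fix a' c' assume 1: "a' = - c \<or> a' \<in> U \<and> - c < a' \<and> a' < - a"
      "c' = - a \<or> c' \<in> SN n - U \<and> - c < c' \<and> c' < - a" "a' < c'"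
    have "- c' = a \<or> - c' \<in> U \<and> a < - c' \<and> - c' < c"
      using 1(2) up_dn_mem[OF U] by auto
    moreover have "- a' = c \<or> - a' \<in> SN n - U \<and> a < - a' \<and> - a' < c"
      using 1(1) up_dn_mem[OF U, of "- a'"] up_dn_SN[OF U, of a'] by auto
    ultimately have "(- c', - a') \<in> S" using bottomD[OF ac, of "- c'" "- a'"] 1(3) by simp
    then show "(a', c') \<in> S" using good_sym[OF S] by fastforce
  qed
  fix b assume b: "b \<in> SN n" "a < b" "b < c"
  show "(a, b) \<in> bottom n U S \<or> (b, c) \<in> bottom n U S"
  proof (cases "b \<in> U")
    case True
    have "(b, c) \<in> bottom n U S"
    proof (rule bottomI)
      show "(b, c) \<in> Pairs n" using b P by (auto simp: Pairs_def)
    qed (rule bottomD[OF ac]; use b True in \<open>force\<close>)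
    then show ?thesis by blast
  next
    case False
    have "(a, b) \<in> bottom n U S"
    proof (rule bottomI)
      show "(a, b) \<in> Pairs n" using b P by (auto simp: Pairs_def)
    qed (rule bottomD[OF ac]; use b False in \<open>force\<close>)
    then show ?thesis by blast
  qed
next
  show "trans (bottom n U S)"
  proof (rule transI)
    fix a b c assume ab: "(a, b) \<in> bottom n U S" and bc: "(b, c) \<in> bottom n U S"
    then have P: "a \<in> SN n" "b \<in> SN n" "c \<in> SN n" "a < b" "b < c"
      using bottom_Pairs by (force simp: Pairs_def)+
    then have Pac: "(a, c) \<in> Pairs n" by (auto simp: Pairs_def)
    show "(a, c) \<in> bottom n U S"
    proof (rule bottomI[OF Pac])
      fix a' c' assume A: "a' = a \<or> a' \<in> U \<and> a < a' \<and> a' < c"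
        "c' = c \<or> c' \<in> SN n - U \<and> a < c' \<and> c' < c" "a' < c'"
      consider "c' < b" | "b < a'" | "a' = b" | "c' = b" | "a' < b" "b < c'" by linarith
      then show "(a', c') \<in> S"
      proof cases
        case 1
        then show ?thesis using bottomD[OF ab, of a' c'] A P by auto
      next
        case 2
        then show ?thesis using bottomD[OF bc, of a' c'] A P by auto
      next
        case 3
        then show ?thesis using bottomD[OF bc, of a' c'] A P by auto
      next
        case 4
        then show ?thesis using bottomD[OF ab, of a' c'] A P by auto
      next
        case 5
        then have "(a', b) \<in> S" "(b, c') \<in> S"
          using bottomD[OF ab, of a' b] bottomD[OF bc, of b c'] A P by auto
        then show ?thesis using good_trans[OF S] by (auto dest: transD)
      qed
    qed
  qed
qed

text \<open>Some replacement \<open>(a', c')\<close> is not inverted above the cover, so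
  \<open>a'\<close> precedes \<open>c'\<close> in \<open>x\<close>. No position lies between the
  exchanged ones; hence \<open>a'\<close> precedes both and is an up witness, or \<open>c'\<close>
  follows both and is a down witness.\<close>

lemma ex_witness:
  assumes x: "x \<in> Bn n" and U: "U \<subseteq> SN n" and j: "j < n" and asc: "x (posl j) < x (posr j)"
    and nb: "(x (posl j), x (posr j)) \<notin> bottom n U (Inv n (x \<circ> gen j))"
  shows "\<exists>m. witness n U x j m"
proof -
  let ?a = "x (posl j)" and ?c = "x (posr j)"
  have P: "(?a, ?c) \<in> Pairs n" using x j asc by (auto simp: Pairs_def Bn_SN)
  have nb': "\<not> (\<forall>a' c'. (a' = ?a \<or> a' \<in> U \<and> ?a < a' \<and> a' < ?c) \<longrightarrow>
     (c' = ?c \<or> c' \<in> SN n - U \<and> ?a < c' \<and> c' < ?c) \<longrightarrow> a' < c' \<longrightarrow> (a', c') \<in> Inv n (x \<circ> gen j))"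
    using nb bottomI[OF P, of U "Inv n (x \<circ> gen j)"] by blast
  then obtain a' c' where *: "a' = ?a \<or> a' \<in> U \<and> ?a < a' \<and> a' < ?c"
     "c' = ?c \<or> c' \<in> SN n - U \<and> ?a < c' \<and> c' < ?c" "a' < c'" "(a', c') \<notin> Inv n (x \<circ> gen j)"
    by blast
  define r s where "r = inv x a'" and "s = inv x c'"
  have xr: "x r = a'" "x s = c'" using x by (auto simp: r_def s_def)
  have "a' \<in> SN n" "c' \<in> SN n" using * P U by (auto simp: Pairs_def)
  then have rs: "r \<in> SN n" "s \<in> SN n" using Bn_SN[OF x, of r] Bn_SN[OF x, of s] unfolding xr by auto
  have notin: "(x r, x s) \<notin> Inv n x" "(x r, x s) \<noteq> (?a, ?c)"
    using *(4) Inv_gen[OF x j asc] unfolding xr by auto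
  then have "r \<le> s" using Inv_at[OF x, of r s] rs *(3) unfolding xr by auto
  moreover have "r \<noteq> s" using xr *(3) by auto
  ultimately have less: "r < s" by simp
  have adj: "m < posl j \<or> m = posl j \<or> m = posr j \<or> posr j < m" if "m \<in> SN n" for m
    using that by (auto simp: posl_def posr_def SN_iff)
  have W: "witness n U x j r" if "a' \<noteq> ?a" "r < posl j"
    using that *(1) rs xr by (auto simp: witness_def)
  have W': "witness n U x j s" if "c' \<noteq> ?c" "posr j < s"
    using that *(2) rs xr by (auto simp: witness_def)
  have rl: "r = posl j \<longleftrightarrow> a' = ?a" "s = posr j \<longleftrightarrow> c' = ?c" "r \<noteq> posr j" "s \<noteq> posl j"
    using xr Bn_eq_iff[OF x] * by auto
  show ?thesis
  proof (cases "a' = ?a")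
    case True
    then have "c' \<noteq> ?c" using notin xr by auto
    then have "posr j < s" using adj[OF rs(2)] less True rl posl_less_posr[of j] by auto
    then show ?thesis using W' \<open>c' \<noteq> ?c\<close> by blast
  next
    case False
    show ?thesis
    proof (cases "r < posl j")
      case True then show ?thesis using W False by blast
    next
      case r: False
      then have "posr j < r" using adj[OF rs(1)] rl False by auto
      then show ?thesis using W' less rl by fastforce
    qed
  qed
qed

text \<open>A pair added on the way up from \<open>w\<close> is missing in \<open>w\<close>, hence
  not in the \<open>bottom\<close> for \<open>x\<close>, and by monotonicity not in that for the
  next element; so \<open>ex_witness\<close> applies to each cover.\<close>

lemma etaB_interval:
  assumes x: "x \<in> Bn n" and U: "up_dn n U"
  shows "w \<in> Bn n \<Longrightarrow> Inv n w \<subseteq> Inv n x \<Longrightarrow> bottom n U (Inv n x) \<subseteq> Inv n w \<Longrightarrow> etaB n U w = etaB n U x"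
proof (induction "card (Inv n x - Inv n w)" arbitrary: w rule: less_induct)
  case less
  show ?case
  proof (cases "Inv n w = Inv n x")
    case True
    then show ?thesis using Inv_inject less.prems(1) x by blast
  next
    case False
    note w = less.prems(1)
    obtain j where j: "j < n" "w (posl j) < w (posr j)" "Inv n (w \<circ> gen j) \<subseteq> Inv n x"
      using good_step[OF w good_Inv[OF x]] less.prems(2) False by blast
    have "(w (posl j), w (posr j)) \<notin> bottom n U (Inv n (w \<circ> gen j))"
      using bottom_mono[OF j(3)] less.prems(3) Inv_gen_notin(1)[OF w j(2)] by blast
    then obtain m where "witness n U w j m"
      using ex_witness[OF w _ j(1,2)] U unfolding up_dn_def by blast
    then have "etaB n U (w \<circ> gen j) = etaB n U w" using etaB_gen[OF w U j(1)] by blast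
    moreover have "etaB n U (w \<circ> gen j) = etaB n U x"
    proof (rule less.hyps)
      show "card (Inv n x - Inv n (w \<circ> gen j)) < card (Inv n x - Inv n w)"
        using Inv_gen_asc[OF w j(1,2)] j(3) by (intro psubset_card_mono) auto
      show "bottom n U (Inv n x) \<subseteq> Inv n (w \<circ> gen j)"
        using less.prems(3) Inv_gen_asc[OF w j(1,2)] by blast
    qed (use w j in \<open>auto\<close>)
    ultimately show ?thesis by simp
  qed
qed

text \<open>The path of \<open>x\<close> at the time when \<open>c\<close> has just been read has an edge above or below
  \<open>a\<close> and \<open>c\<close>, and this edge records that \<open>c\<close> precedes \<open>a\<close>.\<close>
lemma etaB_bottom_aux:
  assumes x: "x \<in> Bn n" and y: "y \<in> Bn n" and U: "U \<subseteq> SN n"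
    and bx: "Inv n x \<subseteq> bottom n U (Inv n x)"
    and eta: "etaB n U x = etaB n U y"
    and ac: "(a, c) \<in> Inv n x"
    and narrow: "\<And>a' c'. c' - a' < c - a \<Longrightarrow> (a', c') \<in> Inv n x \<longleftrightarrow> (a', c') \<in> Inv n y"
  shows "(a, c) \<in> Inv n y"
proof (rule ccontr)
  assume nac: "(a, c) \<notin> Inv n y"
  have P: "a \<in> SN n" "c \<in> SN n" "a < c" using ac by (auto simp: Inv_def Pairs_def)
  define k where "k = nat (idx n x c)"
  have k: "int k = idx n x c" "k \<le> 2 * n"
    unfolding k_def using idx_bounds[OF x P(2)] by auto
  let ?l = "lam n U x k"
  have mem: "v \<in> ?l \<longleftrightarrow> (v \<in> U \<longleftrightarrow> idx n x v \<le> idx n x c)" if "v \<in> SN n" for v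
  proof -
    have "v \<noteq> int n + 1" "v \<noteq> - (int n + 1)" using that by (auto simp: SN_iff)
    then show ?thesis using that unfolding lam_eq[OF x U k(2)] k(1) by blast
  qed
  have ends: "- (int n + 1) \<in> ?l" "int n + 1 \<in> ?l" and lsub: "?l \<subseteq> SN (n + 1)"
    unfolding lam_eq[OF x U k(2)] by (auto simp: SN_iff)
  \<comment> \<open>An up \<open>b\<close> is still unread, because \<open>bottom\<close> puts
    \<open>(b, c)\<close> into \<open>Inv n x\<close>. For a down \<open>b\<close> it gives
    \<open>(a, b)\<close>; were \<open>(b, c)\<close> inverted as well, both narrower pairs would be
    inverted in \<open>y\<close>, against \<open>nac\<close>. So \<open>b\<close> has been
    deleted.\<close>
  have inside: "b \<notin> ?l" if "b \<in> SN n" "a < b" "b < c" for b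
  proof (cases "b \<in> U")
    case True
    then have "(b, c) \<in> Inv n x" using bottomD[of a c n U _ b c] bx ac that by blast
    then have "idx n x c < idx n x b" using idx_less_Inv[OF x that(1) P(2) that(3)] by simp
    then show ?thesis using mem that True by simp
  next
    case False
    then have ab: "(a, b) \<in> Inv n x" using bottomD[of a c n U _ a b] bx ac that by blast
    have "(b, c) \<notin> Inv n x"
    proof
      assume "(b, c) \<in> Inv n x"
      then have "(a, b) \<in> Inv n y" "(b, c) \<in> Inv n y" using narrow ab that by auto
      then show False using nac good_trans[OF good_Inv[OF y]] by (auto dest: transD)
    qed
    then have "idx n x b < idx n x c" using idx_less_Inv'[OF x that(1) P(2) that(3)] by simp
    then show ?thesis using mem that False by simp
  qed
  have amem: "a \<in> ?l \<longleftrightarrow> a \<notin> U"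
    using mem[OF P(1)] idx_less_Inv[OF x P] ac by auto
  have cmem: "c \<in> ?l \<longleftrightarrow> c \<in> U" using mem[OF P(2)] by auto
  \<comment> \<open>The nearest path vertices on either side. The index \<open>a\<close> is one
    itself iff it is down, being read after \<open>c\<close>; \<open>c\<close> is one iff it is up,
    having just been read.\<close>
  define p where "p = Max {v \<in> ?l. v \<le> a}"
  define q where "q = Min {v \<in> ?l. c \<le> v}"
  have fin: "finite ?l" using lsub finite_subset finite_SN by blast
  have "p \<in> {v \<in> ?l. v \<le> a}" unfolding p_def
    by (rule Max_in) (use fin ends P in \<open>auto simp: SN_iff\<close>)
  then have p: "p \<in> ?l" "p \<le> a" by auto
  have "q \<in> {v \<in> ?l. c \<le> v}" unfolding q_def
    by (rule Min_in) (use fin ends P in \<open>auto simp: SN_iff\<close>)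
  then have q: "q \<in> ?l" "c \<le> q" by auto
  have pmax: "v \<le> p" if "v \<in> ?l" "v \<le> a" for v unfolding p_def using that fin by (intro Max_ge) auto
  have qmin: "q \<le> v" if "v \<in> ?l" "c \<le> v" for v unfolding q_def using that fin by (intro Min_le) auto
  have between: "v \<notin> ?l" if v: "p < v" "v < q" for v
  proof
    assume vl: "v \<in> ?l"
    have av: "a < v" using pmax[OF vl] v(1) by (cases "v \<le> a") auto
    have vc: "v < c" using qmin[OF vl] v(2) by (cases "c \<le> v") auto
    have "v \<in> SN n" using vl av vc P unfolding lam_eq[OF x U k(2)] by (auto simp: SN_iff)
    then show False using inside av vc vl by blast
  qed
  have edge: "(p, q) \<in> path_edges ?l" using p q P between by (auto simp: path_edges_def)
  have ap: "a \<notin> U \<longleftrightarrow> a = p" using amem p pmax by force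
  have cq: "c \<in> U \<longleftrightarrow> c = q" using cmem q qmin by force
  have anend: "a \<noteq> int n + 1" "a \<noteq> - (int n + 1)" "c \<noteq> int n + 1" "c \<noteq> - (int n + 1)"
    using P by (auto simp: SN_iff)
  \<comment> \<open>Not a boundary edge: an up \<open>a\<close> lies strictly between
    \<open>p\<close> and \<open>q\<close>, while a down \<open>a\<close> equals \<open>p\<close>.
    The lower boundary is treated in the same way with \<open>c\<close> and
    \<open>q\<close>.\<close>
  have "(p, q) \<notin> path_edges (U \<union> {- (int n + 1), int n + 1})"
  proof
    assume A: "(p, q) \<in> path_edges (U \<union> {- (int n + 1), int n + 1})"
    show False
    proof (cases "a \<in> U")
      case True
      then have "p < a" "a < q" using ap p q P by auto
      then show False using A True by (auto simp: path_edges_def)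
    next
      case False
      then show False using A ap anend by (auto simp: path_edges_def)
    qed
  qed
  moreover have "(p, q) \<notin> path_edges ((SN n - U) \<union> {- (int n + 1), int n + 1})"
  proof
    assume A: "(p, q) \<in> path_edges ((SN n - U) \<union> {- (int n + 1), int n + 1})"
    show False
    proof (cases "c \<in> U")
      case False
      then have "p < c" "c < q" using cq p q P by auto
      then show False using A False P by (auto simp: path_edges_def)
    next
      case True
      then show False using A cq anend by (auto simp: path_edges_def)
    qed
  qed
  ultimately have diag: "(p, q) \<in> diagQ n U"
    using p q P lsub by (auto simp: diagQ_def)
  then have "(p, q) \<in> etaB n U x" using edge k(2) by (auto simp: etaB_def)
  then have "\<forall>u \<in> before n U p q. \<forall>v \<in> after n U p q. inv y u < inv y v"
    using eta etaB_iff[OF y U] by blast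
  moreover have "c \<in> before n U p q" using P p q cq by (auto simp: before_def)
  moreover have "a \<in> after n U p q" using P p q ap by (auto simp: after_def)
  ultimately have "inv y c < inv y a" by blast
  then show False using nac P by (auto simp: Inv_def Pairs_def)
qed

lemma etaB_bottom_inj:
  assumes x: "x \<in> Bn n" and y: "y \<in> Bn n" and U: "U \<subseteq> SN n"
    and bx: "Inv n x \<subseteq> bottom n U (Inv n x)" and by': "Inv n y \<subseteq> bottom n U (Inv n y)"
    and eta: "etaB n U x = etaB n U y"
  shows "Inv n x = Inv n y"
proof -
  have "(a, c) \<in> Inv n x \<longleftrightarrow> (a, c) \<in> Inv n y" for a c
  proof (induction "nat (c - a)" arbitrary: a c rule: less_induct)
    case less
    have narrow: "(a', c') \<in> Inv n x \<longleftrightarrow> (a', c') \<in> Inv n y" if "c' - a' < c - a" for a' c'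
    proof (cases "a' < c'")
      case True
      then show ?thesis using less[of c' a'] that by auto
    qed (auto simp: Inv_def Pairs_def)
    show ?case
      using etaB_bottom_aux[OF x y U bx eta] etaB_bottom_aux[OF y x U by' eta[symmetric]] narrow by metis
  qed
  then show ?thesis by auto
qed

lemma ex_bottom:
  assumes x: "x \<in> Bn n" and U: "up_dn n U"
  obtains w where "w \<in> Bn n" "Inv n w = bottom n U (Inv n x)" "etaB n U w = etaB n U x"
proof -
  obtain w where w: "w \<in> Bn n" "Inv n w = bottom n U (Inv n x)"
    using good_realize[OF good_bottom[OF good_Inv[OF x] U]] by blast
  moreover have "etaB n U w = etaB n U x"
    using etaB_interval[OF x U w(1)] w(2) bottom_subset by blast
  ultimately show thesis using that by blast
qed

lemma etaB_eq_iff: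
  assumes x: "x \<in> Bn n" and y: "y \<in> Bn n" and U: "up_dn n U"
  shows "etaB n U x = etaB n U y \<longleftrightarrow> bottom n U (Inv n x) = bottom n U (Inv n y)"
proof -
  have sub: "U \<subseteq> SN n" using U unfolding up_dn_def by blast
  obtain v where v: "v \<in> Bn n" "Inv n v = bottom n U (Inv n x)" "etaB n U v = etaB n U x"
    using ex_bottom[OF x U] by blast
  obtain w where w: "w \<in> Bn n" "Inv n w = bottom n U (Inv n y)" "etaB n U w = etaB n U y"
    using ex_bottom[OF y U] by blast
  have "Inv n v = Inv n w" if "etaB n U v = etaB n U w"
    using etaB_bottom_inj[OF v(1) w(1) sub] that bottom_idem[OF sub] v(2) w(2) by simp
  moreover have "v = w" if "Inv n v = Inv n w" using Inv_inject v(1) w(1) that by blast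
  ultimately show ?thesis using v w by metis
qed

text \<open>It suffices to compare bottoms. The bottom of \<open>wmeet n x z\<close> lies below that
  of \<open>x\<close>, which is that of \<open>y\<close>, and below \<open>z\<close>; so it lies
  below \<open>wmeet n y z\<close>, and by idempotence below the bottom of the latter. The converse
  is symmetric.\<close>

lemma etaB_wmeet:
  assumes B: "x \<in> Bn n" "y \<in> Bn n" "z \<in> Bn n" and U: "up_dn n U" and eq: "etaB n U x = etaB n U y"
  shows "etaB n U (wmeet n x z) = etaB n U (wmeet n y z)"
proof -
  have sub: "U \<subseteq> SN n" using U unfolding up_dn_def by blast
  have le: "bottom n U (Inv n (wmeet n u z)) \<subseteq> bottom n U (Inv n (wmeet n v z))"
    if u: "u \<in> Bn n" and v: "v \<in> Bn n" and le: "bottom n U (Inv n u) \<subseteq> Inv n v" for u v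
  proof -
    let ?S = "bottom n U (Inv n (wmeet n u z))"
    have "?S \<subseteq> Inv n (wmeet n v z)"
    proof (rule wmeet_greatest[OF v B(3)])
      show "good n ?S" using good_bottom good_Inv wmeet_lower(1)[OF u B(3)] U by blast
      show "?S \<subseteq> Inv n v" using bottom_mono[OF wmeet_lower(2)[OF u B(3)]] le by blast
      show "?S \<subseteq> Inv n z" using bottom_subset wmeet_lower(3)[OF u B(3)] by blast
    qed
    then show ?thesis using bottom_mono bottom_idem[OF sub] by metis
  qed
  have e: "bottom n U (Inv n x) = bottom n U (Inv n y)" using etaB_eq_iff B U eq by blast
  have "bottom n U (Inv n (wmeet n x z)) = bottom n U (Inv n (wmeet n y z))"
    using le[OF B(1,2)] le[OF B(2,1)] e bottom_subset by (metis subset_antisym)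
  then show ?thesis using etaB_eq_iff wmeet_lower(1) B U by blast
qed

lemma up_dn_Compl: assumes "up_dn n U" shows "up_dn n (SN n - U)"
proof -
  have "i \<in> SN n - U \<longleftrightarrow> - i \<notin> SN n - U" if "i \<in> SN n" for i
    using up_dn_mem[OF assms that] up_dn_mem[OF assms, of "- i"] that by simp
  then show ?thesis unfolding up_dn_def by blast
qed

text \<open>Complementation of inversion sets, here \<open>f\<close>, turns joins into meets and
  \<open>U\<close> into \<open>SN n - U\<close>, so \<open>etaB_wmeet\<close> applies.\<close>

lemma etaB_wjoin:
  assumes B: "x \<in> Bn n" "y \<in> Bn n" "z \<in> Bn n" and U: "up_dn n U" and eq: "etaB n U x = etaB n U y"
  shows "etaB n U (wjoin n x z) = etaB n U (wjoin n y z)"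
proof -
  have sub: "U \<subseteq> SN n" using U unfolding up_dn_def by blast
  have "\<exists>u' \<in> Bn n. Inv n u' = Pairs n - Inv n u" if "u \<in> Bn n" for u
    using good_realize[OF good_Compl[OF good_Inv[OF that]]] by metis
  then obtain f where f: "\<And>u. u \<in> Bn n \<Longrightarrow> f u \<in> Bn n" "\<And>u. u \<in> Bn n \<Longrightarrow> Inv n (f u) = Pairs n - Inv n u"
    by metis
  have e: "etaB n (SN n - U) (f u) = etaB n U u" if "u \<in> Bn n" for u
    using etaB_complement f sub that by blast
  have ff: "Pairs n - Inv n (f u) = Inv n u" if "u \<in> Bn n" for u
    using f(2)[OF that] Inv_subset_Pairs by blast
  have j: "etaB n U (wjoin n u z) = etaB n (SN n - U) (wmeet n (f u) (f z))" if u: "u \<in> Bn n" for u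
  proof -
    note J = wjoin[OF u B(3)]
    have "Inv n (wmeet n (f u) (f z)) = Pairs n - Inv n (wjoin n u z)"
      using wmeet[OF f(1)[OF u] f(1)[OF B(3)]] J ff u B(3) by simp
    then show ?thesis
      using etaB_complement[of "wjoin n u z" n "wmeet n (f u) (f z)" U] J wmeet_lower(1) f(1) u B(3) sub
      by metis
  qed
  show ?thesis
    unfolding j[OF B(1)] j[OF B(2)]
    using etaB_wmeet[OF f(1) f(1) f(1) up_dn_Compl[OF U]] e B eq by metis
qed

lemma lat_cong_etaB:
  assumes U: "up_dn n U"
  shows "lat_cong n {(x, y). x \<in> Bn n \<and> y \<in> Bn n \<and> etaB n U x = etaB n U y}"
proof -
  let ?R = "{(x, y). x \<in> Bn n \<and> y \<in> Bn n \<and> etaB n U x = etaB n U y}"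
  have "equiv (Bn n) ?R" by (intro equivI refl_onI symI transI) auto
  moreover have "(wmeet n x z, wmeet n y z) \<in> ?R \<and> (wjoin n x z, wjoin n y z) \<in> ?R"
    if "x \<in> Bn n" "y \<in> Bn n" "z \<in> Bn n" "(x, y) \<in> ?R" for x y z
    using that etaB_wmeet[OF that(1-3) U] etaB_wjoin[OF that(1-3) U] wmeet_lower(1) wjoin_upper(1) by simp
  ultimately show ?thesis unfolding lat_cong_def by blast
qed

section \<open>Covers forced by the generating relations\<close>

lemma InvI:
  assumes "x \<in> Bn n" "x p = u" "x q = v" "u < v" "q < p" "p \<in> SN n" "q \<in> SN n"
  shows "(u, v) \<in> Inv n x"
  using assms Inv_at[OF assms(1), of p q] by auto

lemma not_InvI:
  assumes "x \<in> Bn n" "x p = u" "x q = v" "u < v" "p < q" "p \<in> SN n" "q \<in> SN n"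
  shows "(u, v) \<in> Pairs n - Inv n x"
proof -
  have "(u, v) \<in> Pairs n" using assms Bn_SN[OF assms(1)] by (auto simp: Pairs_def)
  then show ?thesis using assms Inv_at[OF assms(1), of p q] by auto
qed

lemma pos_Suc [simp]: "posl (Suc k) = int k + 1" "posr (Suc k) = int k + 2" "posl 0 = - 1" "posr 0 = 1"
  by (auto simp: posl_def posr_def)

text \<open>Neighbouring generators on a window of four positions, in the form
  \<open>int k + ...\<close> in which the simplifier meets these positions when it evaluates
  products.\<close>

lemma gen_near [simp]:
  "1 \<le> k \<Longrightarrow> gen k (int k) = int k + 1"
  "1 \<le> k \<Longrightarrow> gen k (int k + 1) = int k"
  "1 \<le> k \<Longrightarrow> gen k (int k + 2) = int k + 2"
  "1 \<le> k \<Longrightarrow> gen k (int k + 3) = int k + 3"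
  "gen (Suc k) (int k) = int k"
  "gen (Suc k) (int k + 1) = int k + 2"
  "gen (Suc k) (int k + 2) = int k + 1"
  "gen (Suc k) (int k + 3) = int k + 3"
  "gen (Suc (Suc k)) (int k) = int k"
  "gen (Suc (Suc k)) (int k + 1) = int k + 1"
  "gen (Suc (Suc k)) (int k + 2) = int k + 3"
  "gen (Suc (Suc k)) (int k + 3) = int k + 2"
  by (auto simp: gen_def)

lemma gen_center [simp]:
  "gen 0 1 = - 1" "gen 0 (- 1) = 1" "gen 0 2 = 2" "gen 0 (- 2) = - 2" "gen 0 3 = 3" "gen 0 (- 3) = - 3"
  "gen (Suc 0) 1 = 2" "gen (Suc 0) 2 = 1" "gen (Suc 0) 3 = 3"
  "gen (Suc 0) (- 1) = - 2" "gen (Suc 0) (- 2) = - 1" "gen (Suc 0) (- 3) = - 3"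
  "gen (Suc (Suc 0)) 1 = 1" "gen (Suc (Suc 0)) 2 = 3" "gen (Suc (Suc 0)) 3 = 2"
  "gen (Suc (Suc 0)) (- 1) = - 1" "gen (Suc (Suc 0)) (- 2) = - 3" "gen (Suc (Suc 0)) (- 3) = - 2"
  by (auto simp: gen_def)

lemma gen_left: "1 \<le> k \<Longrightarrow> m < int k \<Longrightarrow> j = k \<or> j = Suc k \<Longrightarrow> gen j m < int k"
  and gen_right: "int k + 2 < m \<Longrightarrow> j = k \<or> j = Suc k \<Longrightarrow> gen j m = m"
  and gen_outer: "2 < m \<or> m < - 2 \<Longrightarrow> j = 0 \<or> j = Suc 0 \<Longrightarrow> gen j m = m"
  by (auto simp: gen_def)

lemma gen_SN: "j < n \<Longrightarrow> gen j m \<in> SN n \<longleftrightarrow> m \<in> SN n"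
  using Bn_SN gen_Bn by blast

lemma gen_far:
  assumes "j \<noteq> i" "j \<noteq> Suc i" "Suc j \<noteq> i"
  shows "gen j (posl i) = posl i" "gen j (posr i) = posr i"
    "m \<noteq> 0 \<Longrightarrow> m < posl i \<Longrightarrow> gen j m < posl i" "m \<noteq> 0 \<Longrightarrow> posr i < m \<Longrightarrow> posr i < gen j m"
proof -
  have "j + 2 \<le> i \<or> i + 2 \<le> j" using assms by linarith
  then show "gen j (posl i) = posl i" "gen j (posr i) = posr i"
    by (elim disjE; simp add: gen_def posl_def posr_def)+
  show "gen j m < posl i" if "m \<noteq> 0" "m < posl i"
    using \<open>j + 2 \<le> i \<or> i + 2 \<le> j\<close> that by (elim disjE) (simp_all add: gen_def posl_def split: if_splits)
  show "posr i < gen j m" if "m \<noteq> 0" "posr i < m"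
    using \<open>j + 2 \<le> i \<or> i + 2 \<le> j\<close> that by (elim disjE) (simp_all add: gen_def posr_def split: if_splits)
qed

lemma witness_ascent: "witness n U y i m \<Longrightarrow> y (posl i) < y (posr i)"
  by (auto simp: witness_def)

section \<open>An arbitrary congruence containing the generating relations\<close>

locale cambrian =
  fixes n :: nat and U :: "int set" and \<Theta> :: "((int \<Rightarrow> int) \<times> (int \<Rightarrow> int)) set"
  assumes U: "up_dn n U"
    and cong: "lat_cong n \<Theta>"
    and gens: "\<And>s t. (s, t) \<in> orient n U \<Longrightarrow> (gen t, word_prod (altw t s (coxm s t - 1))) \<in> \<Theta>"
begin

lemma refl: "x \<in> Bn n \<Longrightarrow> (x, x) \<in> \<Theta>"
  and sym: "(x, y) \<in> \<Theta> \<Longrightarrow> (y, x) \<in> \<Theta>"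
  and trans: "(x, y) \<in> \<Theta> \<Longrightarrow> (y, z) \<in> \<Theta> \<Longrightarrow> (x, z) \<in> \<Theta>"
  using cong unfolding lat_cong_def equiv_def
  by (blast dest: refl_onD symD transD)+

lemma in_Bn: "(x, y) \<in> \<Theta> \<Longrightarrow> x \<in> Bn n \<and> y \<in> Bn n"
  using cong unfolding lat_cong_def equiv_def refl_on_def by blast

lemma meet: "(x, y) \<in> \<Theta> \<Longrightarrow> z \<in> Bn n \<Longrightarrow> (wmeet n x z, wmeet n y z) \<in> \<Theta>"
  and join: "(x, y) \<in> \<Theta> \<Longrightarrow> z \<in> Bn n \<Longrightarrow> (wjoin n x z, wjoin n y z) \<in> \<Theta>"
  using cong in_Bn unfolding lat_cong_def by blast+

lemma wjoin_absorb:
  assumes "x \<in> Bn n" "y \<in> Bn n" "Inv n x \<subseteq> Inv n y" shows "wjoin n x y = y"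
proof -
  have "Inv n x \<union> Inv n y = Inv n y" using assms(3) by blast
  then have "Inv n (wjoin n x y) = Inv n y"
    using wjoin[OF assms(1,2)] good_trans[OF good_Inv[OF assms(2)]] by (simp add: trancl_id)
  then show ?thesis using Inv_inject wjoin_upper(1) assms(1,2) by blast
qed

lemma wmeet_absorb:
  assumes "x \<in> Bn n" "y \<in> Bn n" "Inv n y \<subseteq> Inv n x" shows "wmeet n x y = y"
proof -
  have "Inv n y \<subseteq> Inv n (wmeet n x y)"
    using wmeet_greatest[OF assms(1,2) good_Inv[OF assms(2)] assms(3)] by blast
  then have "Inv n (wmeet n x y) = Inv n y" using wmeet_lower(3)[OF assms(1,2)] by blast
  then show ?thesis using Inv_inject wmeet_lower(1) assms(1,2) by blast
qed

text \<open>Joining \<open>x\<close> and \<open>y\<close> with \<open>u\<close> yields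
  \<open>u\<close> and \<open>y\<close>.\<close>

lemma convex:
  assumes "(x, y) \<in> \<Theta>" "u \<in> Bn n" "Inv n x \<subseteq> Inv n u" "Inv n u \<subseteq> Inv n y"
  shows "(x, u) \<in> \<Theta>" "(u, y) \<in> \<Theta>"
proof -
  have B: "x \<in> Bn n" "y \<in> Bn n" using in_Bn assms(1) by auto
  have "wjoin n x u = u" using wjoin_absorb B assms by blast
  moreover have "wjoin n y u = y"
  proof -
    have "Inv n y \<union> Inv n u = Inv n y" using assms(4) by blast
    then have "Inv n (wjoin n y u) = Inv n y"
      using wjoin[OF B(2) assms(2)] good_trans[OF good_Inv[OF B(2)]] by (simp add: trancl_id)
    then show ?thesis using Inv_inject wjoin_upper(1) assms(2) B by blast
  qed
  ultimately show "(u, y) \<in> \<Theta>" using join[OF assms(1,2)] by simp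
  then show "(x, u) \<in> \<Theta>" using assms(1) sym trans by blast
qed

text \<open>The two forcing rules: joining with \<open>y\<close>, respectively meeting with \<open>y \<circ> gen i\<close>, carries a
  contracted cover \<open>(p, p \<circ> gen k)\<close> to a pair of congruent elements that straddles the cover
  \<open>(y, y \<circ> gen i)\<close>.\<close>

lemma force_up:
  assumes y: "y \<in> Bn n" and i: "i < n" and asc: "y (posl i) < y (posr i)"
    and p: "p \<in> Bn n" and k: "k < n" and ascp: "p (posl k) < p (posr k)"
    and pp: "(p, p \<circ> gen k) \<in> \<Theta>" and le: "Inv n p \<subseteq> Inv n y"
    and chain: "(y (posl i), y (posr i)) \<in>
      (insert (p (posl k), p (posr k)) (insert (- p (posr k), - p (posl k)) (Inv n y)))\<^sup>+"
  shows "(y, y \<circ> gen i) \<in> \<Theta>"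
proof -
  let ?p' = "p \<circ> gen k" and ?y' = "y \<circ> gen i"
  let ?J = "wjoin n ?p' y"
  have p': "?p' \<in> Bn n" using p k by simp
  have yJ: "(y, ?J) \<in> \<Theta>" using join[OF pp y] wjoin_absorb[OF p y le] by simp
  have "(y (posl i), y (posr i)) \<in> (Inv n ?p' \<union> Inv n y)\<^sup>+"
    by (rule trancl_mono[OF chain]) (auto simp: Inv_gen[OF p k ascp])
  then have l: "(y (posl i), y (posr i)) \<in> Inv n ?J" using wjoin[OF p' y] by simp
  then have "(- y (posr i), - y (posl i)) \<in> Inv n ?J"
    using good_sym[OF good_Inv] wjoin_upper(1)[OF p' y] by blast
  then have "Inv n ?y' \<subseteq> Inv n ?J"
    using l wjoin_upper(3)[OF p' y] unfolding Inv_gen[OF y i asc] by blast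
  moreover have "Inv n y \<subseteq> Inv n ?y'" using Inv_gen_asc[OF y i asc] by blast
  ultimately show ?thesis using convex(1)[OF yJ Bn_comp_gen[OF y i]] by blast
qed

lemma force_down:
  assumes y: "y \<in> Bn n" and i: "i < n" and asc: "y (posl i) < y (posr i)"
    and p: "p \<in> Bn n" and k: "k < n" and ascp: "p (posl k) < p (posr k)"
    and pp: "(p, p \<circ> gen k) \<in> \<Theta>" and le: "Inv n (y \<circ> gen i) \<subseteq> Inv n (p \<circ> gen k)"
    and chain: "(y (posl i), y (posr i)) \<in>
      (insert (p (posl k), p (posr k)) (insert (- p (posr k), - p (posl k)) (Pairs n - Inv n (y \<circ> gen i))))\<^sup>+"
  shows "(y, y \<circ> gen i) \<in> \<Theta>"
proof -
  let ?p' = "p \<circ> gen k" and ?y' = "y \<circ> gen i"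
  let ?M = "wmeet n p ?y'"
  have y': "?y' \<in> Bn n" and p': "?p' \<in> Bn n" using y i p k by simp_all
  have M: "?M \<in> Bn n" using wmeet_lower(1)[OF p y'] .
  have My: "(?M, ?y') \<in> \<Theta>" using meet[OF pp y'] wmeet_absorb[OF p' y' le] by simp
  have "Inv n ?p' \<subseteq> Pairs n" by (rule Inv_subset_Pairs)
  then have "(p (posl k), p (posr k)) \<in> Pairs n - Inv n p" "(- p (posr k), - p (posl k)) \<in> Pairs n - Inv n p"
    using Inv_gen_notin[OF p ascp] unfolding Inv_gen[OF p k ascp] by auto
  then have "(y (posl i), y (posr i)) \<in> ((Pairs n - Inv n p) \<union> (Pairs n - Inv n ?y'))\<^sup>+"
    by (intro trancl_mono[OF chain]) auto
  then have l: "(y (posl i), y (posr i)) \<notin> Inv n ?M" using wmeet[OF p y'] by simp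
  then have "(- y (posr i), - y (posl i)) \<notin> Inv n ?M"
    using good_sym[OF good_Inv[OF M], of "- y (posr i)" "- y (posl i)"] by auto
  then have "Inv n ?M \<subseteq> Inv n y"
    using l wmeet_lower(3)[OF p y'] unfolding Inv_gen[OF y i asc] by blast
  moreover have "Inv n y \<subseteq> Inv n ?y'" using Inv_gen_asc[OF y i asc] by blast
  ultimately show ?thesis using convex(2)[OF My y] by blast
qed

lemma slide_up:
  assumes "y \<in> Bn n" "i < n" "y (posl i) < y (posr i)" "p \<in> Bn n" "k < n"
    and "(p, p \<circ> gen k) \<in> \<Theta>" and "Inv n p \<subseteq> Inv n y"
    and lab: "p (posl k) = y (posl i) \<and> p (posr k) = y (posr i) \<or>
      p (posl k) = - y (posr i) \<and> p (posr k) = - y (posl i)"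
  shows "(y, y \<circ> gen i) \<in> \<Theta>"
  using lab by (intro force_up[OF assms(1-5) _ assms(6,7)] r_into_trancl) (use assms(3) in auto)

text \<open>Carries a contraction from a larger element to a smaller one with the same label. Its
  premise is never an induction hypothesis; it is supplied by the rank two lemmas below.\<close>

lemma slide_down:
  assumes y: "y \<in> Bn n" "i < n" "y (posl i) < y (posr i)" and p: "p \<in> Bn n" "k < n"
    and pp: "(p, p \<circ> gen k) \<in> \<Theta>" and le: "Inv n y \<subseteq> Inv n p"
    and lab: "p (posl k) = y (posl i)" "p (posr k) = y (posr i)"
  shows "(y, y \<circ> gen i) \<in> \<Theta>"
proof (rule force_down[OF y p _ pp])
  show asc: "p (posl k) < p (posr k)" using lab y(3) by simp
  show "Inv n (y \<circ> gen i) \<subseteq> Inv n (p \<circ> gen k)"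
    using le lab unfolding Inv_gen[OF y] Inv_gen[OF p asc] by auto
qed (use lab in auto)

text \<open>The hypothesis of the outer induction, on the width; \<open>smaller\<close> is its inner
  counterpart.\<close>

definition narrow :: "int \<Rightarrow> bool" where
  "narrow w \<longleftrightarrow> (\<forall>p i m. p \<in> Bn n \<longrightarrow> i < n \<longrightarrow> witness n U p i m \<longrightarrow> p (posr i) - p (posl i) < w
     \<longrightarrow> (p, p \<circ> gen i) \<in> \<Theta>)"

lemma narrowD:
  assumes "narrow w" "p \<in> Bn n" "i < n" "m \<in> SN n" "p (posl i) < p m" "p m < p (posr i)"
    "m < posl i \<and> p m \<in> U \<or> posr i < m \<and> p m \<notin> U" "p (posr i) - p (posl i) < w"
  shows "(p, p \<circ> gen i) \<in> \<Theta>"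
proof -
  have "witness n U p i m" using assms by (auto simp: witness_def)
  then show ?thesis using assms unfolding narrow_def by blast
qed

text \<open>In the next four lemmas an entry other than the witness lies between the two exchanged entries
  and next to them; in the rank two interval spanned by the three entries the cover is a side edge,
  hence forced by a narrower bottom or top edge that has the same witness.\<close>

lemma contract_left:
  assumes y: "y \<in> Bn n" and k: "1 \<le> k" "Suc k < n"
    and z: "y (int k + 1) < y (int k)" "y (int k) < y (int k + 2)"
    and w: "witness n U y (Suc k) m" "y m \<noteq> y (int k)" and N: "narrow (y (int k + 2) - y (int k + 1))"
  shows "(y, y \<circ> gen (Suc k)) \<in> \<Theta>"
proof -
  have kn: "k < n" using k by simp
  have SN: "int k \<in> SN n" "int k + 1 \<in> SN n" "int k + 2 \<in> SN n" "m \<in> SN n"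
    using k w by (auto simp: SN_iff witness_def)
  have pk: "posl k = int k" "posr k = int k + 1" using k by (auto simp: posl_def posr_def)
  have m: "m < int k \<and> y m \<in> U \<or> int k + 2 < m \<and> y m \<notin> U" "y (int k + 1) < y m" "y m < y (int k + 2)"
  proof -
    have "m \<noteq> int k" using w(2) by auto
    then show "m < int k \<and> y m \<in> U \<or> int k + 2 < m \<and> y m \<notin> U" "y (int k + 1) < y m" "y m < y (int k + 2)"
      using w(1) by (auto simp: witness_def)
  qed
  have asc: "y (posl (Suc k)) < y (posr (Suc k))" using witness_ascent[OF w(1)] .
  have side: "gen j m < int k" if "m < int k" "j = k \<or> j = Suc k" for j m
    using gen_left[of k m j] that k by simp
  have side': "gen j m = m" if "int k + 2 < m" "j = k \<or> j = Suc k" for j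
    using gen_right[of k m j] that by simp
  consider "y (int k) < y m" | "y m < y (int k)" using w(2) by linarith
  then show ?thesis
  proof cases
    case 1
    \<comment> \<open>Write the window as \<open>z a c\<close>. The bottom edge of the hexagon,
      starting at \<open>a z c\<close>, exchanges \<open>z\<close> and \<open>c\<close>, and the
      witness value lies between these.\<close>
    let ?p = "y \<circ> gen k"
    have p: "?p \<in> Bn n" using y kn by simp
    have pp: "(?p, ?p \<circ> gen (Suc k)) \<in> \<Theta>"
    proof (rule narrowD[OF N p k(2), where m = "gen k m"])
      show "gen k m < posl (Suc k) \<and> ?p (gen k m) \<in> U \<or> posr (Suc k) < gen k m \<and> ?p (gen k m) \<notin> U"
        using m(1) gen_left[of k m k] gen_right[of k m k] k by auto
    qed (use k z 1 m SN kn in \<open>auto simp: gen_SN\<close>)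
    show ?thesis
    proof (rule force_up[OF y k(2) asc p k(2) _ pp])
      show "Inv n ?p \<subseteq> Inv n y" using Inv_gen_desc[OF y kn] z pk by auto
      have "(y (int k + 1), y (int k)) \<in> Inv n y"
        by (rule InvI[OF y, of "int k + 1" _ "int k"]) (use z SN in auto)
      then show "(y (posl (Suc k)), y (posr (Suc k))) \<in> (insert (?p (posl (Suc k)), ?p (posr (Suc k)))
          (insert (- ?p (posr (Suc k)), - ?p (posl (Suc k))) (Inv n y)))\<^sup>+"
        using k by (intro trancl.intros(2)[OF r_into_trancl, of _ "y (int k)"]) auto
    qed (use k z in auto)
  next
    case 2
    \<comment> \<open>Now the witness value lies between \<open>a\<close> and \<open>z\<close>, and
      the top edge from \<open>c a z\<close> to \<open>c z a\<close> serves.\<close>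
    let ?y' = "y \<circ> gen (Suc k)"
    let ?p' = "?y' \<circ> gen k"
    let ?p = "?p' \<circ> gen (Suc k)"
    have B: "?y' \<in> Bn n" "?p' \<in> Bn n" "?p \<in> Bn n" using y kn k by simp_all
    have pp: "(?p, ?p \<circ> gen (Suc k)) \<in> \<Theta>"
    proof (rule narrowD[OF N B(3) k(2), where m = "gen (Suc k) (gen k (gen (Suc k) m))"])
      show "gen (Suc k) (gen k (gen (Suc k) m)) < posl (Suc k) \<and> ?p (gen (Suc k) (gen k (gen (Suc k) m))) \<in> U \<or>
          posr (Suc k) < gen (Suc k) (gen k (gen (Suc k) m)) \<and> ?p (gen (Suc k) (gen k (gen (Suc k) m))) \<notin> U"
        using m(1)
      proof
        assume "m < int k \<and> y m \<in> U"
        then show ?thesis using side[of "gen k (gen (Suc k) m)" "Suc k"] side[of "gen (Suc k) m" k] side[of m "Suc k"]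
          by simp
      next
        assume "int k + 2 < m \<and> y m \<notin> U"
        then show ?thesis using side' by simp
      qed
    qed (use k z 2 m SN kn in \<open>auto simp: gen_SN\<close>)
    show ?thesis
    proof (rule force_down[OF y k(2) asc B(3) k(2) _ pp])
      show "Inv n (y \<circ> gen (Suc k)) \<subseteq> Inv n (?p \<circ> gen (Suc k))"
        using Inv_gen_asc[OF B(1) kn] k z pk by auto
      have "(y (int k), y (int k + 2)) \<in> Pairs n - Inv n ?y'"
        by (rule not_InvI[OF B(1), of "int k" _ "int k + 1"]) (use z SN in auto)
      then show "(y (posl (Suc k)), y (posr (Suc k))) \<in> (insert (?p (posl (Suc k)), ?p (posr (Suc k)))
          (insert (- ?p (posr (Suc k)), - ?p (posl (Suc k))) (Pairs n - Inv n ?y')))\<^sup>+"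
        using k by (intro trancl.intros(2)[OF r_into_trancl, of _ "y (int k)"]) auto
    qed (use k z in auto)
  qed
qed

lemma contract_right:
  assumes y: "y \<in> Bn n" and k: "Suc (Suc k) < n"
    and z: "y (int k + 1) < y (int k + 3)" "y (int k + 3) < y (int k + 2)"
    and w: "witness n U y (Suc k) m" "y m \<noteq> y (int k + 3)" and N: "narrow (y (int k + 2) - y (int k + 1))"
  shows "(y, y \<circ> gen (Suc k)) \<in> \<Theta>"
proof -
  have kn: "Suc k < n" using k by simp
  have SN: "int k + 1 \<in> SN n" "int k + 2 \<in> SN n" "int k + 3 \<in> SN n" "m \<in> SN n"
    using k w by (auto simp: SN_iff witness_def)
  have pk: "posl (Suc (Suc k)) = int k + 2" "posr (Suc (Suc k)) = int k + 3" by auto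
  have m: "m < int k + 1 \<and> y m \<in> U \<or> int k + 3 < m \<and> y m \<notin> U" "y (int k + 1) < y m" "y m < y (int k + 2)"
  proof -
    have "m \<noteq> int k + 3" using w(2) by auto
    then show "m < int k + 1 \<and> y m \<in> U \<or> int k + 3 < m \<and> y m \<notin> U" "y (int k + 1) < y m" "y m < y (int k + 2)"
      using w(1) by (auto simp: witness_def)
  qed
  have asc: "y (posl (Suc k)) < y (posr (Suc k))" using witness_ascent[OF w(1)] .
  have side: "gen j m < int k + 1" if "m < int k + 1" "j = Suc k \<or> j = Suc (Suc k)" for j m
    using gen_left[of "Suc k" m j] that by simp
  have side': "gen j m = m" if "int k + 3 < m" "j = Suc k \<or> j = Suc (Suc k)" for j
    using gen_right[of "Suc k" m j] that by simp
  consider "y (int k + 3) < y m" | "y m < y (int k + 3)" using w(2) by linarith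
  then show ?thesis
  proof cases
    case 2
    let ?p = "y \<circ> gen (Suc (Suc k))"
    have p: "?p \<in> Bn n" using y k by simp
    have pp: "(?p, ?p \<circ> gen (Suc k)) \<in> \<Theta>"
    proof (rule narrowD[OF N p kn, where m = "gen (Suc (Suc k)) m"])
      show "gen (Suc (Suc k)) m < posl (Suc k) \<and> ?p (gen (Suc (Suc k)) m) \<in> U \<or>
          posr (Suc k) < gen (Suc (Suc k)) m \<and> ?p (gen (Suc (Suc k)) m) \<notin> U"
        using m(1) side side' by auto
    qed (use k z 2 m SN kn in \<open>auto simp: gen_SN\<close>)
    show ?thesis
    proof (rule force_up[OF y kn asc p kn _ pp])
      show "Inv n ?p \<subseteq> Inv n y" using Inv_gen_desc[OF y k, unfolded pk] z by auto
      have "(y (int k + 3), y (int k + 2)) \<in> Inv n y"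
        by (rule InvI[OF y, of "int k + 3" _ "int k + 2"]) (use z SN in auto)
      then show "(y (posl (Suc k)), y (posr (Suc k))) \<in> (insert (?p (posl (Suc k)), ?p (posr (Suc k)))
          (insert (- ?p (posr (Suc k)), - ?p (posl (Suc k))) (Inv n y)))\<^sup>+"
        by (intro trancl.intros(2)[OF r_into_trancl, of _ "y (int k + 3)"]) auto
    qed (use z in auto)
  next
    case 1
    let ?y' = "y \<circ> gen (Suc k)"
    let ?p' = "?y' \<circ> gen (Suc (Suc k))"
    let ?p = "?p' \<circ> gen (Suc k)"
    have B: "?y' \<in> Bn n" "?p' \<in> Bn n" "?p \<in> Bn n" using y kn k by simp_all
    have pp: "(?p, ?p \<circ> gen (Suc k)) \<in> \<Theta>"
    proof (rule narrowD[OF N B(3) kn, where m = "gen (Suc k) (gen (Suc (Suc k)) (gen (Suc k) m))"])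
      show "gen (Suc k) (gen (Suc (Suc k)) (gen (Suc k) m)) < posl (Suc k) \<and>
            ?p (gen (Suc k) (gen (Suc (Suc k)) (gen (Suc k) m))) \<in> U \<or>
          posr (Suc k) < gen (Suc k) (gen (Suc (Suc k)) (gen (Suc k) m)) \<and>
            ?p (gen (Suc k) (gen (Suc (Suc k)) (gen (Suc k) m))) \<notin> U"
        using m(1) side side' by auto
    qed (use k z 1 m SN kn in \<open>auto simp: gen_SN\<close>)
    show ?thesis
    proof (rule force_down[OF y kn asc B(3) kn _ pp])
      show "Inv n (y \<circ> gen (Suc k)) \<subseteq> Inv n (?p \<circ> gen (Suc k))"
        using Inv_gen_asc[OF B(1) k, unfolded pk] z by auto
      have "(y (int k + 1), y (int k + 3)) \<in> Pairs n - Inv n ?y'"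
        by (rule not_InvI[OF B(1), of "int k + 2" _ "int k + 3"]) (use z SN in auto)
      then show "(y (posl (Suc k)), y (posr (Suc k))) \<in> (insert (?p (posl (Suc k)), ?p (posr (Suc k)))
          (insert (- ?p (posr (Suc k)), - ?p (posl (Suc k))) (Pairs n - Inv n ?y')))\<^sup>+"
        by (intro trancl.intros(2)[OF r_into_trancl, of _ "y (int k + 3)"]) auto
    qed (use z in auto)
  qed
qed

lemma contract_octagon:
  assumes y: "y \<in> Bn n" and n: "1 < n" and s: "y 1 < 0" "0 < y 2"
    and w: "witness n U y (Suc 0) m" "m \<noteq> - 1" "m \<noteq> - 2" and N: "narrow (y 2 - y 1)"
  shows "(y, y \<circ> gen (Suc 0)) \<in> \<Theta>"
proof -
  have n': "0 < n" "Suc 0 < n" using n by auto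
  have SN: "1 \<in> SN n" "2 \<in> SN n" "m \<in> SN n" using n w by (auto simp: SN_iff witness_def)
  note neg = Bn_uminus[OF y]
  have m0: "m \<noteq> 0" using SN(3) by (auto simp: SN_iff)
  have m: "m < - 2 \<and> y m \<in> U \<or> 2 < m \<and> y m \<notin> U" "y 1 < y m" "y m < y 2"
    using w m0 by (auto simp: witness_def)
  have g: "gen 0 m = m" "gen (Suc 0) m = m" using m gen_outer by auto
  have asc: "y (posl (Suc 0)) < y (posr (Suc 0))" using witness_ascent[OF w(1)] .
  have ne: "y m \<noteq> - y 1" "y m \<noteq> - y 2" "y 2 \<noteq> - y 1"
    using w(2,3) by (simp_all add: Bn_eq_uminus_iff[OF y])
  let ?y' = "y \<circ> gen (Suc 0)"
  have y': "?y' \<in> Bn n" using y n' by simp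
  \<comment> \<open>Exactly one of \<open>- y 1\<close> and \<open>- y 2\<close> lies in the range,
    the one of smaller absolute value. It splits the range, and the half containing the witness
    value labels a bottom or top edge of the octagon.\<close>
  consider "- y 1 < y 2" "- y 1 < y m" | "- y 1 < y 2" "y m < - y 1"
    | "y 2 < - y 1" "- y 2 < y m" | "y 2 < - y 1" "y m < - y 2" using ne by linarith
  then show ?thesis
  proof cases
    case 1
    let ?p = "y \<circ> gen 0"
    have p: "?p \<in> Bn n" using y n' by simp
    have pp: "(?p, ?p \<circ> gen (Suc 0)) \<in> \<Theta>"
      by (rule narrowD[OF N p n'(2), where m = m]) (use 1 s m SN g in \<open>auto simp: neg\<close>)
    show ?thesis
    proof (rule force_up[OF y n'(2) asc p n'(2) _ pp])
      show "Inv n ?p \<subseteq> Inv n y" using Inv_gen_desc[OF y n'(1)] s neg by auto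
      have "(y 1, - y 1) \<in> Inv n y" by (rule InvI[OF y, of 1 _ "- 1"]) (use s SN neg in auto)
      then show "(y (posl (Suc 0)), y (posr (Suc 0))) \<in> (insert (?p (posl (Suc 0)), ?p (posr (Suc 0)))
          (insert (- ?p (posr (Suc 0)), - ?p (posl (Suc 0))) (Inv n y)))\<^sup>+"
        by (intro trancl.intros(2)[OF r_into_trancl, of _ "- y 1"]) (auto simp: neg)
    qed (use 1 s in \<open>auto simp: neg\<close>)
  next
    case 2
    let ?p' = "?y' \<circ> gen 0 \<circ> gen (Suc 0)"
    let ?p = "?p' \<circ> gen 0"
    have B: "?y' \<circ> gen 0 \<in> Bn n" "?p \<in> Bn n" using y n' by simp_all
    have pp: "(?p, ?p \<circ> gen 0) \<in> \<Theta>"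
      by (rule narrowD[OF N B(2) n'(1), where m = m]) (use 2 s m SN g in \<open>auto simp: neg\<close>)
    show ?thesis
    proof (rule force_down[OF y n'(2) asc B(2) n'(1) _ pp])
      have "Inv n ?y' \<subseteq> Inv n (?y' \<circ> gen 0)"
        using Inv_gen_asc[OF y' n'(1)] s neg by auto
      moreover have "Inv n (?y' \<circ> gen 0) \<subseteq> Inv n ?p'"
        using Inv_gen_asc[OF B(1) n'(2)] 2 neg by auto
      ultimately show "Inv n ?y' \<subseteq> Inv n (?p \<circ> gen 0)" by simp
      have "(- y 1, y 2) \<in> Pairs n - Inv n ?y'"
        by (rule not_InvI[OF y', of "- 2" _ 1]) (use 2 SN neg in auto)
      then show "(y (posl (Suc 0)), y (posr (Suc 0))) \<in> (insert (?p (posl 0), ?p (posr 0))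
          (insert (- ?p (posr 0), - ?p (posl 0)) (Pairs n - Inv n ?y')))\<^sup>+"
        by (intro trancl.intros(2)[OF r_into_trancl, of _ "- y 1"]) (auto simp: neg)
    qed (use 2 s in \<open>auto simp: neg\<close>)
  next
    case 3
    let ?p = "y \<circ> gen 0 \<circ> gen (Suc 0)"
    have B: "y \<circ> gen 0 \<in> Bn n" "?p \<in> Bn n" using y n' by simp_all
    have pp: "(?p, ?p \<circ> gen 0) \<in> \<Theta>"
      by (rule narrowD[OF N B(2) n'(1), where m = m]) (use 3 s m SN g in \<open>auto simp: neg\<close>)
    show ?thesis
    proof (rule force_up[OF y n'(2) asc B(2) n'(1) _ pp])
      have "Inv n (y \<circ> gen 0) \<subseteq> Inv n y" using Inv_gen_desc[OF y n'(1)] s neg by auto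
      moreover have "Inv n ?p \<subseteq> Inv n (y \<circ> gen 0)"
        using Inv_gen_desc[OF B(1) n'(2)] 3 neg by auto
      ultimately show "Inv n ?p \<subseteq> Inv n y" by simp
      have "(y 1, - y 2) \<in> Inv n y" by (rule InvI[OF y, of 1 _ "- 2"]) (use 3 SN neg in auto)
      then show "(y (posl (Suc 0)), y (posr (Suc 0))) \<in> (insert (?p (posl 0), ?p (posr 0))
          (insert (- ?p (posr 0), - ?p (posl 0)) (Inv n y)))\<^sup>+"
        by (intro trancl.intros(2)[OF r_into_trancl, of _ "- y 2"]) (auto simp: neg)
    qed (use 3 s in \<open>auto simp: neg\<close>)
  next
    case 4
    let ?p' = "?y' \<circ> gen 0"
    let ?p = "?p' \<circ> gen (Suc 0)"
    have B: "?p' \<in> Bn n" "?p \<in> Bn n" using y n' by simp_all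
    have pp: "(?p, ?p \<circ> gen (Suc 0)) \<in> \<Theta>"
      by (rule narrowD[OF N B(2) n'(2), where m = m]) (use 4 s m SN g in \<open>auto simp: neg\<close>)
    show ?thesis
    proof (rule force_down[OF y n'(2) asc B(2) n'(2) _ pp])
      show "Inv n ?y' \<subseteq> Inv n (?p \<circ> gen (Suc 0))"
        using Inv_gen_asc[OF y' n'(1)] s neg by auto
      have "(- y 2, y 2) \<in> Pairs n - Inv n ?y'"
        by (rule not_InvI[OF y', of "- 1" _ 1]) (use s SN neg in auto)
      then show "(y (posl (Suc 0)), y (posr (Suc 0))) \<in> (insert (?p (posl (Suc 0)), ?p (posr (Suc 0)))
          (insert (- ?p (posr (Suc 0)), - ?p (posl (Suc 0))) (Pairs n - Inv n ?y')))\<^sup>+"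
        by (intro trancl.intros(2)[OF r_into_trancl, of _ "- y 2"]) (auto simp: neg)
    qed (use 4 s in \<open>auto simp: neg\<close>)
  qed
qed

lemma contract_center:
  assumes y: "y \<in> Bn n" and n: "1 < n" and z: "\<bar>y 2\<bar> < y 1"
    and w: "witness n U y 0 m" "m \<noteq> 2" "m \<noteq> - 2" and N: "narrow (2 * y 1)"
  shows "(y, y \<circ> gen 0) \<in> \<Theta>"
proof -
  have z': "y 2 < y 1" "- y 1 < y 2" using z by auto
  have n': "0 < n" "Suc 0 < n" using n by auto
  note neg = Bn_uminus[OF y]
  \<comment> \<open>The range from \<open>- y 1\<close> to \<open>y 1\<close> is symmetric, so the
    witness may be mirrored to make its value positive.\<close>
  obtain m where m: "m \<in> SN n" "m < - 2 \<and> y m \<in> U \<or> 2 < m \<and> y m \<notin> U" "0 < y m" "y m < y 1"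
  proof -
    have mS: "m \<in> SN n" "y m \<in> SN n" "m \<noteq> 0" using w(1) Bn_SN[OF y, of m] by (auto simp: witness_def SN_iff)
    have "y m \<noteq> 0" using mS by (auto simp: SN_iff)
    then consider "0 < y m" | "0 < y (- m)" using neg[of m] by linarith
    then show thesis
    proof cases
      case 1
      then show thesis using that[of m] w mS neg by (auto simp: witness_def)
    next
      case 2
      then show thesis using that[of "- m"] w mS neg up_dn_mem[OF U mS(2)] by (auto simp: witness_def)
    qed
  qed
  have SN: "1 \<in> SN n" "2 \<in> SN n" using n by (auto simp: SN_iff)
  have mU: "y m \<notin> U \<longleftrightarrow> - y m \<in> U" using up_dn_mem[OF U] Bn_SN[OF y] m(1) by blast
  have g: "gen 0 m = m" "gen (Suc 0) m = m" "gen 0 (- m) = - m" "gen (Suc 0) (- m) = - m"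
    using m gen_outer by auto
  have asc: "y (posl 0) < y (posr 0)" using z neg by simp
  have ne: "y m \<noteq> - y 2" "y m \<noteq> y 2" "y 2 \<noteq> 0"
    using m(2) Bn_SN[OF y, of 2] SN by (auto simp: Bn_eq_uminus_iff[OF y] Bn_eq_iff[OF y] SN_iff)
  let ?y' = "y \<circ> gen 0"
  have y': "?y' \<in> Bn n" using y n' by simp
  have chain: "(a, d) \<in> R\<^sup>+" if "(a, b) \<in> R" "(b, c) \<in> R" "(c, d) \<in> R" for a b c d :: int and R
    using that by (meson trancl.intros)
  \<comment> \<open>The values \<open>y 2\<close> and \<open>- y 2\<close> cut the range into three
    parts. A witness in the middle uses an edge exchanging these two values; one in an outer part
    uses an edge whose label and mirror label are the two outer parts. Hence chains of three
    steps.\<close>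
  consider "0 < y 2" "y m < y 2" | "0 < y 2" "y 2 < y m"
    | "y 2 < 0" "- y 2 < y m" | "y 2 < 0" "y m < - y 2" using ne by linarith
  then show ?thesis
  proof cases
    case 1
    let ?p = "y \<circ> gen (Suc 0)"
    have p: "?p \<in> Bn n" using y n' by simp
    have pp: "(?p, ?p \<circ> gen 0) \<in> \<Theta>"
      by (rule narrowD[OF N p n'(1), where m = m]) (use 1 z' m SN g in \<open>auto simp: neg\<close>)
    show ?thesis
    proof (rule force_up[OF y n'(1) asc p n'(1) _ pp])
      show "Inv n ?p \<subseteq> Inv n y" using Inv_gen_desc[OF y n'(2)] z' by auto
      have "(y 2, y 1) \<in> Inv n y" by (rule InvI[OF y, of 2 _ 1]) (use z' SN neg in auto)
      moreover have "(- y 1, - y 2) \<in> Inv n y" by (rule InvI[OF y, of "- 1" _ "- 2"]) (use z' SN neg in auto)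
      ultimately show "(y (posl 0), y (posr 0)) \<in> (insert (?p (posl 0), ?p (posr 0))
          (insert (- ?p (posr 0), - ?p (posl 0)) (Inv n y)))\<^sup>+"
        by (intro chain[of _ "- y 2" _ "y 2"]) (auto simp: neg)
    qed (use 1 in \<open>auto simp: neg\<close>)
  next
    case 2
    let ?p' = "?y' \<circ> gen (Suc 0) \<circ> gen 0"
    let ?p = "?p' \<circ> gen (Suc 0)"
    have B: "?y' \<circ> gen (Suc 0) \<in> Bn n" "?p \<in> Bn n" using y n' by simp_all
    have pp: "(?p, ?p \<circ> gen (Suc 0)) \<in> \<Theta>"
      by (rule narrowD[OF N B(2) n'(2), where m = "- m"]) (use 2 z' m SN g mU in \<open>auto simp: neg\<close>)
    show ?thesis
    proof (rule force_down[OF y n'(1) asc B(2) n'(2) _ pp])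
      have "Inv n ?y' \<subseteq> Inv n (?y' \<circ> gen (Suc 0))"
        using Inv_gen_asc[OF y' n'(2)] z' neg by auto
      moreover have "Inv n (?y' \<circ> gen (Suc 0)) \<subseteq> Inv n ?p'"
        using Inv_gen_asc[OF B(1) n'(1)] 2 neg by auto
      ultimately show "Inv n ?y' \<subseteq> Inv n (?p \<circ> gen (Suc 0))" by simp
      have "(- y 2, y 2) \<in> Pairs n - Inv n ?y'"
        by (rule not_InvI[OF y', of "- 2" _ 2]) (use 2 SN neg in auto)
      then show "(y (posl 0), y (posr 0)) \<in> (insert (?p (posl (Suc 0)), ?p (posr (Suc 0)))
          (insert (- ?p (posr (Suc 0)), - ?p (posl (Suc 0))) (Pairs n - Inv n ?y')))\<^sup>+"
        by (intro chain[of _ "- y 2" _ "y 2"]) (auto simp: neg)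
    qed (use z' in \<open>auto simp: neg\<close>)
  next
    case 3
    let ?p = "y \<circ> gen (Suc 0) \<circ> gen 0"
    have B: "y \<circ> gen (Suc 0) \<in> Bn n" "?p \<in> Bn n" using y n' by simp_all
    have pp: "(?p, ?p \<circ> gen (Suc 0)) \<in> \<Theta>"
      by (rule narrowD[OF N B(2) n'(2), where m = m]) (use 3 z' m SN g in \<open>auto simp: neg\<close>)
    show ?thesis
    proof (rule force_up[OF y n'(1) asc B(2) n'(2) _ pp])
      have "Inv n (y \<circ> gen (Suc 0)) \<subseteq> Inv n y" using Inv_gen_desc[OF y n'(2)] z' neg by auto
      moreover have "Inv n ?p \<subseteq> Inv n (y \<circ> gen (Suc 0))"
        using Inv_gen_desc[OF B(1) n'(1)] 3 neg by auto
      ultimately show "Inv n ?p \<subseteq> Inv n y" by simp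
      have "(y 2, - y 2) \<in> Inv n y" by (rule InvI[OF y, of 2 _ "- 2"]) (use 3 SN neg in auto)
      then show "(y (posl 0), y (posr 0)) \<in> (insert (?p (posl (Suc 0)), ?p (posr (Suc 0)))
          (insert (- ?p (posr (Suc 0)), - ?p (posl (Suc 0))) (Inv n y)))\<^sup>+"
        by (intro chain[of _ "y 2" _ "- y 2"]) (auto simp: neg)
    qed (use z' in \<open>auto simp: neg\<close>)
  next
    case 4
    let ?p' = "?y' \<circ> gen (Suc 0)"
    let ?p = "?p' \<circ> gen 0"
    have B: "?p' \<in> Bn n" "?p \<in> Bn n" using y n' by simp_all
    have pp: "(?p, ?p \<circ> gen 0) \<in> \<Theta>"
      by (rule narrowD[OF N B(2) n'(1), where m = m]) (use 4 z' m SN g in \<open>auto simp: neg\<close>)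
    show ?thesis
    proof (rule force_down[OF y n'(1) asc B(2) n'(1) _ pp])
      show "Inv n ?y' \<subseteq> Inv n (?p \<circ> gen 0)"
        using Inv_gen_asc[OF y' n'(2)] z' neg by auto
      have "(- y 2, y 1) \<in> Pairs n - Inv n ?y'"
        by (rule not_InvI[OF y', of "- 2" _ "- 1"]) (use z' SN neg in auto)
      moreover have "(- y 1, y 2) \<in> Pairs n - Inv n ?y'"
        by (rule not_InvI[OF y', of 1 _ 2]) (use z' SN neg in auto)
      ultimately show "(y (posl 0), y (posr 0)) \<in> (insert (?p (posl 0), ?p (posr 0))
          (insert (- ?p (posr 0), - ?p (posl 0)) (Pairs n - Inv n ?y')))\<^sup>+"
        by (intro chain[of _ "y 2" _ "- y 2"]) (auto simp: neg)
    qed (use 4 in \<open>auto simp: neg\<close>)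
  qed
qed

end

section \<open>Reduction of witnessed covers to the generating relations\<close>

lemma pos_ge1: "1 \<le> k \<Longrightarrow> posl k = int k" "posr k = int k + 1"
  by (auto simp: posl_def posr_def)

lemma pos_Suc2: "posl (Suc (Suc k)) = int k + 2" "posr (Suc (Suc k)) = int k + 3"
  by auto

lemma gen_fix:
  "1 \<le> l \<Longrightarrow> l \<noteq> j \<Longrightarrow> l \<noteq> Suc j \<Longrightarrow> gen j (int l) = int l"
  "1 \<le> l \<Longrightarrow> l \<noteq> j \<Longrightarrow> Suc l \<noteq> j \<Longrightarrow> gen j (int l + 1) = int l + 1"
  by (auto simp: gen_def)

lemma window_id:
  assumes "x \<in> Bn n" "0 < n \<Longrightarrow> 0 < x 1" "\<And>l. 1 \<le> l \<Longrightarrow> l < n \<Longrightarrow> x (int l) < x (int l + 1)"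
  shows "x = id"
proof (rule no_descent_id[OF assms(1)])
  fix j assume j: "j < n"
  show "x (posl j) < x (posr j)"
  proof (cases j)
    case 0
    then show ?thesis using assms(2) j Bn_uminus[OF assms(1)] by simp
  next
    case (Suc k)
    then show ?thesis using assms(3)[of j] j by (simp add: pos_ge1 del: pos_Suc)
  qed
qed

lemma comp_gen_id: "x \<circ> gen j = id \<Longrightarrow> x = gen j"
  using gen_comp_gen(2)[of x j] by auto

context cambrian begin

lemma generator_up:
  assumes "1 \<le> k" "Suc k < n" "int k + 1 \<in> U" shows "(gen k, gen k \<circ> gen (Suc k)) \<in> \<Theta>"
proof -
  have "(Suc k, k) \<in> orient n U" using assms by (force simp: orient_def add.commute)
  then show ?thesis
    using gens assms(1) by (fastforce simp: coxm_def numeral_2_eq_2 word_prod_def)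
qed

lemma generator_down:
  assumes "1 \<le> k" "Suc k < n" "int k + 1 \<notin> U" shows "(gen (Suc k), gen (Suc k) \<circ> gen k) \<in> \<Theta>"
proof -
  have "(k, Suc k) \<in> orient n U" using assms by (force simp: orient_def add.commute)
  then show ?thesis
    using gens assms(1) by (fastforce simp: coxm_def numeral_2_eq_2 word_prod_def)
qed

text \<open>For label 4 the relation identifies the ends of a chain of two covers; convexity
  contracts each of them.\<close>

lemma generator_0_up:
  assumes n: "1 < n" and "1 \<in> U"
  shows "(gen 0, gen 0 \<circ> gen (Suc 0)) \<in> \<Theta>" "(gen 0 \<circ> gen (Suc 0), gen 0 \<circ> gen (Suc 0) \<circ> gen 0) \<in> \<Theta>"
proof -
  have "(Suc 0, 0) \<in> orient n U" using assms by (force simp: orient_def)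
  then have *: "(gen 0, gen 0 \<circ> gen (Suc 0) \<circ> gen 0) \<in> \<Theta>"
    using gens by (fastforce simp: coxm_def numeral_3_eq_3 word_prod_def o_assoc)
  have B: "gen 0 \<in> Bn n" "gen 0 \<circ> gen (Suc 0) \<in> Bn n" using n gen_Bn Bn_comp_gen by auto
  have "Inv n (gen 0) \<subseteq> Inv n (gen 0 \<circ> gen (Suc 0))"
    using Inv_gen_asc[OF B(1), of "Suc 0"] n by auto
  moreover have "Inv n (gen 0 \<circ> gen (Suc 0)) \<subseteq> Inv n (gen 0 \<circ> gen (Suc 0) \<circ> gen 0)"
    using Inv_gen_asc[OF B(2), of 0] n by auto
  ultimately show "(gen 0, gen 0 \<circ> gen (Suc 0)) \<in> \<Theta>"
    "(gen 0 \<circ> gen (Suc 0), gen 0 \<circ> gen (Suc 0) \<circ> gen 0) \<in> \<Theta>"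
    using convex[OF * B(2)] by auto
qed

lemma generator_0_down:
  assumes n: "1 < n" and "1 \<notin> U"
  shows "(gen (Suc 0), gen (Suc 0) \<circ> gen 0) \<in> \<Theta>"
    "(gen (Suc 0) \<circ> gen 0, gen (Suc 0) \<circ> gen 0 \<circ> gen (Suc 0)) \<in> \<Theta>"
proof -
  have "(0, Suc 0) \<in> orient n U" using assms by (force simp: orient_def)
  then have *: "(gen (Suc 0), gen (Suc 0) \<circ> gen 0 \<circ> gen (Suc 0)) \<in> \<Theta>"
    using gens by (fastforce simp: coxm_def numeral_3_eq_3 word_prod_def o_assoc)
  have B: "gen (Suc 0) \<in> Bn n" "gen (Suc 0) \<circ> gen 0 \<in> Bn n" using n gen_Bn Bn_comp_gen by auto
  have "Inv n (gen (Suc 0)) \<subseteq> Inv n (gen (Suc 0) \<circ> gen 0)"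
    using Inv_gen_asc[OF B(1), of 0] n by auto
  moreover have "Inv n (gen (Suc 0) \<circ> gen 0) \<subseteq> Inv n (gen (Suc 0) \<circ> gen 0 \<circ> gen (Suc 0))"
    using Inv_gen_asc[OF B(2), of "Suc 0"] n by auto
  ultimately show "(gen (Suc 0), gen (Suc 0) \<circ> gen 0) \<in> \<Theta>"
    "(gen (Suc 0) \<circ> gen 0, gen (Suc 0) \<circ> gen 0 \<circ> gen (Suc 0)) \<in> \<Theta>"
    using convex[OF * B(2)] by auto
qed

definition smaller :: "(int \<Rightarrow> int) \<Rightarrow> int \<Rightarrow> bool" where
  "smaller y w \<longleftrightarrow> (\<forall>p j m. p \<in> Bn n \<longrightarrow> j < n \<longrightarrow> witness n U p j m \<longrightarrow> p (posr j) - p (posl j) = w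
     \<longrightarrow> Inv n p \<subset> Inv n y \<longrightarrow> (p, p \<circ> gen j) \<in> \<Theta>)"

lemma slide_smaller:
  assumes y: "y \<in> Bn n" "i < n" "witness n U y i m" and sm: "smaller y (y (posr i) - y (posl i))"
    and p: "p \<in> Bn n" "j < n" "witness n U p j m'" and le: "Inv n p \<subset> Inv n y"
    and lab: "p (posl j) = y (posl i) \<and> p (posr j) = y (posr i) \<or>
      p (posl j) = - y (posr i) \<and> p (posr j) = - y (posl i)"
  shows "(y, y \<circ> gen i) \<in> \<Theta>"
proof (rule slide_up[OF y(1,2) witness_ascent[OF y(3)] p(1,2) _ _ lab])
  have "p (posr j) - p (posl j) = y (posr i) - y (posl i)" using lab by auto
  then show "(p, p \<circ> gen j) \<in> \<Theta>" using sm p le unfolding smaller_def by blast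
  show "Inv n p \<subseteq> Inv n y" using le by blast
qed

text \<open>A descent at a generator commuting with \<open>gen i\<close> could be undone without
  touching the exchanged entries or losing the witness, so the inner induction would contract the
  cover.\<close>

lemma far_ascent:
  assumes y: "y \<in> Bn n" "i < n" "witness n U y i m" and sm: "smaller y (y (posr i) - y (posl i))"
    and j: "j < n" "j \<noteq> i" "j \<noteq> Suc i" "Suc j \<noteq> i" and nT: "(y, y \<circ> gen i) \<notin> \<Theta>"
  shows "y (posl j) < y (posr j)"
proof (rule ccontr)
  assume "\<not> y (posl j) < y (posr j)"
  then have desc: "y (posr j) < y (posl j)" using Bn_pos_neq[OF y(1), of j] by linarith
  let ?p = "y \<circ> gen j"
  have m: "m \<noteq> 0" "m \<in> SN n" using y(3) by (auto simp: witness_def SN_iff)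
  have "witness n U ?p i (gen j m)"
    using y(3) gen_far[OF j(2-4)] m gen_SN[OF j(1)] by (auto simp: witness_def)
  then have "(y, y \<circ> gen i) \<in> \<Theta>"
    using slide_smaller[OF y sm, of ?p i] y j Inv_gen_desc[OF y(1) j(1) desc] gen_far[OF j(2-4)] by simp
  then show False using nT by blast
qed

text \<open>Descents away from the exchanged entries, and entries outside their range, are removed by moving
  down in the weak order with the label of the cover unchanged; if no entry besides the witness
  lies inside the range, the cover belongs to one of the generating relations.\<close>

lemma contract_pos:
  assumes y: "y \<in> Bn n" and k: "Suc k < n" and w: "witness n U y (Suc k) m"
    and N: "narrow (y (int k + 2) - y (int k + 1))" and sm: "smaller y (y (int k + 2) - y (int k + 1))"
  shows "(y, y \<circ> gen (Suc k)) \<in> \<Theta>"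
proof (rule ccontr)
  assume nT: "(y, y \<circ> gen (Suc k)) \<notin> \<Theta>"
  define a c where "a = y (int k + 1)" and "c = y (int k + 2)"
  have kn: "k < n" using k by simp
  have sm': "smaller y (y (posr (Suc k)) - y (posl (Suc k)))" using sm by simp
  note neg = Bn_uminus[OF y]
  note slide = slide_smaller[OF y k w sm']
  have asc: "a < y m" "y m < c" "m < int k + 1 \<and> y m \<in> U \<or> int k + 2 < m \<and> y m \<notin> U" and mS: "m \<in> SN n"
    using w by (auto simp: witness_def a_def c_def)
  have m0: "m \<noteq> 0" using mS by (auto simp: SN_iff)
  have ysc: "y (posl (Suc k)) < y (posr (Suc k))" using witness_ascent[OF w] .
  have far: "y (int l) < y (int l + 1)" if "1 \<le> l" "l < n" "l \<noteq> k" "l \<noteq> Suc k" "l \<noteq> Suc (Suc k)" for l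
    using far_ascent[OF y k w sm', of l] that nT by (simp add: pos_ge1 del: pos_Suc)
  have far0: "0 < y 1" if "1 \<le> k"
    using far_ascent[OF y k w sm', of 0] that nT k neg[of 1] by simp
  \<comment> \<open>Otherwise moving the entry at \<open>k + 3\<close> to the left of
    \<open>a\<close> and \<open>c\<close> gives a smaller element with a cover exchanging the same
    entries.\<close>
  have R: "a < y (int k + 3)" if k3: "Suc (Suc k) < n"
  proof (rule ccontr)
    assume "\<not> ?thesis"
    moreover have "y (int k + 3) \<noteq> a" unfolding a_def by (simp add: Bn_eq_iff[OF y])
    ultimately have z: "y (int k + 3) < a" by simp
    let ?q = "y \<circ> gen (Suc (Suc k))"
    let ?p = "?q \<circ> gen (Suc k)"
    have B: "?q \<in> Bn n" "?p \<in> Bn n" using y k k3 by simp_all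
    have "Inv n ?q \<subset> Inv n y"
      using Inv_gen_desc[OF y k3, unfolded pos_Suc2] z asc unfolding a_def c_def by auto
    moreover have "Inv n ?p \<subset> Inv n ?q"
      using Inv_gen_desc[OF B(1) k] z asc unfolding a_def c_def by auto
    ultimately have le: "Inv n ?p \<subset> Inv n y" by blast
    have m': "m < int k + 1 \<and> y m \<in> U \<or> int k + 3 < m \<and> y m \<notin> U"
    proof -
      have "m \<noteq> int k + 3" using z asc by auto
      then show ?thesis using asc by auto
    qed
    have g: "gen (Suc k) (gen (Suc (Suc k)) m) < int k + 2 \<and> y m \<in> U \<or>
        int k + 3 < gen (Suc k) (gen (Suc (Suc k)) m) \<and> y m \<notin> U"
      using m'
    proof
      assume "m < int k + 1 \<and> y m \<in> U"
      then have "gen (Suc (Suc k)) m < int k + 1" "y m \<in> U" using gen_left[of "Suc k" m "Suc (Suc k)"] by auto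
      then show ?thesis using gen_left[of "Suc k" "gen (Suc (Suc k)) m" "Suc k"] by simp
    next
      assume "int k + 3 < m \<and> y m \<notin> U"
      then show ?thesis using gen_right[of "Suc k" m "Suc (Suc k)"] gen_right[of "Suc k" m "Suc k"] by simp
    qed
    have "witness n U ?p (Suc (Suc k)) (gen (Suc k) (gen (Suc (Suc k)) m))"
      unfolding witness_def pos_Suc2 using g asc mS k k3 by (simp add: gen_SN a_def c_def)
    then show False using slide[OF B(2) k3 _ le, unfolded pos_Suc2] nT by simp
  qed
  \<comment> \<open>An adjacent entry inside the range must be the witness, since otherwise
    \<open>contract_right\<close> applies.\<close>
  have RR: "y m = y (int k + 3)" if "Suc (Suc k) < n" "y (int k + 3) < c"
    using contract_right[OF y that(1) _ _ w _ N] R that nT unfolding a_def c_def by blast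
  have L: "y (int k) < c" if k1: "1 \<le> k"
  proof (rule ccontr)
    assume "\<not> ?thesis"
    moreover have "y (int k) \<noteq> c" unfolding c_def by (simp add: Bn_eq_iff[OF y])
    ultimately have z: "c < y (int k)" by simp
    let ?q = "y \<circ> gen k"
    let ?p = "?q \<circ> gen (Suc k)"
    have B: "?q \<in> Bn n" "?p \<in> Bn n" using y k kn by simp_all
    have "Inv n ?q \<subset> Inv n y"
      using Inv_gen_desc[OF y kn] z asc k1 unfolding a_def c_def by (auto simp: pos_ge1)
    moreover have "Inv n ?p \<subset> Inv n ?q"
      using Inv_gen_desc[OF B(1) k] z k1 unfolding a_def c_def by auto
    ultimately have le: "Inv n ?p \<subset> Inv n y" by blast
    have m': "m < int k \<and> y m \<in> U \<or> int k + 2 < m \<and> y m \<notin> U"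
    proof -
      have "m \<noteq> int k" using z asc by auto
      then show ?thesis using asc by auto
    qed
    have g: "gen (Suc k) (gen k m) < int k \<and> y m \<in> U \<or>
        int k + 1 < gen (Suc k) (gen k m) \<and> y m \<notin> U"
      using m'
    proof
      assume "m < int k \<and> y m \<in> U"
      then have "gen k m < int k" "y m \<in> U" using gen_left[of k m k] k1 by auto
      then show ?thesis using gen_left[of k "gen k m" "Suc k"] k1 by simp
    next
      assume "int k + 2 < m \<and> y m \<notin> U"
      then show ?thesis using gen_right[of k m k] gen_right[of k m "Suc k"] by simp
    qed
    have "witness n U ?p k (gen (Suc k) (gen k m))"
      unfolding witness_def using g asc mS k kn k1 by (simp add: gen_SN a_def c_def pos_ge1)
    then show False using slide[OF B(2) kn _ le] nT k1 by (simp add: pos_ge1[of k])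
  qed
  have LL: "y m = y (int k)" if "1 \<le> k" "a < y (int k)"
    using contract_left[OF y that(1) k _ _ w _ N] L that nT unfolding a_def c_def by blast
  have P: "0 < y (int l) \<and> y (int l) \<le> y (int k)" if "1 \<le> l" "l \<le> k" for l
  proof
    have k1: "1 \<le> k" using that by simp
    show "0 < y (int l)" using that
    proof (induction l rule: dec_induct)
      case base then show ?case using far0[OF k1] by simp
    next
      case (step l)
      then show ?case using far[of l] k by (simp add: add.commute)
    qed
    show "y (int l) \<le> y (int k)" using that(2,1)
    proof (induction l rule: inc_induct)
      case (step l)
      then show ?case using far[of l] k by (simp add: add.commute)
    qed simp
  qed
  have Q: "y (int k + 3) \<le> y (int l)" if "k + 3 \<le> l" "l \<le> n" for l
    using that
  proof (induction l rule: dec_induct)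
    case base then show ?case by simp
  next
    case (step l)
    then show ?case using far[of l] by (simp add: add.commute)
  qed
  \<comment> \<open>If both entries are negative, moving them across the centre gives a smaller
    element with the mirror label \<open>(- c, - a)\<close>.\<close>
  have cpos: "0 < c" if k0: "k = 0"
  proof (rule ccontr)
    assume "\<not> ?thesis"
    moreover have "c \<noteq> 0" using Bn_SN[OF y, of "int k + 2"] k unfolding c_def by (auto simp: SN_iff)
    ultimately have c: "c < 0" "a < 0" using asc by auto
    let ?q = "y \<circ> gen 0"
    let ?r = "?q \<circ> gen (Suc 0)"
    let ?p = "?r \<circ> gen 0"
    have n': "0 < n" "Suc 0 < n" using k by auto
    have B: "?q \<in> Bn n" "?r \<in> Bn n" "?p \<in> Bn n" using y n' by simp_all
    have "Inv n ?q \<subset> Inv n y"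
      using Inv_gen_desc[OF y n'(1)] c neg k0 unfolding a_def c_def by auto
    moreover have "Inv n ?r \<subset> Inv n ?q"
      using Inv_gen_desc[OF B(1) n'(2)] c neg k0 unfolding a_def c_def by auto
    moreover have "Inv n ?p \<subset> Inv n ?r"
      using Inv_gen_desc[OF B(2) n'(1)] c neg k0 unfolding a_def c_def by auto
    ultimately have le: "Inv n ?p \<subset> Inv n y" by blast
    have "m \<noteq> - 1" "m \<noteq> - 2" using c asc neg k0 unfolding a_def c_def by auto
    then have m': "m < - 2 \<and> y m \<in> U \<or> 2 < m \<and> y m \<notin> U" using asc k0 m0 by auto
    have g: "gen 0 (- m) = - m" "gen (Suc 0) (- m) = - m" using m' gen_outer[of "- m"] by auto
    have "y m \<notin> U \<longleftrightarrow> - y m \<in> U" using up_dn_mem[OF U] Bn_SN[OF y] mS by blast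
    then have "witness n U ?p (Suc 0) (- m)"
      using g m' asc mS k0 neg by (auto simp: witness_def a_def c_def)
    then show False using slide[OF B(3) n'(2) _ le] nT k0 neg by simp
  qed
  show False
  proof (cases "1 \<le> k \<and> a < y (int k)")
    case True
    then have k1: "1 \<le> k" and z: "a < y (int k)" by auto
    have zm: "y m = y (int k)" using LL k1 z by blast
    then have "m = int k" using Bn_eq_iff[OF y] by blast
    then have zU: "y (int k) \<in> U" using asc by auto
    have zpos: "0 < y (int k)" using P[of k] k1 by simp
    \<comment> \<open>Otherwise two entries lie inside the range. Exchanging them puts the witness
      further away and a different entry next to \<open>a\<close>, so \<open>contract_left\<close>
      applies to the larger element.\<close>
    have left: "y (int l) < a" if kl: "k = Suc l" "1 \<le> l" for l
    proof (rule ccontr)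
      assume "\<not> ?thesis"
      moreover have "y (int l) \<noteq> a" unfolding a_def using kl by (simp add: Bn_eq_iff[OF y])
      ultimately have l: "a < y (int l)" by simp
      let ?p = "y \<circ> gen l"
      have ln: "l < n" using kl kn by simp
      have p: "?p \<in> Bn n" using y ln by simp
      have lz: "y (int l) < y (int k)" using far[of l] kl ln by (simp add: add.commute)
      have pl: "posl l = int l" "posr l = int k" using kl by (auto simp: posl_def posr_def)
      have e: "?p (int k) = y (int l)" "?p (int l) = y (int k)"
        using gen_pos[of l] unfolding pl by auto
      have e': "?p (int k + 1) = a" "?p (int k + 2) = c" "gen l (int k + 1) = int k + 1" "gen l (int k + 2) = int k + 2"
        using kl by (auto simp: a_def c_def gen_def)
      have "(?p, ?p \<circ> gen (Suc k)) \<in> \<Theta>"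
      proof (rule contract_left[OF p k1 k])
        show "witness n U ?p (Suc k) (int l)"
          using e e' z L[OF k1] zU kl ln by (auto simp: witness_def SN_iff)
      qed (use N e e' l lz L[OF k1] in \<open>auto simp: a_def c_def\<close>)
      then have "(y, y \<circ> gen (Suc k)) \<in> \<Theta>"
      proof (rule slide_down[OF y k ysc p k])
        show "Inv n y \<subseteq> Inv n ?p" using Inv_gen_asc[OF y ln, unfolded pl] lz by blast
      qed (use e' in \<open>auto simp: a_def c_def\<close>)
      then show False using nT by blast
    qed
    have apos: "0 < a"
    proof (cases "k = 1")
      case False
      then obtain l where l: "k = Suc l" "1 \<le> l" using k1 by (cases k) auto
      then show ?thesis using left[OF l] P[of l] by simp
    next
      \<comment> \<open>A negative \<open>a\<close> is excluded through the mirror entry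
        \<open>- y 1\<close>. Inside the range it is a second entry for
        \<open>contract_left\<close>; below \<open>a\<close> it is moved out to position 3, and the
        witness, now at \<open>- 3\<close>, allows \<open>contract_octagon\<close>.\<close>
      case k1': True
      show ?thesis
      proof (rule ccontr)
        assume "\<not> 0 < a"
        moreover have "a \<noteq> 0" using Bn_SN[OF y, of "int k + 1"] k unfolding a_def by (auto simp: SN_iff)
        ultimately have a0: "a < 0" by simp
        have n': "0 < n" "Suc 0 < n" "Suc (Suc 0) < n" using k k1' by auto
        have ya: "y 2 = a" "y 3 = c" "y (- 1) = - y 1"
          using k1' neg[of 1] unfolding a_def c_def by auto
        have zc: "a < y 1" "y 1 < c" "0 < y 1" "y 1 \<in> U"
          using z L[OF k1] zpos zU k1' by auto
        have N': "narrow (c - a)" using N by (simp add: a_def c_def)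
        let ?p = "y \<circ> gen 0"
        have p: "?p \<in> Bn n" using y n' by simp
        have up: "Inv n y \<subseteq> Inv n ?p" using Inv_gen_asc[OF y n'(1)] zc(3) ya by auto
        have ne: "- y 1 \<noteq> y 2" using Bn_eq_uminus_iff[OF y, of 2 1] by auto
        have z1: "- y 1 < y 1" using zc(3) by simp
        have "(y, y \<circ> gen (Suc k)) \<in> \<Theta>"
        proof (cases "a < - y 1")
          case True
          have "(?p, ?p \<circ> gen (Suc k)) \<in> \<Theta>"
          proof (rule contract_left[OF p k1 k])
            show "witness n U ?p (Suc k) (- 1)"
              using ya zc k1' n' by (auto simp: witness_def SN_iff)
          qed (use N' ya True zc k1' in auto)
          then show ?thesis
            by (rule slide_down[OF y k ysc p k]) (use up ya k1' in auto)
        next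
          case False
          then have b: "- y 1 < a" using ne ya by simp
          let ?q = "?p \<circ> gen (Suc 0)"
          let ?r = "?q \<circ> gen (Suc (Suc 0))"
          have B: "?q \<in> Bn n" "?r \<in> Bn n" using y n' by simp_all
          have "Inv n ?p \<subseteq> Inv n ?q" using Inv_gen_asc[OF p n'(2)] b ya by auto
          moreover have "Inv n ?q \<subseteq> Inv n ?r"
            using Inv_gen_asc[OF B(1) n'(3)] z1 zc ya by auto
          ultimately have up': "Inv n y \<subseteq> Inv n ?r" using up by blast
          have "?r (- 3) = - ?r 3" using Bn_uminus[OF B(2)] .
          then have v: "?r 1 = a" "?r 2 = c" "?r (- 3) = y 1" using ya by simp_all
          have "(?r, ?r \<circ> gen (Suc 0)) \<in> \<Theta>"
          proof (rule contract_octagon[OF B(2)])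
            show "witness n U ?r (Suc 0) (- 3)"
              unfolding witness_def v using zc n' v(1,2) by (simp add: SN_iff)
            show "narrow (?r 2 - ?r 1)" unfolding v by (rule N')
            show "?r 1 < 0" "0 < ?r 2" unfolding v using a0 zc by auto
          qed (use n' in auto)
          then show ?thesis
            by (rule slide_down[OF y k ysc B(2) n'(2)]) (use up' v ya k1' in simp_all)
        qed
        then show False using nT by blast
      qed
    qed
    have right: "c < y (int k + 3)" if "Suc (Suc k) < n"
    proof (rule ccontr)
      assume "\<not> ?thesis"
      moreover have "y (int k + 3) \<noteq> c" unfolding c_def by (simp add: Bn_eq_iff[OF y])
      ultimately have "y m = y (int k + 3)" using RR that by simp
      then show False using zm by (simp add: Bn_eq_iff[OF y])
    qed
    have "y \<circ> gen k = id"
    proof (rule window_id)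
      show "0 < (y \<circ> gen k) 1"
      proof (cases "k = 1")
        case True
        then show ?thesis using apos by (simp add: a_def)
      next
        case False
        then have "gen k 1 = 1" using k1 by (simp add: gen_def)
        then show ?thesis using far0[OF k1] by simp
      qed
      fix l assume l: "1 \<le> l" "l < n"
      consider "k = Suc l" | "l = k" | "l = Suc k" | "l = Suc (Suc k)" | "l \<noteq> k" "l \<noteq> Suc k" "l \<noteq> Suc (Suc k)" "k \<noteq> Suc l"
        by blast
      then show "(y \<circ> gen k) (int l) < (y \<circ> gen k) (int l + 1)"
      proof cases
        case 1
        then have "gen k (int l) = int l" "gen k (int l + 1) = int k + 1" using l k1 by (auto simp: gen_def)
        then show ?thesis using left[OF 1 l(1)] by (simp add: a_def)
      next
        case 2
        then show ?thesis using k1 z by (simp add: a_def)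
      next
        case 3
        then have e: "int l = int k + 1" "int l + 1 = int k + 2" by auto
        show ?thesis unfolding e(2) unfolding e(1) using k1 L by (simp add: c_def)
      next
        case 4
        then have e: "int l = int k + 2" "int l + 1 = int k + 3" by auto
        show ?thesis unfolding e(2) unfolding e(1) using k1 right 4 l by (simp add: c_def)
      next
        case 5
        then show ?thesis using far[of l] l gen_fix[of l k] by simp
      qed
    qed (use y kn in simp)
    then have yk: "y = gen k" by (rule comp_gen_id)
    then have "int k + 1 \<in> U" using zU k1 by simp
    then show False using generator_up[OF k1 k] nT yk by blast
  next
    case False
    have left: "y (int k) < a" if "1 \<le> k"
    proof -
      have "y (int k) \<noteq> a" unfolding a_def by (simp add: Bn_eq_iff[OF y])
      then show ?thesis using False that by simp
    qed
    show False
    proof (cases "0 < a")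
      case True
      have pos: "0 < y (int l)" if l: "1 \<le> l" "l \<le> n" for l
      proof -
        consider "l \<le> k" | "l = Suc k" | "l = Suc (Suc k)" | "k + 3 \<le> l" by linarith
        then show ?thesis
        proof cases
          case 1 then show ?thesis using P l by blast
        next
          case 2
          then have "int l = int k + 1" by simp
          then show ?thesis using True by (simp add: a_def)
        next
          case 3
          then have "int l = int k + 2" by simp
          then show ?thesis using True asc by (simp add: c_def)
        next
          case 4
          then show ?thesis using Q[OF 4 l(2)] R l True by simp
        qed
      qed
      \<comment> \<open>Entries at positive positions are positive, so those at negative positions
        are below \<open>a\<close>; those at positions 1 to \<open>k\<close> are at most
        \<open>y k < a\<close>. The witness is therefore on the right.\<close>
      have mr: "int k + 2 < m" "y m \<notin> U"
      proof -
        have "\<not> m < int k + 1"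
        proof
          assume m: "m < int k + 1"
          show False
          proof (cases "0 < m")
            case True
            then have "y m \<le> y (int k)" using P[of "nat m"] m by simp
            moreover have "1 \<le> k" using True m by simp
            ultimately show False using left asc by simp
          next
            case mneg: False
            then have "0 < y (- m)" using pos[of "nat (- m)"] m0 mS by (simp add: SN_iff)
            then show False using neg[of m] asc True by simp
          qed
        qed
        then show "int k + 2 < m" "y m \<notin> U" using asc by auto
      qed
      have k3: "Suc (Suc k) < n" using mr mS by (simp add: SN_iff)
      have "y (int k + 3) \<le> y m" using Q[of "nat m"] mr mS by (simp add: SN_iff)
      then have zc: "y (int k + 3) < c" using asc by simp
      then have zm: "y m = y (int k + 3)" using RR k3 by blast
      then have "m = int k + 3" using Bn_eq_iff[OF y] by blast
      then have zU: "y (int k + 3) \<notin> U" using mr by simp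
      have right: "c < y (int k + 4)" if k4: "Suc (Suc (Suc k)) < n"
      proof (rule ccontr)
        assume "\<not> ?thesis"
        moreover have "y (int k + 4) \<noteq> c" unfolding c_def by (simp add: Bn_eq_iff[OF y])
        ultimately have l: "y (int k + 4) < c" by simp
        let ?j = "Suc (Suc (Suc k))"
        have pj: "posl ?j = int k + 3" "posr ?j = int k + 4" by auto
        have e3: "int ?j = int k + 3" "int ?j + 1 = int k + 4" by auto
        let ?p = "y \<circ> gen ?j"
        have p: "?p \<in> Bn n" using y k4 by simp
        have lz: "y (int k + 3) < y (int k + 4)"
        proof -
          have "y (int ?j) < y (int ?j + 1)" by (rule far) (use k4 in auto)
          then show ?thesis unfolding e3(2) unfolding e3(1) .
        qed
        have g: "gen ?j (int k + 3) = int k + 4" "gen ?j (int k + 4) = int k + 3"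
          using gen_pos[of ?j] unfolding pj by auto
        have g': "gen ?j (int k + 1) = int k + 1" "gen ?j (int k + 2) = int k + 2" by (auto simp: gen_def)
        have "(?p, ?p \<circ> gen (Suc k)) \<in> \<Theta>"
        proof (rule contract_right[OF p k3])
          show "witness n U ?p (Suc k) (int k + 4)"
            using g g' R[OF k3] zc zU k4 by (auto simp: witness_def SN_iff a_def c_def)
        qed (use N g g' l lz R[OF k3] in \<open>auto simp: a_def c_def\<close>)
        then have "(y, y \<circ> gen (Suc k)) \<in> \<Theta>"
        proof (rule slide_down[OF y k ysc p k])
          show "Inv n y \<subseteq> Inv n ?p" using Inv_gen_asc[OF y k4, unfolded pj] lz by blast
        qed (use g' in auto)
        then show False using nT by blast
      qed
      have "y \<circ> gen (Suc (Suc k)) = id"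
      proof (rule window_id)
        have "gen (Suc (Suc k)) 1 = 1" by (simp add: gen_def)
        then show "0 < (y \<circ> gen (Suc (Suc k))) 1" using pos[of 1] k by simp
        fix l assume l: "1 \<le> l" "l < n"
        consider "l = k" | "l = Suc k" | "l = Suc (Suc k)" | "l = Suc (Suc (Suc k))"
          | "l \<noteq> k" "l \<noteq> Suc k" "l \<noteq> Suc (Suc k)" "l \<noteq> Suc (Suc (Suc k))"
          by blast
        then show "(y \<circ> gen (Suc (Suc k))) (int l) < (y \<circ> gen (Suc (Suc k))) (int l + 1)"
        proof cases
          case 1
          then show ?thesis using left l by (simp add: a_def)
        next
          case 2
          then have e: "int l = int k + 1" "int l + 1 = int k + 2" by auto
          show ?thesis unfolding e(2) unfolding e(1) using R[OF k3] by (simp add: a_def)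
        next
          case 3
          then have e: "int l = int k + 2" "int l + 1 = int k + 3" by auto
          show ?thesis unfolding e(2) unfolding e(1) using zc by (simp add: c_def)
        next
          case 4
          then have e: "int l = int k + 3" "int l + 1 = int k + 4" by auto
          have "gen (Suc (Suc k)) (int k + 4) = int k + 4" by (simp add: gen_def)
          then show ?thesis unfolding e(2) unfolding e(1) using right 4 l by (simp add: c_def)
        next
          case 5
          then show ?thesis using far[of l] l gen_fix[of l "Suc (Suc k)"] by simp
        qed
      qed (use y k3 in simp)
      then have yk: "y = gen (Suc (Suc k))" by (rule comp_gen_id)
      then have "int (Suc k) + 1 \<notin> U" using zU by (simp add: add.commute)
      then show False using generator_down[of "Suc k"] k3 nT yk by simp
    next
      case False
      have a0: "a < 0"
      proof -
        have "a \<noteq> 0" using Bn_SN[OF y, of "int k + 1"] k unfolding a_def by (auto simp: SN_iff)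
        then show ?thesis using False by simp
      qed
      have k0: "k = 0"
      proof (rule ccontr)
        assume "k \<noteq> 0"
        then show False using left P[of k] a0 by simp
      qed
      have n': "0 < n" "Suc 0 < n" "1 < n" using k k0 by auto
      have c0: "0 < c" using cpos k0 by blast
      have ya: "y 1 = a" "y 2 = c" "y (- 1) = - a" "y (- 2) = - c"
        using k0 neg unfolding a_def c_def by auto
      have w0: "witness n U y (Suc 0) m" "narrow (y 2 - y 1)" "(y, y \<circ> gen (Suc 0)) \<notin> \<Theta>"
        using w N nT k0 by simp_all
      \<comment> \<open>Any other witness falls under \<open>contract_octagon\<close>. The two
        remaining positions lead to \<open>y = gen 0\<close> and
        \<open>y = gen 1 \<circ> gen 0\<close>, where the side edges of the basic octagon that use
        \<open>gen 1\<close> start.\<close>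
      have mc: "m = - 1 \<or> m = - 2"
        using contract_octagon[OF y n'(3) _ _ w0(1) _ _ w0(2)] w0(3) ya a0 c0 by blast
      have right: "c < y 3" if k3: "2 < n"
      proof (rule ccontr)
        assume "\<not> ?thesis"
        moreover have "y 3 \<noteq> y 2" by (simp add: Bn_eq_iff[OF y])
        ultimately have "y m = y 3" using RR k0 k3 ya by simp
        then have "m = 3" using Bn_eq_iff[OF y] by blast
        then show False using mc by auto
      qed
      have far': "y (int l) < y (int l + 1)" if "3 \<le> l" "l < n" for l
        using far[of l] that k0 by simp
      from mc show False
      proof
        assume m1: "m = - 1"
        have "y \<circ> gen 0 = id"
        proof (rule window_id)
          show "0 < (y \<circ> gen 0) 1" using ya a0 by simp
          fix l assume l: "1 \<le> l" "l < n"
          consider "l = 1" | "l = 2" | "3 \<le> l" using l by linarith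
          then show "(y \<circ> gen 0) (int l) < (y \<circ> gen 0) (int l + 1)"
          proof cases
            case 1
            then show ?thesis using m1 asc ya by simp
          next
            case 2
            then show ?thesis using right l ya by simp
          next
            case 3
            then show ?thesis using far'[of l] l gen_fix[of l 0] by simp
          qed
        qed (use y n' in simp)
        then have yg: "y = gen 0" by (rule comp_gen_id)
        then have "1 \<in> U" using asc m1 by simp
        then show False using generator_0_up(1) n' w0(3) yg by blast
      next
        assume m2: "m = - 2"
        have cU: "- c \<in> U" "a < - c" using asc m2 ya by auto
        \<comment> \<open>Otherwise \<open>- y 3\<close> is a second entry inside the range. Moving
          it next to \<open>a\<close> gives a larger element to which \<open>contract_left\<close>
          applies, with the witness now at position \<open>- 3\<close>.\<close>
        have right': "- a < y 3" if k3: "2 < n"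
        proof (rule ccontr)
          assume "\<not> ?thesis"
          moreover have "y 3 \<noteq> - y 1" by (simp add: Bn_eq_uminus_iff[OF y])
          ultimately have s: "y 3 < - a" using ya by simp
          have n3: "Suc (Suc 0) < n" using k3 by simp
          let ?q = "y \<circ> gen (Suc (Suc 0))"
          let ?r = "?q \<circ> gen (Suc 0)"
          let ?p = "?r \<circ> gen 0"
          have B: "?q \<in> Bn n" "?r \<in> Bn n" "?p \<in> Bn n" using y n' n3 by simp_all
          have "Inv n y \<subseteq> Inv n ?q" using Inv_gen_asc[OF y n3] right[OF k3] ya by auto
          moreover have "Inv n ?q \<subseteq> Inv n ?r"
            using Inv_gen_asc[OF B(1) n'(2)] right[OF k3] ya a0 c0 by auto
          moreover have "Inv n ?r \<subseteq> Inv n ?p"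
            using Inv_gen_asc[OF B(2) n'(1)] right[OF k3] Bn_uminus[OF B(2), of 1] ya c0 by auto
          ultimately have up: "Inv n y \<subseteq> Inv n ?p" by blast
          have v: "?p 1 = - y 3" "?p 2 = a" "?p 3 = c"
            using neg[of 3] Bn_uminus[OF B(2), of 1] ya by simp_all
          have v': "?p (- 3) = - c" using Bn_uminus[OF B(3), of 3] unfolding v .
          have "(?p, ?p \<circ> gen (Suc 1)) \<in> \<Theta>"
          proof (rule contract_left[OF B(3)])
            show "witness n U ?p (Suc 1) (- 3)"
              unfolding witness_def v' using v cU c0 n3 by (simp add: SN_iff)
            have "?p (int 1 + 2) - ?p (int 1 + 1) = y 2 - y 1" using v ya by simp
            then show "narrow (?p (int 1 + 2) - ?p (int 1 + 1))" using w0(2) by metis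
          qed (use v s right[OF k3] c0 n3 ya in \<open>auto simp: neg\<close>)
          then have "(y, y \<circ> gen (Suc 0)) \<in> \<Theta>"
            by (intro slide_down[OF y n'(2) _ B(3) _ _ up]) (use v ya a0 c0 n3 in auto)
          then show False using w0(3) by blast
        qed
        have yid: "y \<circ> gen 0 \<circ> gen (Suc 0) = id"
        proof (rule window_id)
          show "0 < (y \<circ> gen 0 \<circ> gen (Suc 0)) 1" using ya c0 by simp
          fix l assume l: "1 \<le> l" "l < n"
          consider "l = 1" | "l = 2" | "3 \<le> l" using l by linarith
          then show "(y \<circ> gen 0 \<circ> gen (Suc 0)) (int l) < (y \<circ> gen 0 \<circ> gen (Suc 0)) (int l + 1)"
          proof cases
            case 1
            then show ?thesis using cU ya by simp
          next
            case 2
            then show ?thesis using right' l ya by simp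
          next
            case 3
            then show ?thesis using far'[of l] l gen_fix[of l 0] gen_fix[of l "Suc 0"] by simp
          qed
        qed (use y n' in simp)
        then have "y \<circ> gen 0 = gen (Suc 0)" by (rule comp_gen_id)
        then have yg: "y = gen (Suc 0) \<circ> gen 0" using gen_comp_gen(2)[of y 0] by simp
        then have "c = 1" using ya(2) by simp
        then have "1 \<notin> U" using cU(1) up_dn_mem[OF U, of 1] n' by (simp add: SN_iff)
        then show False using generator_0_down(2) n' w0(3) yg by blast
      qed
    qed
  qed
qed

text \<open>The exchanged entries are \<open>- y 1\<close> and \<open>y 1\<close>, so the cover is
  its own mirror image and the witness can be taken at a positive position, hence down. Arguments
  like those for \<open>contract_pos\<close> leave only \<open>y = gen 1\<close> and
  \<open>y = gen 0 \<circ> gen 1\<close>.\<close>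

lemma contract_zero:
  assumes y: "y \<in> Bn n" and n: "0 < n" and w: "witness n U y 0 m"
    and N: "narrow (2 * y 1)" and sm: "smaller y (2 * y 1)"
  shows "(y, y \<circ> gen 0) \<in> \<Theta>"
proof (rule ccontr)
  assume nT: "(y, y \<circ> gen 0) \<notin> \<Theta>"
  note neg = Bn_uminus[OF y]
  have sm': "smaller y (y (posr 0) - y (posl 0))" using sm neg by simp
  note slide = slide_smaller[OF y n w sm']
  have ysc: "y (posl 0) < y (posr 0)" using witness_ascent[OF w] .
  then have c0: "0 < y 1" using neg by simp
  obtain m where m: "2 \<le> m" "m \<in> SN n" "y m \<notin> U" "\<bar>y m\<bar> < y 1" and w: "witness n U y 0 m"
  proof -
    have mS: "m \<in> SN n" "y m \<in> SN n" "m \<noteq> 0" using w Bn_SN[OF y, of m] by (auto simp: witness_def SN_iff)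
    consider "1 < m" | "1 < - m" using w by (auto simp: witness_def)
    then show thesis
    proof cases
      case 1
      then show thesis using that[of m] w mS neg by (auto simp: witness_def)
    next
      case 2
      have "- y m \<notin> U" using w 2 up_dn_mem[OF U, of "- y m"] mS by (auto simp: witness_def)
      then show thesis using that[of "- m"] w mS neg 2 by (auto simp: witness_def)
    qed
  qed
  have n': "1 < n" "Suc 0 < n" using m by (auto simp: SN_iff)
  have far: "y (int l) < y (int l + 1)" if "2 \<le> l" "l < n" for l
    using far_ascent[OF y n w sm', of l] that nT by (simp add: pos_ge1 del: pos_Suc)
  have z1: "- y 1 < y 2"
  proof (rule ccontr)
    assume "\<not> ?thesis"
    moreover have "y 2 \<noteq> - y 1" by (simp add: Bn_eq_uminus_iff[OF y])
    ultimately have z: "y 2 < - y 1" by simp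
    let ?q = "y \<circ> gen (Suc 0)"
    let ?r = "?q \<circ> gen 0"
    let ?p = "?r \<circ> gen (Suc 0)"
    have B: "?q \<in> Bn n" "?r \<in> Bn n" "?p \<in> Bn n" using y n n' by simp_all
    have "Inv n ?q \<subset> Inv n y"
      using Inv_gen_desc[OF y n'(2)] z c0 by auto
    moreover have "Inv n ?r \<subset> Inv n ?q"
      using Inv_gen_desc[OF B(1) n] z c0 neg by auto
    moreover have "Inv n ?p \<subset> Inv n ?r"
      using Inv_gen_desc[OF B(2) n'(2)] z neg by auto
    ultimately have le: "Inv n ?p \<subset> Inv n y" by blast
    have "m \<noteq> 2" using z m by auto
    then have g: "gen 0 m = m" "gen (Suc 0) m = m" using m gen_outer by auto
    have "witness n U ?p 0 m"
      using g m w neg by (auto simp: witness_def)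
    then show False using slide[OF B(3) n _ le] nT neg by simp
  qed
  have cent: "m = 2" if "y 2 < y 1"
    using contract_center[OF y n'(1) _ w _ _ N] that z1 nT m(1) by force
  have Q: "y 2 \<le> y (int l)" if "2 \<le> l" "l \<le> n" for l
    using that
  proof (induction l rule: dec_induct)
    case base then show ?case by simp
  next
    case (step l)
    then show ?case using far[of l] by (simp add: add.commute)
  qed
  have "2 \<le> nat m" "nat m \<le> n" "int (nat m) = m" using m by (auto simp: SN_iff)
  then have zc: "y 2 < y 1" using Q[of "nat m"] m(4) by simp
  then have m2: "m = 2" by (rule cent)
  have right: "y 1 < y 3" if k3: "2 < n"
  proof (rule ccontr)
    assume "\<not> ?thesis"
    moreover have "y 3 \<noteq> y 1" by (simp add: Bn_eq_iff[OF y])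
    ultimately have s: "y 3 < y 1" by simp
    have n3: "Suc (Suc 0) < n" using k3 by simp
    let ?p = "y \<circ> gen (Suc (Suc 0))"
    have p: "?p \<in> Bn n" using y n3 by simp
    have lz: "y 2 < y 3" using far[of 2] k3 by simp
    have v: "?p 1 = y 1" "?p 2 = y 3" "?p 3 = y 2" by simp_all
    have v': "?p (- 1) = - y 1" using Bn_uminus[OF p, of 1] unfolding v .
    have "(?p, ?p \<circ> gen 0) \<in> \<Theta>"
    proof (rule contract_center[OF p n'(1)])
      show "witness n U ?p 0 3" unfolding witness_def pos_Suc v v' using m m2 n3 by (auto simp: SN_iff)
    qed (use N v s lz z1 in auto)
    then have "(y, y \<circ> gen 0) \<in> \<Theta>"
    proof (rule slide_down[OF y n ysc p n])
      show "Inv n y \<subseteq> Inv n ?p" using Inv_gen_asc[OF y n3] lz by auto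
    qed (unfold pos_Suc v v', use neg in auto)
    then show False using nT by blast
  qed
  have "y 2 \<noteq> 0" using Bn_SN[OF y, of 2] n' by (auto simp: SN_iff)
  then consider "0 < y 2" | "y 2 < 0" by linarith
  then show False
  proof cases
    case 1
    have "y \<circ> gen (Suc 0) = id"
    proof (rule window_id)
      show "0 < (y \<circ> gen (Suc 0)) 1" using 1 by simp
      fix l assume l: "1 \<le> l" "l < n"
      consider "l = 1" | "l = 2" | "3 \<le> l" using l by linarith
      then show "(y \<circ> gen (Suc 0)) (int l) < (y \<circ> gen (Suc 0)) (int l + 1)"
      proof cases
        case 3
        then show ?thesis using far[of l] l gen_fix[of l "Suc 0"] by simp
      qed (use zc right l in auto)
    qed (use y n' in simp)
    then have yg: "y = gen (Suc 0)" by (rule comp_gen_id)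
    then have "1 \<notin> U" using m m2 by simp
    then show False using generator_0_down(1) n' nT yg by blast
  next
    case 2
    have "y \<circ> gen (Suc 0) \<circ> gen 0 = id"
    proof (rule window_id)
      show "0 < (y \<circ> gen (Suc 0) \<circ> gen 0) 1" using 2 neg by simp
      fix l assume l: "1 \<le> l" "l < n"
      consider "l = 1" | "l = 2" | "3 \<le> l" using l by linarith
      then show "(y \<circ> gen (Suc 0) \<circ> gen 0) (int l) < (y \<circ> gen (Suc 0) \<circ> gen 0) (int l + 1)"
      proof cases
        case 3
        then show ?thesis using far[of l] l gen_fix[of l "Suc 0"] gen_fix[of l 0] by simp
      qed (use z1 right l neg in auto)
    qed (use y n n' in simp)
    then have "y \<circ> gen (Suc 0) = gen 0" by (rule comp_gen_id)
    then have yg: "y = gen 0 \<circ> gen (Suc 0)" using gen_comp_gen(2)[of y "Suc 0"] by simp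
    then have "- 1 \<notin> U" using m m2 by simp
    then have "1 \<in> U" using up_dn_mem[OF U, of "- 1"] n' by (simp add: SN_iff)
    then show False using generator_0_up(2) n' nT yg by blast
  qed
qed

text \<open>The outer induction on the width supplies \<open>narrow\<close>, the inner one on the
  number of inversions supplies \<open>smaller\<close>.\<close>

lemma contract:
  "y \<in> Bn n \<Longrightarrow> i < n \<Longrightarrow> witness n U y i m \<Longrightarrow> (y, y \<circ> gen i) \<in> \<Theta>"
proof (induction "nat (y (posr i) - y (posl i))" arbitrary: y i m rule: less_induct)
  case outer: less
  show ?case
    using outer.prems outer.hyps
  proof (induction "card (Inv n y)" arbitrary: y i m rule: less_induct)
    case less
    let ?w = "y (posr i) - y (posl i)"
    have N: "narrow ?w"
      unfolding narrow_def
    proof (intro allI impI)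
      fix p j m' assume "p \<in> Bn n" "j < n" "witness n U p j m'" "p (posr j) - p (posl j) < ?w"
      then show "(p, p \<circ> gen j) \<in> \<Theta>"
        using less.prems(4)[OF _ \<open>p \<in> Bn n\<close> \<open>j < n\<close>] witness_ascent[OF less.prems(3)] by simp
    qed
    have S: "smaller y ?w"
      unfolding smaller_def
    proof (intro allI impI)
      fix p j m' assume p: "p \<in> Bn n" "j < n" "witness n U p j m'" "p (posr j) - p (posl j) = ?w" "Inv n p \<subset> Inv n y"
      then have "card (Inv n p) < card (Inv n y)" by (intro psubset_card_mono) auto
      then show "(p, p \<circ> gen j) \<in> \<Theta>"
        using less.hyps[of p j m'] p(1-3) less.prems(4) unfolding p(4) by blast
    qed
    show ?case
    proof (cases i)
      case 0
      then show ?thesis using contract_zero[of y m] less.prems N S Bn_uminus[of y n 1] by simp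
    next
      case (Suc k)
      then show ?thesis using contract_pos[of y k m] less.prems N S by simp
    qed
  qed
qed

text \<open>The walk of \<open>etaB_interval\<close>, with \<open>contract\<close> in place of
  \<open>etaB_gen\<close>.\<close>

lemma interval_in:
  assumes x: "x \<in> Bn n"
  shows "w \<in> Bn n \<Longrightarrow> Inv n w \<subseteq> Inv n x \<Longrightarrow> bottom n U (Inv n x) \<subseteq> Inv n w \<Longrightarrow> (w, x) \<in> \<Theta>"
proof (induction "card (Inv n x - Inv n w)" arbitrary: w rule: less_induct)
  case less
  note w = less.prems(1)
  show ?case
  proof (cases "Inv n w = Inv n x")
    case True
    then show ?thesis using Inv_inject w x refl by blast
  next
    case False
    obtain j where j: "j < n" "w (posl j) < w (posr j)" "Inv n (w \<circ> gen j) \<subseteq> Inv n x"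
      using good_step[OF w good_Inv[OF x]] less.prems(2) False by blast
    have "(w (posl j), w (posr j)) \<notin> bottom n U (Inv n (w \<circ> gen j))"
      using bottom_mono[OF j(3)] less.prems(3) Inv_gen_notin(1)[OF w j(2)] by blast
    then obtain m where "witness n U w j m"
      using ex_witness[OF w _ j(1,2)] U unfolding up_dn_def by blast
    then have "(w, w \<circ> gen j) \<in> \<Theta>" using contract w j(1) by blast
    moreover have "(w \<circ> gen j, x) \<in> \<Theta>"
    proof (rule less.hyps)
      show "card (Inv n x - Inv n (w \<circ> gen j)) < card (Inv n x - Inv n w)"
        using Inv_gen_asc[OF w j(1,2)] j(3) by (intro psubset_card_mono) auto
      show "bottom n U (Inv n x) \<subseteq> Inv n (w \<circ> gen j)"
        using less.prems(3) Inv_gen_asc[OF w j(1,2)] by blast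
    qed (use w j in auto)
    ultimately show ?thesis by (rule trans)
  qed
qed

lemma etaB_fibres_in:
  assumes x: "x \<in> Bn n" and y: "y \<in> Bn n" and eq: "etaB n U x = etaB n U y"
  shows "(x, y) \<in> \<Theta>"
proof -
  obtain w where w: "w \<in> Bn n" "Inv n w = bottom n U (Inv n x)"
    using ex_bottom[OF x U] by blast
  have wy: "Inv n w = bottom n U (Inv n y)" using w etaB_eq_iff[OF x y U] eq by simp
  have "(w, x) \<in> \<Theta>"
    by (rule interval_in[OF x w(1)]) (unfold w(2), rule bottom_subset, rule subset_refl)
  moreover have "(w, y) \<in> \<Theta>"
    by (rule interval_in[OF y w(1)]) (unfold wy, rule bottom_subset, rule subset_refl)
  ultimately show ?thesis using sym trans by blast
qed

end

text \<open>Each relation spans a chain of one or two covers. For the edge between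
  \<open>b - 1\<close> and \<open>b\<close>, each cover has a witness with value \<open>b\<close> or
  \<open>- b\<close>; whether \<open>b\<close> is up or down decides which of the two chains has
  them, and this is the rule for the orientation.\<close>

lemma etaB_generators:
  assumes U: "up_dn n U" and st: "(s, t) \<in> orient n U"
  shows "gen t \<in> Bn n" "word_prod (altw t s (coxm s t - 1)) \<in> Bn n"
    "etaB n U (gen t) = etaB n U (word_prod (altw t s (coxm s t - 1)))"
proof -
  let ?word = "word_prod (altw t s (coxm s t - 1))"
  have "gen t \<in> Bn n \<and> ?word \<in> Bn n \<and> etaB n U ?word = etaB n U (gen t)"
  proof -
    consider (up) k where "s = Suc k" "t = k" "1 \<le> k" "Suc k < n" "int k + 1 \<in> U"
      | (down) k where "s = k" "t = Suc k" "1 \<le> k" "Suc k < n" "int k + 1 \<notin> U"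
      | (up0) "s = Suc 0" "t = 0" "1 < n" "1 \<in> U" | (down0) "s = 0" "t = Suc 0" "1 < n" "1 \<notin> U"
    proof -
      from st obtain b where b: "1 \<le> b" "b < n"
        "s = b \<and> t = b - 1 \<and> int b \<in> U \<or> s = b - 1 \<and> t = b \<and> int b \<notin> U"
        by (auto simp: orient_def)
      then obtain k where k: "b = Suc k" by (cases b) auto
      show thesis using that b unfolding k by (cases "k = 0") (auto simp: add.commute)
    qed
    then show ?thesis
    proof cases
      case up
      have B: "gen k \<in> Bn n" using up gen_Bn by simp
      have word: "?word = gen k \<circ> gen (Suc k)"
        using up by (simp add: coxm_def numeral_2_eq_2 word_prod_def)
      have "witness n U (gen k) (Suc k) (int k)" using up by (simp add: witness_def SN_iff)
      then show ?thesis using etaB_gen[OF B U, of "Suc k"] up B unfolding word by simp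
    next
      case down
      have B: "gen (Suc k) \<in> Bn n" using down gen_Bn by simp
      have word: "?word = gen (Suc k) \<circ> gen k"
        using down by (simp add: coxm_def numeral_2_eq_2 word_prod_def)
      have "witness n U (gen (Suc k)) k (int k + 2)" using down by (simp add: witness_def SN_iff pos_ge1)
      then show ?thesis using etaB_gen[OF B U, of k] down B unfolding word by simp
    next
      case up0
      have B: "gen 0 \<in> Bn n" "gen 0 \<circ> gen (Suc 0) \<in> Bn n" using up0 gen_Bn Bn_comp_gen by auto
      have word: "?word = gen 0 \<circ> gen (Suc 0) \<circ> gen 0"
        using up0 by (simp add: coxm_def numeral_3_eq_3 word_prod_def o_assoc)
      have "witness n U (gen 0) (Suc 0) (- 1)" using up0 by (simp add: witness_def SN_iff)
      moreover have "witness n U (gen 0 \<circ> gen (Suc 0)) 0 (- 2)" using up0 by (simp add: witness_def SN_iff)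
      ultimately show ?thesis
        using etaB_gen[OF B(1) U, of "Suc 0"] etaB_gen[OF B(2) U, of 0] up0 B unfolding word by simp
    next
      case down0
      have B: "gen (Suc 0) \<in> Bn n" "gen (Suc 0) \<circ> gen 0 \<in> Bn n" using down0 gen_Bn Bn_comp_gen by auto
      have word: "?word = gen (Suc 0) \<circ> gen 0 \<circ> gen (Suc 0)"
        using down0 by (simp add: coxm_def numeral_3_eq_3 word_prod_def o_assoc)
      have "- 1 \<in> U" using up_dn_mem[OF U, of 1] down0 by (simp add: SN_iff)
      then have "witness n U (gen (Suc 0) \<circ> gen 0) (Suc 0) (- 2)" using down0 by (simp add: witness_def SN_iff)
      moreover have "witness n U (gen (Suc 0)) 0 2" using down0 by (simp add: witness_def SN_iff)
      ultimately show ?thesis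
        using etaB_gen[OF B(1) U, of 0] etaB_gen[OF B(2) U, of "Suc 0"] down0 B unfolding word by simp
    qed
  qed
  then show "gen t \<in> Bn n" "?word \<in> Bn n" "etaB n U (gen t) = etaB n U ?word" by auto
qed

theorem theorem7p3:
  fixes n :: nat and U :: "int set"
  assumes "n \<ge> 1"
    and "U \<subseteq> SN n"
    and "\<forall>i\<in>SN n. i \<in> U \<longleftrightarrow> - i \<notin> U"
  shows "{(x, y). x \<in> Bn n \<and> y \<in> Bn n \<and> etaB n U x = etaB n U y}
           = cambrian_cong n (orient n U)"
proof -
  let ?R = "{(x, y). x \<in> Bn n \<and> y \<in> Bn n \<and> etaB n U x = etaB n U y}"
  have U: "up_dn n U" using assms(2,3) unfolding up_dn_def by blast
  have "?R \<subseteq> \<Theta>"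
    if "lat_cong n \<Theta>" "\<forall>(s, t) \<in> orient n U. (gen t, word_prod (altw t s (coxm s t - 1))) \<in> \<Theta>" for \<Theta>
  proof -
    interpret cambrian n U \<Theta> using U that by unfold_locales auto
    show ?thesis using etaB_fibres_in by auto
  qed
  then have "?R \<subseteq> cambrian_cong n (orient n U)" unfolding cambrian_cong_def by blast
  moreover have "cambrian_cong n (orient n U) \<subseteq> ?R"
  proof -
    have "\<forall>(s, t) \<in> orient n U. (gen t, word_prod (altw t s (coxm s t - 1))) \<in> ?R"
      using etaB_generators[OF U] by auto
    then show ?thesis using lat_cong_etaB[OF U] unfolding cambrian_cong_def by blast
  qed
  ultimately show ?thesis by blast
qed

end
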